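(* Let $f\in K((x))[y]$ be a monic reduced polynomial with irreducible components $f_1,\dots,f_{\xi(f)}$ in $K((x))[y]$, and let $P_i^M$ be a point of the tree $T(f)$ with $P_i^M\notin \mathrm{Top}(f)$. Let $P_{i_1}^{N_1},\dots,P_{i_t}^{N_t}$ be the points that strictly dominate $P_i^M$, and let $\theta$ be the smallest integer such that $M\le m_\theta^F/n_F$ for all $F\in P_i^M$. Let $A$ (resp. $B$) be the set of $1\le l\le t$ for which $M=m_\theta^F/n_F$ (resp. $M<m_\theta^F/n_F$) for all $F\in P_{i_l}^{N_l}$, and let $a$ (resp. $b$) be the cardinality of $A$ (resp. $B$). Let $(l_1,l_2)\in A\times B$, $F_{l_1}\in P_{i_{l_1}}^{N_{l_1}}$ and $F_{l_2}\in P_{i_{l_2}}^{N_{l_2}}$ (if $A=\emptyset$, the term with factor $a$ below is read as $0$; if $B=\emptyset$, $F_{l_2}$ is any element of $P_i^M$). Then the component $Q_{f_y}(M,i)$ of $f_y$ satisfies: (i) $$\deg_y Q_{f_y}(M,i)=a\,\frac{n_{F_{l_1}}}{d_{\theta+1}^{F_{l_1}}}+(b-1)\,\frac{n_{F_{l_2}}}{d_\theta^{F_{l_2}}}+\sum_{F\in D_i^M}n_F .$$ Moreover, when $D_i^M\ne\emptyset$, for each $F\in D_i^M$ the integer $h_F$ is $\theta-1$ or $\theta$ according as $M>m_{h_F}^F/n_F$ or $M=m_{h_F}^F/n_F$, and $\sum_{F\in D_i^M}n_F$ is given as follows. If $M>m_{h_F}^F/n_F$ for all $F\in D_i^M$,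 or $M=m_{h_F}^F/n_F$ for all $F\in D_i^M$, then $n_F$ has a common value $n(D)$ on $D_i^M$ and the sum is $\mathrm{card}(D_i^M)\,n(D)$. Otherwise there is exactly one $F'\in D_i^M$ with $M>m^{F'}_{h_{F'}}/n_{F'}$; the values $n_F$ and $d^F_{h_F}$ have common values $n(D)$ and $d(D)$ for $F\in D_i^M\setminus\{F'\}$, and the sum is $(\mathrm{card}(D_i^M)-1)\,n(D)+n(D)/d(D)$. (ii) For every irreducible component $P$ of $Q_{f_y}(M,i)$ and every $F\in P_i^M$, $c(F,P)=M$. (iii) For every irreducible component $P$ of $Q_{f_y}(M,i)$ and every irreducible component $F$ of $f$ with $F\notin P_i^M$, $c(F,P)=c(F,P_i^M)<M$. (iv) For all $1\le k\le\xi(f)$: if $f_k\in P_i^M$ then $\mathrm{int}(f_k,Q_{f_y}(M,i))=S(m^{f_k},M)\,\dfrac{\deg_yQ_{f_y}(M,i)}{n_{f_k}}$; if $f_k\notin P_i^M$ then $\mathrm{int}(f_k,Q_{f_y}(M,i))=S(m^{f_k},c(f_k,P_i^M))\,\dfrac{\deg_yQ_{f_y}(M,i)}{n_{f_k}}$.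
   Context: $K$ is an algebraically closed field of characteristic $0$. $O_x$ denotes the order in $x$ of a series in $K((x^{1/p}))$, $O_x(0)=+\infty$. $f_y$ is the $y$-derivative of $f$; "irreducible components" are the monic irreducible factors in $K((x))[y]$. Characteristic sequences. Let $F\in K((x))[y]$ be monic irreducible of degree $n_F$ in $y$. By Newton's theorem its roots are $y(w^kx^{1/n_F})$, $1\le k\le n_F$, where $w$ is a primitive $n_F$-th root of unity and $y(t)=\sum a_it^i\in K((t))$ satisfies $F(t^{n_F},y(t))=0$; $\mathrm{supp}(F)=\{i:a_i\ne0\}$. Put $d_1^F=n_F$ and for $k\ge1$, while $d_k^F>1$, $m_k^F=\inf\{i\in\mathrm{supp}(F): d_k^F\nmid i\}$, $d_{k+1}^F=\gcd(d_k^F,m_k^F)$; $h_F$ is the integer with $d_{h_F+1}^F=1$ first attained ($h_F=0$ if $n_F=1$), and $m_{h_F+1}^F=+\infty$. Put $r_1^F=m_1^F$, $r_k^F=r_{k-1}^Fd_{k-1}^F/d_k^F+m_k^F-m_{k-1}^F$ for $2\le k\le h_F$, and $e_k^F=d_k^F/d_{k+1}^F$ for $1\le k\le h_F$. If $h_F=0$, the condition $M>m_{h_F}^F/n_F$ is regarded as true. Contact and intersection. For monic irreducible $F,G$, $c(F,G)=\max O_x(y-z)$ over roots $y$ of $F$, $z$ of $G$ (so $c(F,F)=+\infty$). For irreducible $F$ and any $H\in K((x))[y]$, $\mathrm{int}(F,H)=n_F\,O_xH(x,y(x))$ with $y(x)$ a root of $F$. For $M\in\mathbb R$, $S(m^F,M)=r_k^Fd_k^F+(n_FM-m_k^F)d_{k+1}^F$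 if $m_k^F/n_F\le M<m_{k+1}^F/n_F$ with $1\le k\le h_F$, and $S(m^F,M)=n_FMd_1^F$ if $M<m_1^F/n_F$. Tree. Let $f=f_1\cdots f_{\xi(f)}$ be the factorization. $C(f)=\{c(f_p,f_q):p\ne q\}\cup\bigcup_k\{m_1^{f_k}/n_{f_k},\dots,m_{h_{f_k}}^{f_k}/n_{f_k}\}$. For $M\in C(f)$, $C_M(f)$ is the set of components $f_p$ such that $c(f_p,f_q)\ge M$ for some $q\neq p$, or $m_j^{f_p}/n_{f_p}\ge M$ for some $1\le j\le h_{f_p}$. On $C_M(f)$, $f_pR_Mf_q$ iff $p=q$ or $c(f_p,f_q)\ge M$; this is an equivalence relation, and its classes $P_1^M,\dots,P_{s_M}^M$ are the points of $T(f)$ at level $M$ (points at different levels are regarded as different). $P_j^N$ dominates $P_i^M$ if $N\ge M$ and $P_j^N\subseteq P_i^M$; it strictly dominates $P_i^M$ if moreover $N>M$ and $C(f)\cap\,]M,N[\,=\emptyset$. $\mathrm{Top}(f)$ is the set of maximal points. $D_i^M$ is the set of elements of $P_i^M$ lying in no point strictly dominating $P_i^M$. If $F$ is a component of $f$ not in $P_i^M$, then $c(F,G)$ is the same for all $G\in P_i^M$ and is denoted $c(F,P_i^M)$. $Q_H(M,i)$ is the product (with multiplicities) of the irreducible components of $H$ whose contact with every element of $P_i^M$ equals $M$. The quotient $n_F/d_\theta^F$ is independent of $F\in P_i^M$. *)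

theory Defs
  imports
    "HOL-Library.Extended_Real"
    "HOL-Computational_Algebra.Computational_Algebra"
    "HOL-Computational_Algebra.Field_as_Ring"
begin

text \<open>
  Trivial gcd structure on the field of Laurent series, as the library has it for the real numbers;
  it makes \<^typ>\<open>'a fls poly\<close> a factorial ring and so gives access to \<^const>\<open>multiplicity\<close>.
\<close>

instantiation fls :: (field)
  "{unique_euclidean_ring, normalization_euclidean_semiring, normalization_semidom_multiplicative}"
begin

definition [simp]: "normalize_fls = (normalize_field :: 'a fls \<Rightarrow> _)"
definition [simp]: "unit_factor_fls = (unit_factor_field :: 'a fls \<Rightarrow> _)"
definition [simp]: "modulo_fls = (mod_field :: 'a fls \<Rightarrow> _)"
definition [simp]: "euclidean_size_fls = (euclidean_size_field :: 'a fls \<Rightarrow> _)"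
definition [simp]: "division_segment (x :: 'a fls) = 1"

instance
  by standard
    (simp_all add: dvd_field_iff field_split_simps split: if_splits)

end

instantiation fls :: (field) euclidean_ring_gcd
begin

definition gcd_fls :: "'a fls \<Rightarrow> 'a fls \<Rightarrow> 'a fls" where
  "gcd_fls = Euclidean_Algorithm.gcd"
definition lcm_fls :: "'a fls \<Rightarrow> 'a fls \<Rightarrow> 'a fls" where
  "lcm_fls = Euclidean_Algorithm.lcm"
definition Gcd_fls :: "'a fls set \<Rightarrow> 'a fls" where
  "Gcd_fls = Euclidean_Algorithm.Gcd"
definition Lcm_fls :: "'a fls set \<Rightarrow> 'a fls" where
  "Lcm_fls = Euclidean_Algorithm.Lcm"

instance by standard (simp_all add: gcd_fls_def lcm_fls_def Gcd_fls_def Lcm_fls_def)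

end

instance fls :: (field) field_gcd ..


text \<open>
  \<open>K((x))[y]\<close> is \<^typ>\<open>'a fls poly\<close>: the polynomial variable is \<open>y\<close>, the Laurent variable is \<open>x\<close>.
  An element of \<open>K((x\<^sup>1\<^sup>/\<^sup>p))\<close> is represented by the Laurent series in \<open>t = x\<^sup>1\<^sup>/\<^sup>p\<close>, with \<open>p\<close> kept
  alongside; the inclusion of \<open>K((x))\<close> is then \<open>x = t\<^sup>p\<close>.
\<close>

definition subst_power :: "nat \<Rightarrow> 'a :: field fls poly \<Rightarrow> 'a fls poly" where
  "subst_power p F = map_poly (\<lambda>c. fls_compose_power c p) F"

definition puiseux_ord :: "nat \<Rightarrow> 'a :: field fls \<Rightarrow> ereal" where
  "puiseux_ord p u = (if u = 0 then \<infinity> else ereal (of_int (fls_subdegree u) / of_nat p))"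

definition puiseux_roots :: "nat \<Rightarrow> 'a :: field fls poly \<Rightarrow> 'a fls set" where
  "puiseux_roots p F = {y. poly (subst_power p F) y = 0}"

definition components :: "'a :: field fls poly \<Rightarrow> 'a fls poly set" where
  "components f = {F. lead_coeff F = 1 \<and> irreducible F \<and> F dvd f}"


subsection \<open>Characteristic sequences\<close>

text \<open>
  All indices \<open>k\<close> below start at \<open>1\<close>, as in \<open>d\<^sub>1, d\<^sub>2, \<dots>\<close>; the values at \<open>k = 0\<close> are dummies.
  The root \<open>y(t)\<close> is determined by \<open>F\<close> only up to \<open>t \<mapsto> w t\<close> with \<open>w\<close> a root of unity, which does
  not change its support.
\<close>

definition newton_root :: "'a :: field fls poly \<Rightarrow> 'a fls" where
  "newton_root F = (SOME y. y \<in> puiseux_roots (degree F) F)"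

definition supp :: "'a :: field fls poly \<Rightarrow> int set" where
  "supp F = {i. fls_nth (newton_root F) i \<noteq> 0}"

fun char_d :: "'a :: field fls poly \<Rightarrow> nat \<Rightarrow> nat" where
  "char_d F 0 = degree F"
| "char_d F (Suc 0) = degree F"
| "char_d F (Suc (Suc k)) =
     nat (gcd (int (char_d F (Suc k)))
              (Inf {i \<in> supp F. \<not> int (char_d F (Suc k)) dvd i}))"

text \<open>Meaningful only for \<open>1 \<le> k \<le> h\<^sub>F\<close>; the convention \<open>m\<^sub>h\<^sub>+\<^sub>1 = \<infinity>\<close> is in \<open>char_exponent\<close>.\<close>

definition char_m :: "'a :: field fls poly \<Rightarrow> nat \<Rightarrow> int" where
  "char_m F k = Inf {i \<in> supp F. \<not> int (char_d F k) dvd i}"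

definition char_h :: "'a :: field fls poly \<Rightarrow> nat" where
  "char_h F = (LEAST h. char_d F (Suc h) = 1)"

definition char_exponent :: "'a :: field fls poly \<Rightarrow> nat \<Rightarrow> ereal" where
  "char_exponent F k =
     (if k \<le> char_h F then ereal (of_int (char_m F k) / of_nat (degree F)) else \<infinity>)"

fun char_r :: "'a :: field fls poly \<Rightarrow> nat \<Rightarrow> real" where
  "char_r F 0 = 0"
| "char_r F (Suc 0) = of_int (char_m F 1)"
| "char_r F (Suc (Suc k)) =
     char_r F (Suc k) * of_nat (char_d F (Suc k)) / of_nat (char_d F (Suc (Suc k)))
     + of_int (char_m F (Suc (Suc k))) - of_int (char_m F (Suc k))"

definition above_last_exponent :: "'a :: field fls poly \<Rightarrow> real \<Rightarrow> bool" where
  "above_last_exponent F M \<longleftrightarrow> char_h F = 0 \<or> char_exponent F (char_h F) < ereal M"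

definition at_last_exponent :: "'a :: field fls poly \<Rightarrow> real \<Rightarrow> bool" where
  "at_last_exponent F M \<longleftrightarrow> char_h F \<noteq> 0 \<and> char_exponent F (char_h F) = ereal M"


subsection \<open>Contact and intersection\<close>

text \<open>Any two Puiseux series have a common denominator \<open>p\<close>, so nothing is lost by taking both
  roots in the same \<open>K((x\<^sup>1\<^sup>/\<^sup>p))\<close>.\<close>

definition contact :: "'a :: field fls poly \<Rightarrow> 'a fls poly \<Rightarrow> ereal" where
  "contact F G =
     Max {puiseux_ord p (y - z) | p y z. 0 < p \<and> y \<in> puiseux_roots p F \<and> z \<in> puiseux_roots p G}"

definition intersection :: "'a :: field fls poly \<Rightarrow> 'a fls poly \<Rightarrow> ereal" where
  "intersection F H =
     ereal (of_nat (degree F)) *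
     puiseux_ord (degree F) (poly (subst_power (degree F) H) (newton_root F))"

definition char_S :: "'a :: field fls poly \<Rightarrow> real \<Rightarrow> real" where
  "char_S F M =
     (if ereal M < char_exponent F 1 then of_nat (degree F) * M * of_nat (char_d F 1)
      else let k = (THE k. 1 \<le> k \<and> k \<le> char_h F \<and>
                       char_exponent F k \<le> ereal M \<and> ereal M < char_exponent F (k + 1))
           in char_r F k * of_nat (char_d F k)
              + (of_nat (degree F) * M - of_int (char_m F k)) * of_nat (char_d F (k + 1)))"


subsection \<open>The tree of \<open>f\<close>\<close>

definition tree_levels :: "'a :: field fls poly \<Rightarrow> real set" where
  "tree_levels f =
     {M. \<exists>F\<in>components f. \<exists>G\<in>components f. F \<noteq> G \<and> contact F G = ereal M} \<union>
     {M. \<exists>F\<in>components f. \<exists>k\<in>{1..char_h F}. char_exponent F k = ereal M}"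

definition level_components :: "'a :: field fls poly \<Rightarrow> real \<Rightarrow> 'a fls poly set" where
  "level_components f M =
     {F \<in> components f. (\<exists>G\<in>components f. G \<noteq> F \<and> ereal M \<le> contact F G) \<or>
                        (\<exists>j\<in>{1..char_h F}. ereal M \<le> char_exponent F j)}"

definition level_rel :: "'a :: field fls poly \<Rightarrow> real \<Rightarrow> ('a fls poly \<times> 'a fls poly) set" where
  "level_rel f M = {(F, G). F \<in> level_components f M \<and> G \<in> level_components f M \<and>
                            (F = G \<or> ereal M \<le> contact F G)}"

text \<open>Points carry their level, so equal classes at different levels are different points.\<close>

type_synonym 'a tree_point = "real \<times> 'a fls poly set"

definition tree_points :: "'a :: field fls poly \<Rightarrow> 'a tree_point set" where
  "tree_points f = {(M, P). M \<in> tree_levels f \<and> P \<in> level_components f M // level_rel f M}"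

definition dominates :: "'a :: field tree_point \<Rightarrow> 'a tree_point \<Rightarrow> bool" where
  "dominates q p \<longleftrightarrow> fst p \<le> fst q \<and> snd q \<subseteq> snd p"

definition strictly_dominates ::
    "'a :: field fls poly \<Rightarrow> 'a tree_point \<Rightarrow> 'a tree_point \<Rightarrow> bool" where
  "strictly_dominates f q p \<longleftrightarrow>
     dominates q p \<and> fst p < fst q \<and> tree_levels f \<inter> {fst p<..<fst q} = {}"

definition tree_top :: "'a :: field fls poly \<Rightarrow> 'a tree_point set" where
  "tree_top f = {p \<in> tree_points f. \<forall>q\<in>tree_points f. dominates q p \<longrightarrow> q = p}"

definition strict_dominators :: "'a :: field fls poly \<Rightarrow> 'a tree_point \<Rightarrow> 'a tree_point set" where
  "strict_dominators f p = {q \<in> tree_points f. strictly_dominates f q p}"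

definition point_D :: "'a :: field fls poly \<Rightarrow> 'a tree_point \<Rightarrow> 'a fls poly set" where
  "point_D f p = snd p - (\<Union>q\<in>strict_dominators f p. snd q)"

definition contact_point :: "'a :: field fls poly \<Rightarrow> 'a fls poly set \<Rightarrow> ereal" where
  "contact_point F P = (THE c. \<forall>G\<in>P. contact F G = c)"

definition Q_part :: "'a :: field fls poly \<Rightarrow> 'a tree_point \<Rightarrow> 'a fls poly" where
  "Q_part H p =
     (\<Prod>G \<in> {G \<in> components H. \<forall>F\<in>snd p. contact F G = ereal (fst p)}. G ^ multiplicity G H)"

end

(*
  A common ramification index N makes all roots of f and f_y Laurent series in t = x^(1/N). The
  cyclic group generated by t -> w t, with w a primitive N-th root of unity, permutes them, and the
  roots of an irreducible component form one orbit. Two series agree below order c iff they lie in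
  a common ultrametric ball, and by the Newton polygon a ball that contains k > 0 roots of f contains
  exactly k - 1 roots of f_y (characteristic 0). The roots of Q are the roots of f_y in the balls
  of level M around the roots of P that lie in none of the balls of the next smaller radius;
  subtracting the two counts, deg Q is the number of small balls minus the number of large ones.
  The roots of a class of components that are close at the given radius lie in n_F / d_k^F balls, for
  any F in the class, and the strictly dominating points together with D partition the small balls. The intersection number is a double sum over pairs of
  roots; summing over the conjugates of the root of f_k first gives the value S at each root of Q.
*)
theory Submission
  imports Defs
begin

text \<open>Orders in t are integers, so with M = c/N the next smaller radius is just c + 1,
  whatever the next level of the tree is; comparisons of contacts become statements on coefficients
  below an integer exponent. The obstacle is that characteristic exponents are read off one chosen
  root of each component, while the claim compares several components. The link is
  \<open>period F c\<close>, the number of balls of radius c met by the roots of F: it is a quotient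
  n_F/d_k, its jumps in c are exactly the characteristic exponents, and up to level c it is the same
  for any two components of contact at least c/N. Hence \<theta> and n_F/d_\<theta> are constant on
  the class, and crossing level M either keeps this number (the points in B) or raises it to
  n_F/d_{\<theta>+1} (the points in A). The jumps also give the uniqueness of F': two components
  without a jump at M, in a class where another one jumps, both have coefficient 0 there and so have
  contact greater than M.\<close>

unbundle fps_syntax

subsection \<open>Substituting a power of the variable\<close>

lemma fls_compose_power_sum:
  "fls_compose_power (\<Sum>i\<in>A. f i) d = (\<Sum>i\<in>A. fls_compose_power (f i) d)"
  for f :: "'b \<Rightarrow> 'a :: ab_group_add fls"
  by (induction A rule: infinite_finite_induct) auto

lemma fps_to_fls_sum: "fps_to_fls (\<Sum>i\<in>A. f i) = (\<Sum>i\<in>A. fps_to_fls (f i))"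
  by (induction A rule: infinite_finite_induct) auto

lemma fls_compose_power_eq_0_iff:
  assumes "d > 0"
  shows "fls_compose_power f d = 0 \<longleftrightarrow> f = 0"
proof
  assume "fls_compose_power f d = 0"
  then have "fls_compose_power f d $$ (int d * i) = 0" for i
    by simp
  with assms show "f = 0"
    by (intro fls_eqI) (simp add: fls_nth_compose_power)
qed simp

lemma fls_compose_power_eq_iff:
  fixes f g :: "'a :: ab_group_add fls"
  assumes "d > 0"
  shows "fls_compose_power f d = fls_compose_power g d \<longleftrightarrow> f = g"
  using fls_compose_power_eq_0_iff[OF assms, of "f - g"] by simp

lemma fls_compose_power_compose_power:
  assumes "d > 0" "e > 0"
  shows "fls_compose_power (fls_compose_power f d) e = fls_compose_power f (d * e)"
proof (rule fls_eqI)
  fix n :: int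
  have "int (d * e) dvd n \<longleftrightarrow> int e dvd n \<and> int d dvd n div int e"
    using assms by (auto simp: mult.commute elim!: dvdE)
  then show "fls_compose_power (fls_compose_power f d) e $$ n = fls_compose_power f (d * e) $$ n"
    using assms zdiv_zmult2_eq[of "int d" n "int e"] zdiv_zmult2_eq[of "int e" n "int d"]
    by (simp add: fls_nth_compose_power mult.commute)
qed

lemma fls_compose_power_1_right [simp]: "fls_compose_power f (Suc 0) = f"
  by (rule fls_eqI) (simp add: fls_nth_compose_power)

lemma fls_subdegree_compose_power:
  assumes "d > 0"
  shows "fls_subdegree (fls_compose_power f d) = int d * fls_subdegree f"
proof (cases "f = 0")
  case False
  show ?thesis
  proof (rule fls_subdegree_eqI)
    show "fls_compose_power f d $$ (int d * fls_subdegree f) \<noteq> 0"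
      using assms False by (simp add: fls_nth_compose_power)
    fix k assume k: "k < int d * fls_subdegree f"
    show "fls_compose_power f d $$ k = 0"
    proof (cases "int d dvd k")
      case True
      then obtain j where "k = int d * j" by blast
      with k assms show ?thesis by (simp add: fls_nth_compose_power)
    qed (use assms in \<open>simp add: fls_nth_compose_power\<close>)
  qed
qed simp

lemma coeff_subst_power: "coeff (subst_power d F) i = fls_compose_power (coeff F i) d"
  by (simp add: subst_power_def coeff_map_poly)

lemma degree_subst_power: "d > 0 \<Longrightarrow> degree (subst_power d F) = degree F"
  unfolding subst_power_def
  by (cases "F = 0") (auto intro!: map_poly_degree_eq simp: fls_compose_power_eq_0_iff)

lemma subst_power_0 [simp]: "subst_power d 0 = 0"
  by (simp add: subst_power_def)

lemma subst_power_eq_0_iff: "d > 0 \<Longrightarrow> subst_power d F = 0 \<longleftrightarrow> F = 0"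
  by (auto simp: poly_eq_iff coeff_subst_power fls_compose_power_eq_0_iff)

lemma subst_power_add: "subst_power d (F + G) = subst_power d F + subst_power d G"
  by (simp add: poly_eq_iff coeff_subst_power)

lemma subst_power_mult: "subst_power d (F * G) = subst_power d F * subst_power d G"
  by (simp add: poly_eq_iff coeff_subst_power coeff_mult fls_compose_power_sum)

lemma subst_power_1 [simp]: "d > 0 \<Longrightarrow> subst_power d 1 = 1"
  by (simp add: poly_eq_iff coeff_subst_power)

lemma subst_power_power: "d > 0 \<Longrightarrow> subst_power d (F ^ n) = subst_power d F ^ n"
  by (induction n) (simp_all add: subst_power_mult)

lemma subst_power_prod:
  "d > 0 \<Longrightarrow> subst_power d (\<Prod>i\<in>A. F i) = (\<Prod>i\<in>A. subst_power d (F i))"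
  by (induction A rule: infinite_finite_induct) (simp_all add: subst_power_mult)

lemma subst_power_pCons:
  "subst_power d (pCons a F) = pCons (fls_compose_power a d) (subst_power d F)"
  by (simp add: poly_eq_iff coeff_subst_power coeff_pCons split: nat.splits)

lemma subst_power_pcompose:
  "subst_power d (F \<circ>\<^sub>p G) = subst_power d F \<circ>\<^sub>p subst_power d G"
  by (induction F) (simp_all add: pcompose_pCons subst_power_pCons subst_power_add subst_power_mult)

lemma subst_power_smult:
  "subst_power d (smult c F) = smult (fls_compose_power c d) (subst_power d F)"
  by (simp add: poly_eq_iff coeff_subst_power)

lemma subst_power_pderiv:
  fixes F :: "'a :: field fls poly"
  assumes "d > 0"
  shows "subst_power d (pderiv F) = pderiv (subst_power d F)"
proof -
  have "fls_compose_power (of_nat n :: 'a fls) d = of_nat n" for n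
    using assms by (induction n) simp_all
  then have "fls_compose_power (1 + of_nat n :: 'a fls) d = 1 + of_nat n" for n
    using assms by simp
  then show ?thesis
    by (simp add: poly_eq_iff coeff_subst_power coeff_pderiv)
qed

lemma subst_power_subst_power:
  "d > 0 \<Longrightarrow> e > 0 \<Longrightarrow> subst_power e (subst_power d F) = subst_power (d * e) F"
  by (simp add: poly_eq_iff coeff_subst_power fls_compose_power_compose_power)

lemma subst_power_1_left [simp]: "subst_power (Suc 0) F = F"
  by (simp add: poly_eq_iff coeff_subst_power)

lemma poly_subst_power:
  "poly (subst_power d F) (fls_compose_power y d) = fls_compose_power (poly F y) d"
  by (induction F) (simp_all add: subst_power_pCons)


subsection \<open>Hensel's lemma\<close>

text \<open>Euclidean algorithm, by recursion on the size of \<open>q\<close>. The common divisor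
  appears as an explicit combination; it serves over \<open>K\<close> in Hensel lifting and over
  \<open>K((x))\<close> for polynomials with a common root.\<close>

lemma poly_bezout:
  fixes p q :: "'a :: field poly"
  shows "\<exists>u v. u * p + v * q dvd p \<and> u * p + v * q dvd q"
proof (induction "euclidean_size q" arbitrary: p q rule: less_induct)
  case less
  show ?case
  proof (cases "q = 0")
    case True
    then show ?thesis
      by (intro exI[of _ 1] exI[of _ 0]) simp
  next
    case False
    then have "euclidean_size (p mod q) < euclidean_size q"
      by (rule mod_size_less)
    from less[OF this, of q] obtain u v
      where uv: "u * q + v * (p mod q) dvd q" "u * q + v * (p mod q) dvd p mod q"
      by blast
    have eq: "u * q + v * (p mod q) = v * p + (u - v * (p div q)) * q"
      by (subst (1) minus_div_mult_eq_mod[symmetric]) (simp add: algebra_simps)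
    show ?thesis
      using uv unfolding eq
      by (intro exI[of _ v] exI[of _ "u - v * (p div q)"]) (auto dest: dvd_mod_imp_dvd)
  qed
qed

text \<open>The cofactor of \<open>h\<close> is reduced modulo \<open>g\<close> and the quotient
  moved to the other term; the bound on \<open>degree R\<close> then forces the degree of
  \<open>B\<close>.\<close>

lemma coprime_poly_diophantine:
  fixes g h R :: "'a :: field poly"
  assumes "coprime g h" "degree g > 0" "degree h > 0" "degree R < degree g + degree h"
  shows "\<exists>A B. g * B + h * A = R \<and> degree A < degree g \<and> degree B < degree h"
proof -
  obtain u v where "u * g + v * h dvd g" "u * g + v * h dvd h"
    using poly_bezout by blast
  with assms(1) have "u * g + v * h dvd 1"
    by (simp add: coprime_def)
  then obtain w where w: "1 = (u * g + v * h) * w" by blast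
  define A where "A = (v * w * R) mod g"
  define B where "B = u * w * R + h * ((v * w * R) div g)"
  have "g * B + h * A = ((u * g + v * h) * w) * R"
    by (simp add: A_def B_def minus_div_mult_eq_mod[symmetric] algebra_simps)
  then have eq: "g * B + h * A = R" using w by simp
  have A: "degree A < degree g"
    using assms(2) degree_mod_less[of g "v * w * R"] unfolding A_def by (metis degree_0 less_numeral_extra(3))
  have "degree B < degree h"
  proof (cases "B = 0")
    case False
    have "degree (h * A) < degree g + degree h"
      using A degree_mult_le[of h A] by linarith
    with assms(4) have "degree (R - h * A) < degree g + degree h"
      using degree_diff_less by blast
    moreover from eq have "R - h * A = g * B" by (simp add: algebra_simps)
    moreover have "degree (g * B) = degree g + degree B"
      using False assms(2) by (subst degree_mult_eq) auto
    ultimately show ?thesis by simp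
  qed (use assms in simp)
  with eq A show ?thesis by blast
qed

text \<open>Polynomials over \<open>K[[t]]\<close> are handled as sequences of polynomials over \<open>K\<close>, the coefficients
  of the powers of \<open>t\<close>; the factors are found one power at a time.\<close>

lemma hensel_sequence:
  fixes G :: "nat \<Rightarrow> 'a :: field poly"
  assumes "coprime g h" "degree g > 0" "degree h > 0" "G 0 = g * h"
    and deg: "\<And>k. k > 0 \<Longrightarrow> degree (G k) < degree g + degree h"
  shows "\<exists>P H. P 0 = g \<and> H 0 = h \<and> (\<forall>k>0. degree (P k) < degree g \<and> degree (H k) < degree h) \<and>
    (\<forall>k. G k = (\<Sum>i\<le>k. P i * H (k - i)))"
proof -
  \<comment> \<open>Comparing coefficients of \<open>t^n\<close> in the product leaves one linear
    equation for the pair \<open>(P n, H n)\<close>. The degree bounds on earlier pairs keep its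
    right side in the range where it is solvable.\<close>
  define S where "S = (\<lambda>f n r. if n = 0 then r = (g, h) else
     degree (fst r) < degree g \<and> degree (snd r) < degree h \<and>
     g * snd r + h * fst r = G n - (\<Sum>i\<in>{1..<n}. fst (f i) * snd (f (n - i) :: 'a poly \<times> 'a poly)))"
  have "\<exists>f. \<forall>n. S f n (f n)"
  proof (rule dependent_wf_choice[of less_than], simp)
    fix f f' :: "nat \<Rightarrow> 'a poly \<times> 'a poly" and n r
    assume "\<And>z. (z, n) \<in> less_than \<Longrightarrow> f z = f' z"
    then have "(\<Sum>i\<in>{1..<n}. fst (f i) * snd (f (n - i))) = (\<Sum>i\<in>{1..<n}. fst (f' i) * snd (f' (n - i)))"
      by (intro sum.cong) auto
    then show "S f n r = S f' n r" by (simp add: S_def)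
  next
    fix n f assume IH: "\<And>y. (y, n) \<in> less_than \<Longrightarrow> S f y (f y)"
    show "\<exists>r. S f n r"
    proof (cases "n = 0")
      case False
      have "degree (G n - (\<Sum>i\<in>{1..<n}. fst (f i) * snd (f (n - i)))) < degree g + degree h"
      proof (rule degree_diff_less)
        show "degree (\<Sum>i\<in>{1..<n}. fst (f i) * snd (f (n - i))) < degree g + degree h"
        proof (rule degree_sum_less)
          fix i assume i: "i \<in> {1..<n}"
          then have "S f i (f i)" "S f (n - i) (f (n - i))" using IH by auto
          with i have "degree (fst (f i)) < degree g" "degree (snd (f (n - i))) < degree h"
            by (auto simp: S_def)
          then show "degree (fst (f i) * snd (f (n - i))) < degree g + degree h"
            using degree_mult_le[of "fst (f i)" "snd (f (n - i))"] by linarith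
        qed (use assms in simp)
      qed (use False deg in simp)
      from coprime_poly_diophantine[OF assms(1-3) this] show ?thesis
        using False by (auto simp: S_def)
    qed (simp add: S_def)
  qed
  then obtain f where f: "\<And>n. S f n (f n)" by blast
  have f0: "f 0 = (g, h)" using f[of 0] by (simp add: S_def)
  have "G k = (\<Sum>i\<le>k. fst (f i) * snd (f (k - i)))" for k
  proof (cases "k = 0")
    case False
    then have "{..k} = insert 0 (insert k {1..<k})" by auto
    with False have "(\<Sum>i\<le>k. fst (f i) * snd (f (k - i))) =
      g * snd (f k) + h * fst (f k) + (\<Sum>i\<in>{1..<k}. fst (f i) * snd (f (k - i)))"
      by (simp add: f0 algebra_simps)
    with f[of k] False show ?thesis by (simp add: S_def)
  qed (simp add: f0 assms)
  moreover have "degree (fst (f k)) < degree g" "degree (snd (f k)) < degree h" if "k > 0" for k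
    using f[of k] that by (simp_all add: S_def)
  ultimately show ?thesis
    by (intro exI[of _ "fst \<circ> f"] exI[of _ "snd \<circ> f"]) (simp add: f0)
qed

text \<open>Inverse of reading off the coefficients of the powers of \<open>t\<close>: the
  \<open>y\<close>-coefficients are reassembled as power series. A single bound \<open>n\<close> on
  all \<open>y\<close>-degrees is what makes the result a polynomial.\<close>

definition glue_poly :: "nat \<Rightarrow> (nat \<Rightarrow> 'a :: field poly) \<Rightarrow> 'a fls poly" where
  "glue_poly n P = (\<Sum>i\<le>n. monom (fps_to_fls (Abs_fps (\<lambda>k. coeff (P k) i))) i)"

lemma coeff_glue_poly:
  assumes "\<And>k. degree (P k) \<le> n"
  shows "coeff (glue_poly n P) i = fps_to_fls (Abs_fps (\<lambda>k. coeff (P k) i))"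
proof (cases "i \<le> n")
  case False
  then have "coeff (P k) i = 0" for k
    using assms[of k] by (intro coeff_eq_0) linarith
  then have "Abs_fps (\<lambda>k. coeff (P k) i) = 0" by (intro fps_ext) simp
  with False show ?thesis by (simp add: glue_poly_def coeff_sum)
qed (simp add: glue_poly_def coeff_sum)

lemma glue_poly_mult:
  assumes "\<And>k. degree (P k) \<le> m" "\<And>k. degree (H k) \<le> n"
  shows "glue_poly m P * glue_poly n H = glue_poly (m + n) (\<lambda>k. \<Sum>i\<le>k. P i * H (k - i))"
proof (rule poly_eqI)
  fix j
  define p where "p = (\<lambda>i. Abs_fps (\<lambda>k. coeff (P k) i))"
  define q where "q = (\<lambda>i. Abs_fps (\<lambda>k. coeff (H k) i))"
  have "degree (\<Sum>i\<le>k. P i * H (k - i)) \<le> m + n" for k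
    by (intro degree_sum_le) (auto intro: order_trans[OF degree_mult_le] add_mono assms)
  then have "coeff (glue_poly (m + n) (\<lambda>k. \<Sum>i\<le>k. P i * H (k - i))) j =
    fps_to_fls (Abs_fps (\<lambda>k. coeff (\<Sum>i\<le>k. P i * H (k - i)) j))"
    by (rule coeff_glue_poly)
  also have "Abs_fps (\<lambda>k. coeff (\<Sum>i\<le>k. P i * H (k - i)) j) = (\<Sum>l\<le>j. p l * q (j - l))"
  proof (rule fps_ext)
    fix k
    have "fps_nth (\<Sum>l\<le>j. p l * q (j - l)) k =
      (\<Sum>l\<le>j. \<Sum>i\<le>k. coeff (P i) l * coeff (H (k - i)) (j - l))"
      by (simp add: fps_sum_nth fps_mult_nth p_def q_def atLeast0AtMost)
    also have "\<dots> = (\<Sum>i\<le>k. \<Sum>l\<le>j. coeff (P i) l * coeff (H (k - i)) (j - l))"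
      by (rule sum.swap)
    finally show "fps_nth (Abs_fps (\<lambda>k. coeff (\<Sum>i\<le>k. P i * H (k - i)) j)) k =
      fps_nth (\<Sum>l\<le>j. p l * q (j - l)) k"
      by (simp add: coeff_sum coeff_mult)
  qed
  also have "fps_to_fls (\<Sum>l\<le>j. p l * q (j - l)) = (\<Sum>l\<le>j. fps_to_fls (p l * q (j - l)))"
    by (rule fps_to_fls_sum)
  also have "\<dots> = coeff (glue_poly m P * glue_poly n H) j"
    by (simp add: coeff_mult coeff_glue_poly assms p_def q_def fls_times_fps_to_fls)
  finally show "coeff (glue_poly m P * glue_poly n H) j =
    coeff (glue_poly (m + n) (\<lambda>k. \<Sum>i\<le>k. P i * H (k - i))) j" ..
qed

lemma hensel_fls:
  fixes G :: "'a :: field fls poly"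
  assumes int: "\<And>i. fls_subdegree (coeff G i) \<ge> 0"
    and red: "map_poly (\<lambda>c. c $$ 0) G = g * h"
    and cop: "coprime g h" "degree g > 0" "degree h > 0"
    and monic: "lead_coeff G = 1"
  obtains P H where "G = P * H" "degree P > 0" "degree H > 0"
proof -
  define S where "S = (\<lambda>k::nat. map_poly (\<lambda>c. c $$ int k) G)"
  have coeff_S: "coeff (S k) i = coeff G i $$ int k" for k i
    by (simp add: S_def coeff_map_poly)
  have degS: "degree (S k) \<le> degree G" for k
    by (rule degree_le) (simp add: coeff_S coeff_eq_0)
  have S0: "S 0 = g * h" using red by (simp add: S_def)
  have "coeff (S 0) (degree G) = 1" using monic by (simp add: coeff_S)
  then have "degree (S 0) = degree G"
    using degS[of 0] le_degree[of "S 0" "degree G"] by simp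
  then have deg: "degree G = degree g + degree h"
    using cop by (subst (asm) S0, subst (asm) degree_mult_eq) auto
  \<comment> \<open>\<open>G\<close> is monic, so the coefficient of the top power of
    \<open>y\<close> is constant in \<open>t\<close>, and the \<open>t^k\<close>-part for
    \<open>k > 0\<close> has smaller degree, as the recursion requires.\<close>
  have degS': "degree (S k) < degree g + degree h" if "k > 0" for k
  proof (rule degree_lessI)
    show "\<forall>i\<ge>degree g + degree h. coeff (S k) i = 0"
    proof safe
      fix i assume "i \<ge> degree g + degree h"
      then have "i = degree G \<or> i > degree G" using deg by auto
      then show "coeff (S k) i = 0"
        using monic that by (auto simp: coeff_S coeff_eq_0)
    qed
  qed (use cop in auto)
  obtain P H where PH: "P 0 = g" "H 0 = h"
      "\<And>k. k > 0 \<Longrightarrow> degree (P k) < degree g \<and> degree (H k) < degree h"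
      "\<And>k. S k = (\<Sum>i\<le>k. P i * H (k - i))"
    using hensel_sequence[of g h S, OF cop S0 degS'] by metis
  have bP: "degree (P k) \<le> degree g" and bH: "degree (H k) \<le> degree h" for k
    using PH(1-2) PH(3)[of k] by (cases "k = 0"; simp)+
  have "glue_poly (degree G) S = G"
  proof (rule poly_eqI)
    fix i
    have "coeff (glue_poly (degree G) S) i = fps_to_fls (Abs_fps (\<lambda>k. coeff G i $$ int k))"
      using coeff_glue_poly[of S "degree G" i] degS by (simp add: coeff_S)
    also have "\<dots> = coeff G i"
      using int[of i] by (intro fls_eqI) simp
    finally show "coeff (glue_poly (degree G) S) i = coeff G i" .
  qed
  then have "G = glue_poly (degree g) P * glue_poly (degree h) H"
    by (simp add: glue_poly_mult bP bH PH(4)[symmetric] deg)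
  moreover have "degree (glue_poly n Q) > 0" if "n > 0" "degree (Q 0) = n" "\<And>k. degree (Q k) \<le> n"
    for n and Q :: "nat \<Rightarrow> 'a poly"
  proof -
    have "coeff (glue_poly n Q) n $$ 0 \<noteq> 0"
      using that by (simp add: coeff_glue_poly) (metis degree_0 leading_coeff_neq_0 less_numeral_extra(3))
    then have "n \<le> degree (glue_poly n Q)" by (intro le_degree) auto
    with that show ?thesis by simp
  qed
  ultimately show ?thesis using that cop PH(1,2) bP bH by blast
qed

text \<open>Serves twice: a suitable \<open>b\<close> makes the second coefficient vanish
  (Tschirnhaus shift), and applied to \<open>y^n\<close> it gives the second coefficient of
  \<open>(y + b)^n\<close>.\<close>

lemma coeff_pcompose_linear_subleading:
  fixes F :: "'a :: idom poly"
  assumes "degree F > 0"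
  shows "coeff (F \<circ>\<^sub>p [:b, 1:]) (degree F - 1) = coeff F (degree F - 1) + of_nat (degree F) * b * lead_coeff F"
  using assms
proof (induction F)
  case (pCons a F)
  define G where "G = F \<circ>\<^sub>p [:b, 1:]"
  have F: "F \<noteq> 0" using pCons.prems by auto
  have G: "degree G = degree F" "lead_coeff G = lead_coeff F"
    using lead_coeff_comp[of "[:b, 1:]" F] by (simp_all add: G_def degree_pcompose)
  show ?case
  proof (cases "degree F = 0")
    case True
    then obtain c where "F = [:c:]" by (rule degree_eq_zeroE)
    with F show ?thesis by (simp add: pcompose_pCons)
  next
    case False
    then obtain m where m: "degree F = Suc m" by (cases "degree F") auto
    have "coeff (pCons a F \<circ>\<^sub>p [:b, 1:]) (Suc m) = b * coeff G (Suc m) + coeff G m"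
      by (simp add: pcompose_pCons G_def)
    also have "coeff G (Suc m) = lead_coeff F" using G m by simp
    also have "coeff G m = coeff F m + of_nat (Suc m) * b * lead_coeff F"
      using pCons.IH m by (simp add: G_def)
    finally show ?thesis using F m by (simp add: algebra_simps)
  qed
qed simp

text \<open>If \<open>x\<close> were the only root, \<open>g\<close> would be
  \<open>(y - x)^n\<close> with second coefficient \<open>- n x\<close>; characteristic 0 gives
  \<open>x = 0\<close> and \<open>g = y^n\<close>, against the nonzero coefficient
  \<open>i\<close>.\<close>

lemma monic_no_subleading_distinct_roots:
  fixes g :: "'a :: {alg_closed_field, field_char_0} poly"
  assumes "lead_coeff g = 1" "degree g > 1" "coeff g (degree g - 1) = 0"
    and "i < degree g" "coeff g i \<noteq> 0"
  obtains x y where "poly g x = 0" "poly g y = 0" "x \<noteq> y"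
proof -
  define n where "n = degree g"
  have "g \<noteq> 0" using assms by auto
  from alg_closed_imp_factorization[OF this] obtain A
    where A: "size A = n" "g = (\<Prod>x\<in>#A. [:-x, 1:])"
    using assms(1) by (auto simp: n_def)
  then have roots: "poly g x = 0 \<longleftrightarrow> x \<in># A" for x
    by (simp add: poly_prod_mset prod_mset_zero_iff) force
  obtain x where x: "poly g x = 0"
    using alg_closed_imp_poly_has_root[of g] assms(2) by auto
  show ?thesis
  proof (cases "\<exists>y. poly g y = 0 \<and> y \<noteq> x")
    case False
    with roots have "A = replicate_mset n x"
      using A(1) by (metis set_mset_subset_singletonD subsetI singletonI)
    with A have g: "g = [:-x, 1:] ^ n" by simp
    have "monom 1 m \<circ>\<^sub>p [:-x, 1:] = [:-x, 1:] ^ m" for m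
      by (induction m) (simp_all add: monom_Suc pcompose_pCons pcompose_1)
    moreover have n: "n > 1" using assms(2) by (simp add: n_def)
    ultimately have "coeff g (n - 1) = of_nat n * (-x)"
      using coeff_pcompose_linear_subleading[of "monom 1 n" "-x"] n by (subst g) (simp add: degree_monom_eq)
    with assms(2,3) have "x = 0" by (simp add: n_def)
    with g have "g = monom 1 n" by (simp add: monom_altdef)
    then have "coeff g i = (if n = i then 1 else 0)" by (metis coeff_monom)
    with assms(4,5) show ?thesis by (simp add: n_def)
  qed (use x that in auto)
qed


subsection \<open>The Newton-Puiseux theorem\<close>

text \<open>Substituting \<open>x = t^q\<close> and \<open>y -> t^u y\<close> along a slope of the
  Newton polygon makes the polynomial integral up to a power of \<open>t\<close>, with a reduction
  that has two distinct roots. These split the reduction into coprime factors, which Hensel's lemma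
  lifts.\<close>

lemma newton_puiseux_step:
  fixes F :: "'a :: {alg_closed_field, field_char_0} fls poly"
  assumes "lead_coeff F = 1" "degree F > 1" "coeff F (degree F - 1) = 0"
    and "i < degree F" "coeff F i \<noteq> 0"
  obtains q u P H where "q > 0" "degree P > 0" "degree H > 0"
    "subst_power q F \<circ>\<^sub>p [:0, fls_X_intpow u:] = smult (fls_X_intpow (int (degree F) * u)) (P * H)"
proof -
  define X :: "int \<Rightarrow> 'a fls" where "X = fls_X_intpow"
  have Xp: "X a * X b = X (a + b)" and Xpow: "X a ^ m = X (int m * a)" and X0: "X 0 = 1"
    and X_sub: "fls_subdegree (X a) = a" and X_nz: "X a \<noteq> 0" for a b m
    by (simp_all add: X_def fls_X_intpow_times_fls_X_intpow fls_X_intpow_power)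
  define n where "n = degree F"
  define I where "I = {i. i < n \<and> coeff F i \<noteq> 0}"
  define slope where "slope = (\<lambda>i. real_of_int (fls_subdegree (coeff F i)) / real (n - i))"
  have I: "finite I" "I \<noteq> {}" using assms by (auto simp: I_def n_def)
  \<comment> \<open>Index of least slope below the top coefficient: by minimality the rescaled
    polynomial is integral, and its coefficient \<open>k\<close> has order exactly 0.\<close>
  define k where "k = arg_min_on slope I"
  have k: "k \<in> I" "\<And>i. i \<in> I \<Longrightarrow> slope k \<le> slope i"
    using arg_min_if_finite[OF I, of slope] unfolding k_def by fastforce+
  \<comment> \<open>The least slope is \<open>u / q\<close>; ramification of index \<open>q\<close>
    turns it into the integer \<open>u\<close>.\<close>
  define q where "q = n - k"
  define u where "u = fls_subdegree (coeff F k)"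
  have q: "q > 0" using k by (simp add: q_def I_def)
  define G where "G = smult (X (- int n * u)) (subst_power q F \<circ>\<^sub>p [:0, X u:])"
  have coeff_G: "coeff G j = X (u * (int j - int n)) * fls_compose_power (coeff F j) q" for j
  proof -
    have "coeff G j = X (- int n * u) * (X u ^ j * fls_compose_power (coeff F j) q)"
      by (simp add: G_def coeff_pcompose_linear coeff_subst_power)
    also have "\<dots> = (X (- int n * u) * X (int j * u)) * fls_compose_power (coeff F j) q"
      by (simp add: Xpow mult_ac)
    finally show ?thesis by (simp add: Xp algebra_simps)
  qed
  have sub_G: "fls_subdegree (coeff G j) = u * (int j - int n) + int q * fls_subdegree (coeff F j)"
    if "coeff F j \<noteq> 0" for j
    using that q unfolding coeff_G
    by (subst fls_subdegree_mult) (auto simp: fls_compose_power_eq_0_iff fls_subdegree_compose_power X_sub X_nz)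
  have lead: "coeff G n = 1"
    using assms(1) q by (simp add: coeff_G n_def X0)
  have deg: "degree G = n"
  proof (rule antisym)
    show "degree G \<le> n"
      by (rule degree_le) (auto simp: coeff_G n_def coeff_eq_0)
    show "n \<le> degree G" using lead by (intro le_degree) simp
  qed
  have int: "fls_subdegree (coeff G j) \<ge> 0" for j
  proof (cases "j \<in> I")
    case True
    with k(2)[OF True] k(1) have "real_of_int u * real (n - j) \<le> real_of_int (fls_subdegree (coeff F j)) * real q"
      by (simp add: slope_def u_def q_def I_def field_simps)
    then have "real_of_int (u * int (n - j)) \<le> real_of_int (fls_subdegree (coeff F j) * int q)"
      by simp
    then have "u * int (n - j) \<le> fls_subdegree (coeff F j) * int q"
      by (simp only: of_int_le_iff)
    with True show ?thesis by (subst sub_G) (auto simp: I_def algebra_simps of_nat_diff)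
  next
    case False
    then consider "coeff F j = 0" | "j = n" | "j > n" by (fastforce simp: I_def)
    then have "coeff G j = 0 \<or> coeff G j = 1"
      by cases (use lead in \<open>simp_all add: coeff_G n_def coeff_eq_0\<close>)
    then show ?thesis by auto
  qed
  define g where "g = map_poly (\<lambda>c. c $$ 0) G"
  have cg: "coeff g j = coeff G j $$ 0" for j
    by (simp add: g_def coeff_map_poly)
  have deg_g: "degree g = n"
  proof (rule antisym)
    show "degree g \<le> n"
      by (rule degree_le) (auto simp: cg deg[symmetric] coeff_eq_0)
    show "n \<le> degree g" using lead by (intro le_degree) (simp add: cg)
  qed
  have "coeff g k \<noteq> 0"
  proof -
    have ck: "coeff F k \<noteq> 0" and "k < n" using k by (auto simp: I_def)
    then have "fls_subdegree (coeff G k) = 0"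
      by (simp add: sub_G q_def u_def[symmetric] algebra_simps of_nat_diff)
    moreover have "coeff G k \<noteq> 0"
      using ck q by (auto simp: coeff_G fls_compose_power_eq_0_iff X_nz)
    ultimately show ?thesis
      unfolding cg by (metis nth_fls_subdegree_nonzero)
  qed
  moreover have "lead_coeff g = 1" by (simp add: deg_g cg lead)
  moreover have "coeff g (degree g - 1) = 0"
    using assms(3) by (simp add: deg_g cg coeff_G n_def)
  moreover have "k < degree g" using k by (simp add: deg_g I_def)
  moreover have "degree g > 1" using assms by (simp add: deg_g n_def)
  ultimately obtain x y where "poly g x = 0" "poly g y = 0" "x \<noteq> y"
    using monic_no_subleading_distinct_roots[of g k] by blast
  then obtain r s where "degree r > 0" "degree s > 0" "coprime r s" "g = r * s"
    using alg_closed_imp_poly_splits_coprime[of g x y] \<open>degree g > 1\<close> by blast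
  then obtain P H where PH: "G = P * H" "degree P > 0" "degree H > 0"
    using hensel_fls[of G r s] int g_def lead deg by metis
  have "subst_power q F \<circ>\<^sub>p [:0, X u:] = smult (X (int n * u)) G"
    unfolding G_def by (simp add: Xp X0)
  with PH q that show ?thesis by (simp add: n_def X_def)
qed

text \<open>Induction on the degree. After the shift by \<open>c\<close>, either all lower
  coefficients vanish and 0 is a root, or one slope step yields a factor of smaller positive degree,
  whose root is carried back.\<close>

lemma newton_puiseux_root:
  fixes F :: "'a :: {alg_closed_field, field_char_0} fls poly"
  assumes "degree F > 0"
  shows "\<exists>p>0. \<exists>y. poly (subst_power p F) y = 0"
  using assms
proof (induction "degree F" arbitrary: F rule: less_induct)
  case less
  define n where "n = degree F"
  define c where "c = coeff F (n - 1) / (of_nat n * lead_coeff F)"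
  define F0 where "F0 = smult (inverse (lead_coeff F)) F"
  define F1 where "F1 = F0 \<circ>\<^sub>p [:-c, 1:]"
  have F: "F \<noteq> 0" and n: "n > 0" using less.prems by (auto simp: n_def)
  have deg0: "degree F0 = n" and lead0: "lead_coeff F0 = 1"
    using F by (simp_all add: F0_def n_def)
  have deg: "degree F1 = n" using deg0 by (simp add: F1_def degree_pcompose)
  have lead: "lead_coeff F1 = 1" using lead0 by (simp add: F1_def lead_coeff_comp)
  have lift_root: "\<exists>p>0. \<exists>y. poly (subst_power p F) y = 0"
    if "p > 0" "poly (subst_power p F1) y = 0" for p y
  proof -
    have "F = smult (lead_coeff F) F0" using F by (simp add: F0_def)
    have "poly (subst_power p F0) (y - fls_compose_power c p) = 0"
      using that(2) by (simp add: F1_def subst_power_pcompose subst_power_pCons poly_pcompose that(1))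
    moreover have "subst_power p F = smult (fls_compose_power (lead_coeff F) p) (subst_power p F0)"
      by (subst \<open>F = smult _ _\<close>) (simp add: subst_power_smult)
    ultimately have "poly (subst_power p F) (y - fls_compose_power c p) = 0" by simp
    with that(1) show ?thesis by blast
  qed
  show ?case
  proof (cases "\<exists>i<n. coeff F1 i \<noteq> 0")
    case False
    then have "poly F1 0 = 0" using n by (simp add: poly_0_coeff_0)
    with lift_root[of 1 0] show ?thesis by simp
  next
    case True
    have sub: "coeff F1 (n - 1) = 0"
    proof -
      have "c = coeff F0 (n - 1) / of_nat n"
        using F n by (simp add: c_def F0_def field_simps)
      moreover have "coeff F1 (n - 1) = coeff F0 (n - 1) - of_nat n * c"
        using coeff_pcompose_linear_subleading[of F0 "-c"] deg0 lead0 n by (simp add: F1_def)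
      ultimately show ?thesis using n by simp
    qed
    from True obtain i where i: "i < n" "coeff F1 i \<noteq> 0" by blast
    with sub have n1: "n > 1" by (cases "n = 1") auto
    obtain q u P H where PH: "q > 0" "degree P > 0" "degree H > 0"
      "subst_power q F1 \<circ>\<^sub>p [:0, fls_X_intpow u:] = smult (fls_X_intpow (int (degree F1) * u)) (P * H)"
      using newton_puiseux_step[of F1 i thesis] lead n1 sub i deg by auto
    have "degree (subst_power q F1 \<circ>\<^sub>p [:0, fls_X_intpow u:]) = n"
      using PH(1) deg by (simp add: degree_pcompose degree_subst_power)
    then have "degree P + degree H = n"
      unfolding PH(4) using PH(2,3) by (subst (asm) degree_smult_eq, subst (asm) degree_mult_eq) auto
    with PH(3) have "degree P < degree F" by (simp add: n_def)
    from less.hyps[OF this PH(2)] obtain p y where py: "p > 0" "poly (subst_power p P) y = 0"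
      by blast
    have "poly (subst_power p (subst_power q F1 \<circ>\<^sub>p [:0, fls_X_intpow u:])) y = 0"
      unfolding PH(4) using py by (simp add: subst_power_smult subst_power_mult)
    then have "poly (subst_power (q * p) F1) (fls_compose_power (fls_X_intpow u) p * y) = 0"
      using py(1) PH(1) by (simp add: subst_power_pcompose subst_power_subst_power
          subst_power_pCons poly_pcompose mult.commute)
    with lift_root[of "q * p"] py(1) PH(1) show ?thesis by simp
  qed
qed


abbreviation splits :: "'a :: idom poly \<Rightarrow> bool" where
  "splits p \<equiv> \<exists>A. p = smult (lead_coeff p) (\<Prod>x\<in>#A. [:-x, 1:])"

text \<open>One root is split off at a time; the ramification indices of the stages
  multiply.\<close>

lemma newton_puiseux_splits:
  fixes F :: "'a :: {alg_closed_field, field_char_0} fls poly"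
  assumes "F \<noteq> 0"
  shows "\<exists>p>0. splits (subst_power p F)"
  using assms
proof (induction "degree F" arbitrary: F)
  case 0
  then obtain c where "F = [:c:]" by (metis degree_eq_zeroE)
  then show ?case by (intro exI[of _ 1] conjI exI[of _ "{#}"]) simp_all
next
  case (Suc n)
  then obtain p y where p: "p > 0" and "poly (subst_power p F) y = 0"
    using newton_puiseux_root[of F] by auto
  then obtain G where G: "subst_power p F = [:-y, 1:] * G"
    by (auto simp: poly_eq_0_iff_dvd)
  have "G \<noteq> 0" using G p Suc.prems by (auto simp flip: subst_power_eq_0_iff[of p F])
  moreover have "degree (subst_power p F) = Suc n" using p Suc.hyps by (simp add: degree_subst_power)
  ultimately have "degree G = n" unfolding G by (subst (asm) degree_mult_eq) auto
  from Suc.hyps(1)[OF this[symmetric] \<open>G \<noteq> 0\<close>] obtain q A where q: "q > 0"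
    and A: "subst_power q G = smult (lead_coeff (subst_power q G)) (\<Prod>x\<in>#A. [:-x, 1:])"
    by blast
  define z where "z = fls_compose_power y q"
  have eq: "subst_power (p * q) F = [:-z, 1:] * subst_power q G"
    using p q by (simp add: G z_def subst_power_mult subst_power_pCons flip: subst_power_subst_power
        del: mult_pCons_left)
  then have "lead_coeff (subst_power (p * q) F) = lead_coeff (subst_power q G)"
    by (simp add: lead_coeff_mult del: mult_pCons_left)
  then have "subst_power (p * q) F = smult (lead_coeff (subst_power (p * q) F)) (\<Prod>x\<in>#add_mset z A. [:-x, 1:])"
    by (subst eq, subst A) (simp del: mult_pCons_left)
  moreover have "p * q > 0" using p q by simp
  ultimately show ?case by blast
qed

subsection \<open>The Galois action\<close>

text \<open>Induction along \<open>n = p * m\<close> with \<open>p\<close> prime, from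
  \<open>v\<close> of exact order \<open>m\<close>. If \<open>p\<close> divides \<open>m\<close>, a
  \<open>p\<close>-th root of \<open>v\<close> works; otherwise \<open>v\<close> times an element of
  order \<open>p\<close> does.\<close>

lemma primitive_root_of_unity_exists:
  assumes "n > 0"
  shows "\<exists>w :: 'a :: {alg_closed_field, field_char_0}. \<forall>k. w ^ k = 1 \<longleftrightarrow> n dvd k"
  using assms
proof (induction n rule: less_induct)
  case (less n)
  show ?case
  proof (cases "n = 1")
    case False
    then obtain p where p: "prime p" "p dvd n"
      using prime_factor_nat by blast
    then obtain m where n: "n = p * m" by blast
    with less.prems p have m: "0 < m" "m < n" by (auto simp: prime_gt_Suc_0_nat)
    then obtain v :: 'a where v: "\<And>k. v ^ k = 1 \<longleftrightarrow> m dvd k"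
      using less.IH by blast
    show ?thesis
    proof (cases "p dvd m")
      case True
      then obtain m' where m': "m = p * m'" by blast
      obtain w where w: "w ^ p = v"
        using nth_root_exists[of p v] p(1) prime_gt_0_nat by blast
      have "n dvd k" if k: "w ^ k = 1" for k
      proof -
        have "v ^ k = (w ^ k) ^ p" by (simp add: w[symmetric] flip: power_mult) (simp add: mult.commute)
        with k v obtain j where j: "k = m * j" by auto
        then have "v ^ (m' * j) = 1"
          using k by (simp add: w[symmetric] m' power_mult)
        then have "p dvd j" using v[of "m' * j"] m(1) m' by simp
        with j show ?thesis by (simp add: n mult.commute mult_dvd_mono)
      qed
      moreover have "w ^ k = 1" if "n dvd k" for k
        using that v[of m] by (auto simp: n power_mult w)
      ultimately show ?thesis by blast
    next
      case False
      \<comment> \<open>A root \<open>e\<close> of \<open>1 + y + ... + y^(p-1)\<close> satisfies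
        \<open>e^p = 1\<close>, and \<open>e\<close> is not 1 because \<open>p\<close> is nonzero in
        characteristic 0.\<close>
      define g where "g = (\<Sum>i<p. monom (1 :: 'a) i)"
      have "coeff g (p - 1) = 1"
        using p(1) prime_gt_0_nat by (simp add: g_def coeff_sum)
      then have "degree g \<ge> p - 1" by (intro le_degree) simp
      then have "degree g > 0" using prime_gt_1_nat[OF p(1)] by linarith
      then obtain e where e: "poly g e = 0"
        using alg_closed_imp_poly_has_root by blast
      then have sum: "(\<Sum>i<p. e ^ i) = 0" by (simp add: g_def poly_sum poly_monom)
      have e_p: "e ^ p = 1"
        using power_diff_1_eq[of e p] sum by simp
      have e_1: "e \<noteq> 1"
        using sum p(1) by (auto simp: prime_gt_0_nat)
      have e_dvd: "p dvd k" if k: "e ^ k = 1" for k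
      proof (rule ccontr)
        assume "\<not> p dvd k"
        then have "coprime k p" using p(1) by (metis coprime_commute prime_imp_coprime)
        moreover have "k \<noteq> 0" using \<open>\<not> p dvd k\<close> by (metis dvd_0_right)
        ultimately obtain x y where "k * x = p * y + 1"
          using bezout_nat[of k p] by auto
        then have "e ^ (k * x) = e ^ (p * y) * e" by simp
        with k e_p e_1 show False by (simp add: power_mult)
      qed
      define w where "w = v * e"
      have "n dvd k" if k: "w ^ k = 1" for k
      proof -
        have vk: "v ^ k * e ^ k = 1" using k by (simp add: w_def power_mult_distrib)
        have "(v ^ k * e ^ k) ^ p = v ^ (k * p) * (e ^ p) ^ k"
          by (simp add: power_mult_distrib mult.commute flip: power_mult)
        with vk e_p have "v ^ (k * p) = 1" by simp
        then have "m dvd k * p" using v by simp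
        then have mk: "m dvd k"
          using False p(1) by (metis coprime_commute coprime_dvd_mult_left_iff prime_imp_coprime)
        with vk v[of k] e_dvd have "p dvd k" by simp
        with mk show ?thesis
          using False p(1) unfolding n by (intro divides_mult prime_imp_coprime)
      qed
      moreover have "w ^ k = 1" if "n dvd k" for k
      proof -
        from that have "m dvd k" "p dvd k" unfolding n by auto
        then have "v ^ k = 1" "e ^ k = 1" using v e_p by (auto simp: power_mult elim!: dvdE[of p])
        then show ?thesis by (simp add: w_def power_mult_distrib)
      qed
      ultimately show ?thesis by blast
    qed
  qed (auto intro: exI[of _ 1])
qed

text \<open>For nonzero \<open>w\<close>, the automorphism \<open>t -> w t\<close> of the field of
  series. Exponents may be negative, hence \<open>powi\<close>.\<close>

definition rot :: "'a :: field \<Rightarrow> 'a fls \<Rightarrow> 'a fls" where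
  "rot w y = Abs_fls (\<lambda>i. w powi i * y $$ i)"

lemma rot_nth [simp]: "rot w y $$ i = w powi i * y $$ i"
  unfolding rot_def
  by (rule nth_Abs_fls_lower_bound[of "fls_subdegree y"]) simp

lemma rot_0 [simp]: "rot w 0 = 0"
  by (rule fls_eqI) simp

lemma rot_1 [simp]: "rot w 1 = 1"
  by (rule fls_eqI) simp

lemma rot_add: "rot w (y + z) = rot w y + rot w z"
  by (rule fls_eqI) (simp add: algebra_simps)

lemma rot_diff: "rot w (y - z) = rot w y - rot w z"
  by (rule fls_eqI) (simp add: algebra_simps)

lemma rot_minus: "rot w (- y) = - rot w y"
  by (rule fls_eqI) simp

lemma rot_rot: "rot w (rot v y) = rot (w * v) y"
  by (rule fls_eqI) (simp add: power_int_mult_distrib)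

lemma rot_one_left [simp]: "rot 1 y = y"
  by (rule fls_eqI) simp

lemma rot_eq_0_iff: "w \<noteq> 0 \<Longrightarrow> rot w y = 0 \<longleftrightarrow> y = 0"
  by (metis rot_rot rot_one_left rot_0 left_inverse)

lemma rot_eq_iff: "w \<noteq> 0 \<Longrightarrow> rot w y = rot w z \<longleftrightarrow> y = z"
  using rot_eq_0_iff[of w "y - z"] by (simp add: rot_diff)

lemma fls_subdegree_rot: "w \<noteq> 0 \<Longrightarrow> fls_subdegree (rot w y) = fls_subdegree y"
  by (cases "y = 0") (auto intro!: fls_subdegree_eqI)

lemma rot_mult:
  assumes "w \<noteq> 0"
  shows "rot w (y * z) = rot w y * rot w z"
proof (rule fls_eqI)
  fix n
  have eq: "w powi n * (y $$ i * z $$ (n - i)) = (w powi i * y $$ i) * (w powi (n - i) * z $$ (n - i))" for i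
    using assms by (simp add: power_int_diff)
  then show "rot w (y * z) $$ n = (rot w y * rot w z) $$ n"
    by (simp only: rot_nth fls_times_nth(2) fls_subdegree_rot[OF assms] sum_distrib_left eq)
qed

lemma rot_compose_power:
  assumes "w ^ d = 1" "d > 0"
  shows "rot w (fls_compose_power y d) = fls_compose_power y d"
proof (rule fls_eqI)
  fix n
  have "w powi (int d * j) = 1" for j
    using assms(1) by (simp add: power_int_mult)
  then show "rot w (fls_compose_power y d) $$ n = fls_compose_power y d $$ n"
    using assms(2) by (auto simp: fls_nth_compose_power elim!: dvdE)
qed

lemma fls_compose_power_exists:
  assumes "d > 0" "\<And>i. y $$ i \<noteq> 0 \<Longrightarrow> int d dvd i"
  obtains z where "y = fls_compose_power z d"
proof -
  define z where "z = Abs_fls (\<lambda>i. y $$ (int d * i))"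
  have "z $$ i = y $$ (int d * i)" for i
    unfolding z_def
  proof (rule nth_Abs_fls_lower_bound[of "- \<bar>fls_subdegree y\<bar>"], intro allI impI)
    fix i assume i: "i < - \<bar>fls_subdegree y\<bar>"
    moreover from i have "int d * i \<le> 1 * i"
      using assms(1) by (intro mult_right_mono_neg) auto
    ultimately show "y $$ (int d * i) = 0" by simp
  qed
  then have "y = fls_compose_power z d"
    using assms by (intro fls_eqI) (auto simp: fls_nth_compose_power)
  with that show ?thesis by blast
qed

lemma poly_subst_power_rot:
  assumes "w ^ d = 1" "d > 0"
  shows "poly (subst_power d F) (rot w y) = rot w (poly (subst_power d F) y)"
proof -
  have "w \<noteq> 0" using assms by (auto simp: power_0_left)
  then show ?thesis
    by (induction F) (simp_all add: subst_power_pCons rot_add rot_mult rot_compose_power assms)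
qed

lemma puiseux_roots_rot:
  "y \<in> puiseux_roots d F \<Longrightarrow> w ^ d = 1 \<Longrightarrow> d > 0 \<Longrightarrow> rot w y \<in> puiseux_roots d F"
  by (simp add: puiseux_roots_def poly_subst_power_rot)

lemma finite_puiseux_roots: "d > 0 \<Longrightarrow> F \<noteq> 0 \<Longrightarrow> finite (puiseux_roots d F)"
  by (simp add: puiseux_roots_def poly_roots_finite subst_power_eq_0_iff)


text \<open>The order of \<open>y - z\<close> is at least \<open>c\<close>, expressed by
  coefficients. This form covers \<open>y = z\<close>, where \<open>fls_subdegree\<close> of the
  difference is 0 by convention, and is visibly an equivalence relation.\<close>

definition agree :: "int \<Rightarrow> 'a :: zero fls \<Rightarrow> 'a fls \<Rightarrow> bool" where
  "agree c y z \<longleftrightarrow> (\<forall>i<c. y $$ i = z $$ i)"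

lemma agree_refl [simp]: "agree c y y"
  by (simp add: agree_def)

lemma agree_sym: "agree c y z \<longleftrightarrow> agree c z y"
  by (auto simp: agree_def)

lemma agree_trans: "agree c x y \<Longrightarrow> agree c y z \<Longrightarrow> agree c x z"
  by (auto simp: agree_def)

lemma agree_mono: "agree d y z \<Longrightarrow> c \<le> d \<Longrightarrow> agree c y z"
  by (auto simp: agree_def)

lemma agree_rot: "v \<noteq> 0 \<Longrightarrow> agree c (rot v y) (rot v z) \<longleftrightarrow> agree c y z"
  by (auto simp: agree_def)

lemma agree_iff_subdegree:
  fixes y z :: "'a :: ab_group_add fls"
  assumes "y \<noteq> z"
  shows "agree c y z \<longleftrightarrow> c \<le> fls_subdegree (y - z)"
proof
  assume "agree c y z"
  with assms show "c \<le> fls_subdegree (y - z)"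
    by (intro fls_subdegree_geI) (auto simp: agree_def)
next
  assume c: "c \<le> fls_subdegree (y - z)"
  show "agree c y z"
    unfolding agree_def
  proof safe
    fix i assume "i < c"
    with c have "(y - z) $$ i = 0" by (intro fls_eq0_below_subdegree) simp
    then show "y $$ i = z $$ i" by simp
  qed
qed

lemma puiseux_ord_ge_iff:
  assumes "d > 0"
  shows "ereal (of_int c / of_nat d) \<le> puiseux_ord d (y - z) \<longleftrightarrow> agree c y z"
proof (cases "y = z")
  case False
  with assms show ?thesis
    by (simp add: puiseux_ord_def agree_iff_subdegree divide_le_cancel)
qed (simp add: puiseux_ord_def)

lemma puiseux_ord_compose_power:
  assumes "d > 0" "e > 0"
  shows "puiseux_ord (d * e) (fls_compose_power y e) = puiseux_ord d y"
  using assms by (simp add: puiseux_ord_def fls_compose_power_eq_0_iff fls_subdegree_compose_power)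

section \<open>Galois orbits of the roots of irreducible polynomials\<close>

locale root_of_unity =
  fixes N :: nat and w :: "'a :: {alg_closed_field, field_char_0}"
  assumes N_pos: "N > 0" and w_power: "\<And>k. w ^ k = 1 \<longleftrightarrow> N dvd k"
begin

abbreviation roots :: "'a fls poly \<Rightarrow> 'a fls set" where
  "roots \<equiv> puiseux_roots N"

abbreviation lv :: "int \<Rightarrow> real" where
  "lv c \<equiv> of_int c / of_nat N"

abbreviation near :: "int \<Rightarrow> 'a fls poly \<Rightarrow> 'a fls poly \<Rightarrow> bool" where
  "near c F G \<equiv> ereal (lv c) \<le> contact F G"

lemma w_nonzero [simp]: "w \<noteq> 0"
  using w_power[of N] N_pos by (auto simp: power_0_left)

lemma w_powi: "w powi i = 1 \<longleftrightarrow> int N dvd i"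
proof (cases "i \<ge> 0")
  case True
  then show ?thesis
    using w_power[of "nat i"] by (simp add: power_int_def int_dvd_int_iff[symmetric])
next
  case False
  then show ?thesis
    using w_power[of "nat (- i)"]
    by (simp add: power_int_def int_dvd_int_iff[symmetric] inverse_eq_1_iff power_inverse del: int_dvd_int_iff)
qed

lemma rot_w_eq_iff: "rot (w ^ k) y = y \<longleftrightarrow> (\<forall>i. y $$ i \<noteq> 0 \<longrightarrow> int N dvd int k * i)"
proof -
  have "(w ^ k) powi i = w powi (int k * i)" for i
    by (simp add: power_int_mult)
  then show ?thesis
    by (auto simp: fls_eq_iff simp flip: w_powi)
qed

text \<open>The map \<open>t -> w^k t\<close> multiplies the coefficient of \<open>t^i\<close> by
  \<open>w^(k i)\<close>, which is 1 iff \<open>N\<close> divides \<open>k i\<close>. Closeness of a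
  series to its conjugates is thus a divisibility condition on its exponents.\<close>

lemma agree_rot_w: "agree c (rot (w ^ k) y) y \<longleftrightarrow> (\<forall>i<c. y $$ i \<noteq> 0 \<longrightarrow> int N dvd int k * i)"
proof -
  have "(w ^ k) powi i = w powi (int k * i)" for i
    by (simp add: power_int_mult)
  then show ?thesis
    by (auto simp: agree_def simp flip: w_powi)
qed

lemma rot_root: "y \<in> roots F \<Longrightarrow> rot (w ^ k) y \<in> roots F"
  using puiseux_roots_rot[of y N F "w ^ k"] N_pos w_power[of "k * N"]
  by (simp add: power_mult)

text \<open>Galois descent: the coefficients of the product are fixed by \<open>rot w\<close>, so
  their exponents are multiples of \<open>N\<close> and they lie in \<open>K((x))\<close>.\<close>

lemma orbit_poly_descends:
  assumes "finite S" "rot w ` S = S"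
  obtains G where "subst_power N G = (\<Prod>z\<in>S. [:-z, 1:])"
proof -
  define p where "p = (\<Prod>z\<in>S. [:-z, 1:])"
  have hom: "map_poly (rot w) (\<Prod>z\<in>A. [:- f z, 1:]) = (\<Prod>z\<in>A. [:- rot w (f z), 1:])" if "finite A"
    for A :: "'a fls set" and f
    using that
  proof (induction A)
    case (insert x A)
    have "map_poly (rot w) ([:- f x, 1:] * q) = [:- rot w (f x), 1:] * map_poly (rot w) q" for q
      by (simp add: poly_eq_iff coeff_map_poly coeff_pCons rot_diff rot_mult rot_minus split: nat.splits)
    with insert show ?case by simp
  qed simp
  have "inj_on (rot w) S" by (auto simp: inj_on_def rot_eq_iff)
  then have "p = (\<Prod>z\<in>S. [:- rot w z, 1:])"
    unfolding p_def by (subst assms(2)[symmetric]) (simp add: prod.reindex)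
  with hom[OF assms(1), of id] have "map_poly (rot w) p = p"
    by (simp add: p_def)
  then have inv: "rot w (coeff p i) = coeff p i" for i
    by (metis coeff_map_poly rot_0)
  have "\<exists>c. coeff p i = fls_compose_power c N" for i
    using inv[of i] rot_w_eq_iff[of 1 "coeff p i"] N_pos
    by (metis fls_compose_power_exists mult_1 of_nat_1 power_one_right)
  then obtain c where c: "\<And>i. coeff p i = fls_compose_power (c i) N" by metis
  define G where "G = (\<Sum>i\<le>degree p. monom (c i) i)"
  have "coeff G i = c i" for i
    using c[of i] N_pos
    by (cases "i \<le> degree p") (simp_all add: G_def coeff_sum coeff_eq_0 fls_compose_power_eq_0_iff eq_commute[of 0])
  then have "subst_power N G = p" by (simp add: poly_eq_iff coeff_subst_power c)
  with that show ?thesis by (simp add: p_def)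
qed

text \<open>The last clause says that \<open>N\<close> is a large enough ramification index for
  \<open>F\<close>: a single root in \<open>K((x^(1/N)))\<close> already makes \<open>F\<close>
  split there.\<close>

definition rooted :: "'a fls poly \<Rightarrow> bool" where
  "rooted F \<longleftrightarrow> lead_coeff F = 1 \<and> irreducible F \<and> roots F \<noteq> {}"

text \<open>A Bezout combination vanishes at the common root, so it is no unit; as \<open>F\<close>
  is irreducible, \<open>F\<close> divides it, and it divides \<open>G\<close>.\<close>

lemma rooted_dvd_of_common_root:
  assumes "irreducible F" "y \<in> roots F" "y \<in> roots G"
  shows "F dvd G"
proof -
  obtain u v where uv: "u * F + v * G dvd F" "u * F + v * G dvd G"
    using poly_bezout by blast
  have "is_unit (u * F + v * G) \<or> F dvd u * F + v * G"
    using irreducibleD'[OF assms(1) uv(1)] by auto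
  then show ?thesis
  proof
    assume "is_unit (u * F + v * G)"
    then obtain q where "1 = (u * F + v * G) * q" by blast
    then have "poly (subst_power N 1) y = poly (subst_power N ((u * F + v * G) * q)) y" by simp
    with assms N_pos show ?thesis
      by (simp add: puiseux_roots_def subst_power_mult subst_power_add)
  qed (use uv(2) dvd_trans in blast)
qed

text \<open>The \<open>n\<close> conjugates of \<open>y\<close> are roots of \<open>F\<close>, and
  their orbit polynomial descends to a polynomial \<open>G\<close> of degree \<open>n\<close>
  divisible by \<open>F\<close>. The two bounds on \<open>degree F\<close> meet, so the roots form
  one full orbit.\<close>

lemma rooted_orbit:
  assumes F: "rooted F" and y: "y \<in> roots F"
  shows "roots F = (\<lambda>k. rot (w ^ k) y) ` {..<degree F}"
    and "inj_on (\<lambda>k. rot (w ^ k) y) {..<degree F}"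
    and "rot (w ^ k) y = y \<longleftrightarrow> degree F dvd k"
    and "degree F dvd N"
    and "subst_power N F = (\<Prod>z\<in>roots F. [:-z, 1:])"
proof -
  define n where "n = (LEAST k. k > 0 \<and> rot (w ^ k) y = y)"
  have "N > 0 \<and> rot (w ^ N) y = y" using N_pos w_power[of N] by simp
  from LeastI[of "\<lambda>k. k > 0 \<and> rot (w ^ k) y = y", OF this]
  have n: "n > 0" "rot (w ^ n) y = y" by (simp_all add: n_def)
  have least: "n \<le> k" if "k > 0" "rot (w ^ k) y = y" for k
    unfolding n_def using that by (intro Least_le) simp
  have mult: "rot (w ^ (n * j)) y = y" for j
  proof (induction j)
    case (Suc j)
    then show ?case using n(2) by (simp add: power_add flip: rot_rot)
  qed simp
  have mod: "rot (w ^ (k mod n)) y = rot (w ^ k) y" for k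
  proof -
    have "rot (w ^ k) y = rot (w ^ (k mod n)) (rot (w ^ (n * (k div n))) y)"
      by (simp add: rot_rot flip: power_add)
    then show ?thesis by (simp add: mult)
  qed
  have per: "rot (w ^ k) y = y \<longleftrightarrow> n dvd k" for k
  proof
    assume "rot (w ^ k) y = y"
    then have "\<not> 0 < k mod n"
      using mod[of k] least[of "k mod n"] mod_less_divisor[OF n(1), of k] by auto
    then show "n dvd k" by (simp add: dvd_eq_mod_eq_0)
  qed (use mult in auto)
  define S where "S = (\<lambda>k. rot (w ^ k) y) ` {..<n}"
  have S: "rot (w ^ k) y \<in> S" for k
    unfolding S_def by (subst mod[symmetric]) (use n in auto)
  have inj: "inj_on (\<lambda>k. rot (w ^ k) y) {..<n}"
  proof (rule linorder_inj_onI)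
    fix i j assume ij: "i < j" "i \<in> {..<n}" "j \<in> {..<n}"
    show "rot (w ^ i) y \<noteq> rot (w ^ j) y"
    proof
      assume "rot (w ^ i) y = rot (w ^ j) y"
      also have "rot (w ^ j) y = rot (w ^ i) (rot (w ^ (j - i)) y)"
        using ij by (simp add: rot_rot flip: power_add)
      finally have "rot (w ^ (j - i)) y = y" by (simp add: rot_eq_iff)
      with least[of "j - i"] ij show False by simp
    qed
  qed auto
  then have card_S: "card S = n" by (simp add: S_def card_image)
  have sub: "S \<subseteq> roots F" using y by (auto simp: S_def rot_root)
  have "rot w ` S \<subseteq> S"
    using S[of "Suc k" for k] by (auto simp: S_def rot_rot)
  moreover have "finite S" by (simp add: S_def)
  moreover have "inj_on (rot w) S" by (auto simp: inj_on_def rot_eq_iff)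
  ultimately have "rot w ` S = S" by (simp add: endo_inj_surj)
  from orbit_poly_descends[OF \<open>finite S\<close> this] obtain G where G: "subst_power N G = (\<Prod>z\<in>S. [:-z, 1:])"
    by blast
  have rG: "roots G = S"
    using \<open>finite S\<close> by (auto simp: puiseux_roots_def G poly_prod)
  have FG: "F dvd G"
    using F y rG S[of 0] by (intro rooted_dvd_of_common_root[of F y G]) (auto simp: rooted_def)
  have dG: "degree G = n"
    using degree_subst_power[OF N_pos, of G] card_S by (simp add: G degree_prod_sum_eq)
  have mG: "lead_coeff (subst_power N G) = 1"
    by (simp add: G lead_coeff_prod)
  then have "G \<noteq> 0" using N_pos by auto
  have F0: "F \<noteq> 0" using F by (auto simp: rooted_def)
  have "card (roots F) \<le> degree F"
    using N_pos F0 card_poly_roots_bound[of "subst_power N F"]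
    by (simp add: puiseux_roots_def degree_subst_power subst_power_eq_0_iff)
  moreover have "n \<le> card (roots F)"
    using card_mono[OF finite_puiseux_roots[OF N_pos F0] sub] card_S by simp
  moreover have "degree F \<le> n" using FG \<open>G \<noteq> 0\<close> dG dvd_imp_degree_le by blast
  ultimately have eq: "degree F = n" "card (roots F) = n" by simp_all
  then have RS: "roots F = S"
    using card_subset_eq[OF finite_puiseux_roots[OF N_pos F0] sub] card_S by simp
  show "roots F = (\<lambda>k. rot (w ^ k) y) ` {..<degree F}" by (simp add: RS S_def eq)
  show "inj_on (\<lambda>k. rot (w ^ k) y) {..<degree F}" using inj by (simp add: eq)
  show "rot (w ^ k) y = y \<longleftrightarrow> degree F dvd k" by (simp add: per eq)
  show "degree F dvd N" using per[of N] w_power[of N] by (simp add: eq)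
  have "subst_power N F = subst_power N G"
  proof -
    from FG obtain H where H: "G = F * H" by blast
    with \<open>G \<noteq> 0\<close> F0 dG eq have "degree H = 0" by (auto simp: degree_mult_eq)
    then obtain c where c: "H = [:c:]" by (rule degree_eq_zeroE)
    have "lead_coeff G = 1"
      using mG N_pos fls_compose_power_eq_iff[OF N_pos, of "lead_coeff G" 1]
      by (simp add: coeff_subst_power degree_subst_power)
    moreover have "lead_coeff G = c" using F by (simp add: H c rooted_def)
    ultimately show ?thesis by (simp add: H c)
  qed
  then show "subst_power N F = (\<Prod>z\<in>roots F. [:-z, 1:])" by (simp add: RS G)
qed

end

subsection \<open>Characteristic sequences\<close>

text \<open>The support is bounded below by the order of the series, so a nonempty set of its
  exponents has a least element and the infimum in \<open>char_m\<close> is attained.\<close>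

lemma char_m_props:
  assumes "i \<in> supp F" "\<not> int (char_d F k) dvd i"
  shows "char_m F k \<in> supp F" "\<not> int (char_d F k) dvd char_m F k"
    and "\<And>j. j \<in> supp F \<Longrightarrow> j < char_m F k \<Longrightarrow> int (char_d F k) dvd j"
proof -
  define X where "X = {i \<in> supp F. \<not> int (char_d F k) dvd i}"
  define b where "b = fls_subdegree (newton_root F)"
  have b: "b \<le> j" if "j \<in> X" for j
    using that by (auto simp: X_def supp_def b_def intro: fls_subdegree_leI)
  have "\<exists>m\<in>X. \<forall>j\<in>X. m \<le> j"
  proof -
    define m where "m = (LEAST m. b + int m \<in> X)"
    have "b + int (nat (i - b)) \<in> X" using b[of i] assms by (auto simp: X_def)
    then have m: "b + int m \<in> X" unfolding m_def by (rule LeastI)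
    have "b + int m \<le> j" if "j \<in> X" for j
    proof -
      have "b + int (nat (j - b)) \<in> X" using b[OF that] that by simp
      then have "m \<le> nat (j - b)" unfolding m_def by (rule Least_le)
      with b[OF that] show ?thesis by linarith
    qed
    with m show ?thesis by blast
  qed
  then obtain m where m: "m \<in> X" "\<And>j. j \<in> X \<Longrightarrow> m \<le> j" by blast
  then have "char_m F k = m"
    unfolding char_m_def X_def[symmetric] by (intro cInf_eq_minimum)
  with m show "char_m F k \<in> supp F" "\<not> int (char_d F k) dvd char_m F k"
    "\<And>j. j \<in> supp F \<Longrightarrow> j < char_m F k \<Longrightarrow> int (char_d F k) dvd j"
    by (auto simp: X_def not_le[symmetric])
qed

lemma char_d_Suc: "k > 0 \<Longrightarrow> int (char_d F (Suc k)) = gcd (int (char_d F k)) (char_m F k)"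
  by (cases k) (simp_all add: char_m_def)

lemma char_d_Suc_dvd: "char_d F (Suc k) dvd char_d F k"
proof (cases k)
  case (Suc j)
  then have "int (char_d F (Suc k)) dvd int (char_d F k)" by (subst char_d_Suc) simp_all
  then show ?thesis by simp
qed simp

lemma char_d_dvd: "j \<le> k \<Longrightarrow> char_d F k dvd char_d F j"
  by (induction k rule: dec_induct) (auto intro: dvd_trans char_d_Suc_dvd)

text \<open>The exponents of a primitive parametrization have no common factor with its ramification.\<close>

locale characteristic =
  fixes F :: "'a :: field fls poly"
  assumes degree_pos: "degree F > 0"
    and primitive: "Gcd (insert (int (degree F)) (supp F)) = 1"
begin

abbreviation "h \<equiv> char_h F"

lemma char_d_pos: "char_d F k > 0"
proof -
  have "char_d F k dvd char_d F 0" by (rule char_d_dvd) simp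
  then show ?thesis using degree_pos by (auto intro: Nat.gr0I)
qed

lemma char_m_exists:
  assumes "char_d F k > 1"
  shows "\<exists>i\<in>supp F. \<not> int (char_d F k) dvd i"
proof (rule ccontr)
  assume "\<not> ?thesis"
  moreover have "char_d F k dvd degree F" using char_d_dvd[of 0 k F] by simp
  ultimately have "int (char_d F k) dvd Gcd (insert (int (degree F)) (supp F))"
    by (intro Gcd_greatest) auto
  with primitive assms show False by simp
qed

lemma char_d_Suc_less: "k > 0 \<Longrightarrow> char_d F k > 1 \<Longrightarrow> char_d F (Suc k) < char_d F k"
proof -
  assume k: "k > 0" "char_d F k > 1"
  from char_m_exists[OF k(2)] char_m_props[of _ F k] have nd: "\<not> int (char_d F k) dvd char_m F k"
    by blast
  have "char_d F (Suc k) \<noteq> char_d F k"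
  proof
    assume "char_d F (Suc k) = char_d F k"
    with char_d_Suc[OF k(1), of F] have "gcd (int (char_d F k)) (char_m F k) = int (char_d F k)" by simp
    then have "int (char_d F k) dvd char_m F k" by (metis gcd_dvd2)
    with nd show False by blast
  qed
  moreover have "char_d F (Suc k) \<le> char_d F k"
    using char_d_Suc_dvd char_d_pos by (intro dvd_imp_le)
  ultimately show ?thesis by simp
qed

text \<open>The \<open>d_k\<close> strictly decrease until they are 1, so 1 is reached after at most
  \<open>degree F\<close> steps; this gives the \<open>LEAST\<close> in \<open>char_h\<close> a
  witness.\<close>

lemma char_d_bound: "char_d F (Suc k) = 1 \<or> char_d F (Suc k) + k \<le> degree F"
proof (induction k)
  case (Suc k)
  show ?case
  proof (cases "char_d F (Suc k) > 1")
    case True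
    with char_d_Suc_less[of "Suc k"] Suc show ?thesis by linarith
  next
    case False
    with char_d_pos[of "Suc k"] have "char_d F (Suc k) = 1" by simp
    with char_d_Suc_dvd[of F "Suc k"] show ?thesis by simp
  qed
qed simp

lemma char_d_h: "char_d F (Suc h) = 1"
  unfolding char_h_def
proof (rule LeastI)
  show "char_d F (Suc (degree F)) = 1"
    using char_d_bound[of "degree F"] char_d_pos[of "Suc (degree F)"] by linarith
qed

lemma char_d_gt_1: "1 \<le> k \<Longrightarrow> k \<le> h \<Longrightarrow> char_d F k > 1"
proof -
  assume k: "1 \<le> k" "k \<le> h"
  then have "char_d F (Suc (k - 1)) \<noteq> 1"
    using not_less_Least[of "k - 1" "\<lambda>h. char_d F (Suc h) = 1"] by (auto simp: char_h_def)
  with k char_d_pos[of k] show ?thesis by simp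
qed

lemma char_d_eq_1: "k > h \<Longrightarrow> char_d F k = 1"
  using char_d_dvd[of "Suc h" k F] char_d_h by simp

lemma char_m_supp:
  assumes "1 \<le> k" "k \<le> h"
  shows "char_m F k \<in> supp F" "\<not> int (char_d F k) dvd char_m F k"
    and "\<And>j. j \<in> supp F \<Longrightarrow> j < char_m F k \<Longrightarrow> int (char_d F k) dvd j"
  using char_m_exists[OF char_d_gt_1[OF assms]] char_m_props[of _ F k] by blast+

lemma char_m_less_Suc:
  assumes "1 \<le> k" "Suc k \<le> h"
  shows "char_m F k < char_m F (Suc k)"
proof (rule ccontr)
  assume "\<not> ?thesis"
  then consider "char_m F (Suc k) < char_m F k" | "char_m F (Suc k) = char_m F k" by linarith
  then have "int (char_d F (Suc k)) dvd char_m F (Suc k)"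
  proof cases
    case 1
    have "int (char_d F k) dvd char_m F (Suc k)"
      using char_m_supp(1)[of "Suc k"] char_m_supp(3)[of k] 1 assms by simp
    moreover have "int (char_d F (Suc k)) dvd int (char_d F k)" using char_d_Suc_dvd by simp
    ultimately show ?thesis by (rule dvd_trans[rotated])
  next
    case 2
    have "int (char_d F (Suc k)) dvd char_m F k"
      using assms by (subst char_d_Suc) auto
    with 2 show ?thesis by simp
  qed
  with char_m_supp(2)[of "Suc k"] assms show False by simp
qed

lemma char_m_less: "1 \<le> j \<Longrightarrow> j < k \<Longrightarrow> k \<le> h \<Longrightarrow> char_m F j < char_m F k"
proof (induction k rule: nat_induct)
  case (Suc k)
  then show ?case
    using char_m_less_Suc[of k] by (cases "j = k") force+
qed simp

lemma char_m_le: "1 \<le> j \<Longrightarrow> j \<le> k \<Longrightarrow> k \<le> h \<Longrightarrow> char_m F j \<le> char_m F k"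
  using char_m_less[of j k] by (cases "j = k") auto

lemma char_exponent_mono:
  assumes "1 \<le> j" "j \<le> k"
  shows "char_exponent F j \<le> char_exponent F k"
  using char_m_le[of j k] assms by (auto simp: char_exponent_def divide_right_mono)

lemma char_exponent_less:
  assumes "1 \<le> j" "j < k" "j \<le> h"
  shows "char_exponent F j < char_exponent F k"
  using char_m_less[of j k] assms degree_pos by (auto simp: char_exponent_def divide_strict_right_mono)

text \<open>Replaces the recursion for \<open>d_k\<close> by a single gcd. By the recursion,
  \<open>m_1, ..., m_{k-1}\<close> force the gcd to divide \<open>d_k\<close>; conversely every
  exponent below \<open>m_k\<close> is a multiple of \<open>d_k\<close>.\<close>

lemma Gcd_eq_char_d:
  assumes k: "1 \<le> k" "k \<le> Suc h" and S: "S \<subseteq> supp F"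
    and low: "\<And>j. 1 \<le> j \<Longrightarrow> j < k \<Longrightarrow> char_m F j \<in> S"
    and high: "\<And>i. i \<in> S \<Longrightarrow> k \<le> h \<Longrightarrow> i < char_m F k"
  shows "Gcd (insert (int (degree F)) S) = int (char_d F k)"
proof (rule antisym)
  let ?g = "Gcd (insert (int (degree F)) S)"
  have "j \<le> k \<Longrightarrow> 1 \<le> j \<Longrightarrow> ?g dvd int (char_d F j)" for j
  proof (induction j rule: nat_induct)
    case (Suc j)
    show ?case
    proof (cases "j = 0")
      case False
      then have "?g dvd char_m F j" using Suc.prems low[of j] by (intro Gcd_dvd) auto
      moreover have "?g dvd int (char_d F j)" using Suc False by simp
      ultimately show ?thesis using False by (subst char_d_Suc) auto
    qed (simp add: Gcd_dvd)
  qed simp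
  from this[of k] k have "?g dvd int (char_d F k)" by simp
  then show "?g \<le> int (char_d F k)" using char_d_pos[of k] by (intro zdvd_imp_le) auto
  have "int (char_d F k) dvd ?g"
  proof (rule Gcd_greatest)
    fix i assume "i \<in> insert (int (degree F)) S"
    then show "int (char_d F k) dvd i"
    proof
      assume "i = int (degree F)"
      then show ?thesis using char_d_dvd[of 0 k F] by simp
    next
      assume i: "i \<in> S"
      show ?thesis
      proof (cases "k \<le> h")
        case True
        then show ?thesis using char_m_supp(3)[of k i] high[OF i] S i k by auto
      qed (simp add: char_d_eq_1)
    qed
  qed
  moreover have "?g > 0" using degree_pos by (intro le_neq_trans) auto
  ultimately show "int (char_d F k) \<le> ?g" by (intro zdvd_imp_le)
qed

end

section \<open>Stabilizers of balls and the characteristic sequence\<close>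

context root_of_unity
begin

lemma rooted_degree_pos: "rooted F \<Longrightarrow> degree F > 0"
  using is_unit_iff_degree[of F] by (auto simp: rooted_def irreducible_def)

lemma rooted_degree_dvd: "rooted F \<Longrightarrow> degree F dvd N"
  using rooted_orbit(4) by (auto simp: rooted_def)

lemma rooted_unramify: "rooted F \<Longrightarrow> N = degree F * (N div degree F)"
  using rooted_degree_dvd by simp

lemma rooted_ram_pos: "rooted F \<Longrightarrow> N div degree F > 0"
  using rooted_unramify[of F] N_pos by (metis mult_0_right neq0_conv)

lemma root_support_dvd:
  assumes F: "rooted F" and y: "y \<in> roots F" and "y $$ j \<noteq> 0"
  shows "int (N div degree F) dvd j"
proof -
  have "rot (w ^ degree F) y = y" using rooted_orbit(3)[OF F y] by simp
  then have "int N dvd int (degree F) * j" using assms(3) by (simp add: rot_w_eq_iff)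
  moreover have "int N = int (degree F) * int (N div degree F)"
    using rooted_unramify[OF F] by (metis of_nat_mult)
  ultimately show ?thesis using rooted_degree_pos[OF F] by simp
qed

text \<open>The roots in \<open>x^(1/N)\<close> have exponents divisible by \<open>N / n\<close>, so
  they come from series in \<open>x^(1/n)\<close>; hence the \<open>SOME\<close> in
  \<open>newton_root\<close> does pick a root.\<close>

lemma rooted_newton_root:
  assumes F: "rooted F"
  shows "fls_compose_power (newton_root F) (N div degree F) \<in> roots F"
proof -
  define n where "n = degree F"
  define e where "e = N div n"
  have N: "N = n * e" using rooted_unramify[OF F] by (simp add: n_def e_def)
  have e: "e > 0" and n: "n > 0" using N_pos N by (auto intro: Nat.gr0I)
  obtain y where y: "y \<in> roots F" using F by (auto simp: rooted_def)
  obtain u where u: "y = fls_compose_power u e"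
    using fls_compose_power_exists[OF e] root_support_dvd[OF F y] by (metis e_def n_def)
  have lift: "fls_compose_power v e \<in> roots F \<longleftrightarrow> v \<in> puiseux_roots n F" for v
    using e n by (simp add: puiseux_roots_def N fls_compose_power_eq_0_iff poly_subst_power
        flip: subst_power_subst_power)
  have "u \<in> puiseux_roots n F" using y lift u by simp
  then have "newton_root F \<in> puiseux_roots n F"
    unfolding newton_root_def n_def by (rule someI)
  then show ?thesis using lift by (simp add: e_def n_def)
qed

text \<open>Any other root is a conjugate, whose coefficients differ by nonzero factors only, so the
  support does not depend on the chosen root. The factor rescales exponents of
  \<open>x^(1/n)\<close> to exponents of \<open>x^(1/N)\<close>.\<close>

lemma supp_iff:
  assumes F: "rooted F" and y: "y \<in> roots F"
  shows "i \<in> supp F \<longleftrightarrow> y $$ (i * int (N div degree F)) \<noteq> 0"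
proof -
  define e where "e = N div degree F"
  have e: "e > 0" using rooted_ram_pos[OF F] by (simp add: e_def)
  obtain k where k: "fls_compose_power (newton_root F) e = rot (w ^ k) y"
    using rooted_newton_root[OF F] rooted_orbit(1)[OF F y] unfolding e_def by auto
  have "fls_compose_power (newton_root F) e $$ (i * int e) = newton_root F $$ i"
    using e by (simp add: fls_nth_compose_power)
  then have "newton_root F $$ i = (w ^ k) powi (i * int e) * y $$ (i * int e)"
    by (simp add: k)
  then show ?thesis by (simp add: supp_def e_def)
qed

text \<open>The number of conjugates of a root of \<open>F\<close> that agree with it below exponent
  \<open>c\<close> of \<open>x^(1/N)\<close>, as \<open>card_agree\<close> shows. The set
  \<open>supp F\<close> refers to \<open>x^(1/n)\<close>, hence the factor.\<close>

definition level_gcd :: "'a fls poly \<Rightarrow> int \<Rightarrow> int" where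
  "level_gcd F c = Gcd (insert (int (degree F)) {i \<in> supp F. i * int (N div degree F) < c})"

text \<open>The index of the stabilizer of a ball: the number of balls of radius \<open>c\<close>
  met by the roots of \<open>F\<close>, as \<open>card_balls\<close> shows.\<close>

definition period :: "'a fls poly \<Rightarrow> int \<Rightarrow> nat" where
  "period F c = degree F div nat (level_gcd F c)"

lemma dvd_mult_Gcd_iff:
  fixes k n :: int
  shows "n dvd k * Gcd A \<longleftrightarrow> (\<forall>i\<in>A. n dvd k * i)"
proof -
  have "n dvd k * Gcd A \<longleftrightarrow> n dvd Gcd ((*) k ` A)"
    by (simp add: Gcd_mult)
  then show ?thesis by (auto simp: dvd_Gcd_iff)
qed

lemma level_gcd:
  assumes F: "rooted F" 
  shows "level_gcd F c > 0" "level_gcd F c dvd int (degree F)"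
    "int (degree F) = level_gcd F c * int (period F c)" "period F c > 0" 
    "period F c dvd degree F"
proof -
  show dvd: "level_gcd F c dvd int (degree F)" by (simp add: level_gcd_def Gcd_dvd)
  with rooted_degree_pos[OF F] have "level_gcd F c \<noteq> 0" by auto
  moreover have "level_gcd F c \<ge> 0" by (simp add: level_gcd_def)
  ultimately show pos: "level_gcd F c > 0" by simp
  have "nat (level_gcd F c) dvd degree F" using dvd pos by (simp add: nat_dvd_iff)
  then have eq: "degree F = nat (level_gcd F c) * period F c"
    by (simp add: period_def)
  then show "int (degree F) = level_gcd F c * int (period F c)"
    using pos by (metis int_nat_eq less_imp_le of_nat_mult)
  show "period F c > 0" using eq rooted_degree_pos[OF F] by (metis mult_0_right neq0_conv)
  show "period F c dvd degree F" using eq by (metis dvd_triv_right)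
qed

text \<open>The divisibility conditions for the single exponents combine into
  \<open>n dvd k * gcd\<close>. The answer does not depend on the root \<open>y\<close>.\<close>

lemma agree_iff_period:
  assumes F: "rooted F" and y: "y \<in> roots F"
  shows "agree c (rot (w ^ k) y) y \<longleftrightarrow> period F c dvd k"
proof -
  define e where "e = N div degree F"
  have e: "e > 0" and N: "N = degree F * e"
    using rooted_ram_pos[OF F] rooted_unramify[OF F] by (simp_all add: e_def)
  have "agree c (rot (w ^ k) y) y \<longleftrightarrow> (\<forall>i<c. y $$ i \<noteq> 0 \<longrightarrow> int N dvd int k * i)"
    by (rule agree_rot_w)
  also have "\<dots> \<longleftrightarrow> (\<forall>i. i * int e < c \<longrightarrow> i \<in> supp F \<longrightarrow> int N dvd int k * (i * int e))"
    using supp_iff[OF F y] root_support_dvd[OF F y] unfolding e_def[symmetric] by (metis dvd_def mult.commute)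
  also have "\<dots> \<longleftrightarrow> (\<forall>i. i * int e < c \<longrightarrow> i \<in> supp F \<longrightarrow> int (degree F) dvd int k * i)"
    using e by (simp add: N mult.assoc[symmetric])
  also have "\<dots> \<longleftrightarrow> int (degree F) dvd int k * level_gcd F c"
    unfolding level_gcd_def dvd_mult_Gcd_iff by (auto simp: e_def)
  also have "\<dots> \<longleftrightarrow> int (period F c) dvd int k"
    using level_gcd(1)[OF F, of c] by (subst level_gcd(3)[OF F, of c]) (simp add: mult.commute)
  finally show ?thesis by simp
qed

text \<open>If \<open>g\<close> divides \<open>n\<close> and every exponent, then
  \<open>w^(n/g)\<close> fixes a root; since the orbit has \<open>n\<close> elements,
  \<open>n\<close> divides \<open>n/g\<close> and \<open>g = 1\<close>.\<close>

lemma rooted_characteristic: "rooted F \<Longrightarrow> characteristic F"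
proof
  assume F: "rooted F"
  show "degree F > 0" using F by (rule rooted_degree_pos)
  obtain y where y: "y \<in> roots F" using F by (auto simp: rooted_def)
  define e where "e = N div degree F"
  have e: "e > 0" and N: "N = degree F * e"
    using rooted_ram_pos[OF F] rooted_unramify[OF F] by (simp_all add: e_def)
  define g where "g = Gcd (insert (int (degree F)) (supp F))"
  have "g dvd int (degree F)" by (simp add: g_def Gcd_dvd)
  moreover have "g \<ge> 0" by (simp add: g_def)
  moreover from \<open>g dvd int (degree F)\<close> \<open>degree F > 0\<close> have "g \<noteq> 0" by auto
  ultimately have "g > 0" "nat g dvd degree F" by (simp_all add: nat_dvd_iff)
  then obtain k where "degree F = nat g * k" by blast
  with \<open>g > 0\<close> have k: "int (degree F) = g * int k" by simp
  have "int N dvd int k * j" if "y $$ j \<noteq> 0" for j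
  proof -
    have "int e dvd j" using root_support_dvd[OF F y that] by (simp add: e_def)
    then obtain i where "j = int e * i" by blast
    then have i: "j = i * int e" by simp
    have "i \<in> supp F" using that supp_iff[OF F y, of i] i by (simp add: e_def)
    then have "g dvd i" unfolding g_def by (intro Gcd_dvd) simp
    then have "g * int k dvd i * int k" by (rule mult_dvd_mono) simp
    then show ?thesis by (simp add: N k i mult.commute mult.assoc mult_dvd_mono)
  qed
  then have "rot (w ^ k) y = y" by (simp add: rot_w_eq_iff)
  then have "degree F dvd k" using rooted_orbit(3)[OF F y] by simp
  then have "g * int k dvd int k" using k by (metis int_dvd_int_iff)
  moreover have "k \<noteq> 0" using k \<open>degree F > 0\<close> by (intro notI) simp
  ultimately have "g dvd 1" by simp
  then show "Gcd (insert (int (degree F)) (supp F)) = 1"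
    using \<open>g \<ge> 0\<close> by (simp add: g_def)
qed

lemma char_exponent_ge_iff:
  assumes F: "rooted F"
  shows "ereal (lv c) \<le> char_exponent F k \<longleftrightarrow>
    char_h F < k \<or> c \<le> char_m F k * int (N div degree F)"
proof -
  define e where "e = N div degree F"
  have e: "e > 0" and N: "N = degree F * e"
    using rooted_ram_pos[OF F] rooted_unramify[OF F] by (simp_all add: e_def)
  have "lv c \<le> (of_int (char_m F k) / of_nat (degree F) :: real) \<longleftrightarrow>
    real_of_int c \<le> real_of_int (char_m F k * int e)"
    using e rooted_degree_pos[OF F] by (simp add: N field_simps)
  also have "\<dots> \<longleftrightarrow> c \<le> char_m F k * int e" by (rule of_int_le_iff)
  finally show ?thesis by (auto simp: char_exponent_def e_def)
qed

lemma char_exponent_le_iff: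
  assumes F: "rooted F"
  shows "char_exponent F k \<le> ereal (lv c) \<longleftrightarrow>
    k \<le> char_h F \<and> char_m F k * int (N div degree F) \<le> c"
proof -
  define e where "e = N div degree F"
  have e: "e > 0" and N: "N = degree F * e"
    using rooted_ram_pos[OF F] rooted_unramify[OF F] by (simp_all add: e_def)
  have "lv c \<ge> (of_int (char_m F k) / of_nat (degree F) :: real) \<longleftrightarrow>
    real_of_int c \<ge> real_of_int (char_m F k * int e)"
    using e rooted_degree_pos[OF F] by (simp add: N field_simps)
  also have "\<dots> \<longleftrightarrow> char_m F k * int e \<le> c" by (rule of_int_le_iff)
  finally show ?thesis by (auto simp: char_exponent_def e_def)
qed

text \<open>For \<open>m_{k-1} < c \<le> m_k\<close>, rescaled, the exponents below \<open>c\<close>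
  include \<open>m_1, ..., m_{k-1}\<close> and stop before \<open>m_k\<close>. The right inequality
  is weak because \<open>agree c\<close> concerns exponents strictly below \<open>c\<close>.\<close>

lemma level_gcd_eq:
  assumes F: "rooted F" and k: "1 \<le> k" "k = 1 \<or> char_exponent F (k - 1) < ereal (lv c)"
    "ereal (lv c) \<le> char_exponent F k"
  shows "level_gcd F c = int (char_d F k)"
proof -
  interpret characteristic F using F by (rule rooted_characteristic)
  define e where "e = N div degree F"
  have e: "e > 0" using rooted_ram_pos[OF F] by (simp add: e_def)
  have prev: "k - 1 \<le> h \<and> char_m F (k - 1) * int e < c" if "k \<noteq> 1"
  proof -
    from that k have "\<not> ereal (lv c) \<le> char_exponent F (k - 1)" by simp
    then show ?thesis by (auto simp: char_exponent_ge_iff[OF F] e_def)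
  qed
  have kh: "k \<le> Suc h" using prev by (cases "k = 1") auto
  have low: "char_m F j * int e < c" if "1 \<le> j" "j < k" for j
  proof -
    have "k \<noteq> 1" using that by simp
    have "char_m F j \<le> char_m F (k - 1)"
      using that prev[OF \<open>k \<noteq> 1\<close>] by (intro char_m_le) auto
    then have "char_m F j * int e \<le> char_m F (k - 1) * int e" by (rule mult_right_mono) simp
    with prev[OF \<open>k \<noteq> 1\<close>] show ?thesis by linarith
  qed
  show ?thesis
    unfolding level_gcd_def e_def[symmetric]
  proof (rule Gcd_eq_char_d)
    show "char_m F j \<in> {i \<in> supp F. i * int e < c}" if "1 \<le> j" "j < k" for j
      using low[OF that] char_m_supp(1)[of j] that kh by auto
    show "i < char_m F k" if "i \<in> {i \<in> supp F. i * int e < c}" "k \<le> h" for i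
    proof -
      have "c \<le> char_m F k * int e" using k(3) that(2) by (simp add: char_exponent_ge_iff[OF F] e_def)
      with that(1) have "i * int e < char_m F k * int e" by simp
      then show ?thesis using e by simp
    qed
  qed (use k kh in auto)
qed

end

subsection \<open>Contact\<close>

lemma puiseux_ord_minus_commute: "puiseux_ord p (y - z) = puiseux_ord p (z - y)"
  by (simp add: puiseux_ord_def fls_subdegree_minus_sym)

lemma contact_sym: "contact F G = contact G F"
  unfolding contact_def by (rule arg_cong[of _ _ Max]) (use puiseux_ord_minus_commute in blast)

context root_of_unity
begin

text \<open>\<open>F\<close> already splits at index \<open>N\<close>, so further ramification only
  rewrites the same roots.\<close>

lemma puiseux_roots_mult:
  assumes F: "rooted F" and "p > 0"
  shows "puiseux_roots (N * p) F = (\<lambda>y. fls_compose_power y p) ` roots F"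
proof -
  obtain y where y: "y \<in> roots F" using F by (auto simp: rooted_def)
  have fin: "finite (roots F)"
    using F N_pos by (intro finite_puiseux_roots) (auto simp: rooted_def)
  have "subst_power (N * p) F = subst_power p (\<Prod>z\<in>roots F. [:-z, 1:])"
    using rooted_orbit(5)[OF F y] assms(2) N_pos by (metis subst_power_subst_power)
  also have "\<dots> = (\<Prod>z\<in>roots F. [:- fls_compose_power z p, 1:])"
    using assms(2) by (simp add: subst_power_prod subst_power_pCons)
  finally show ?thesis
    using fin unfolding puiseux_roots_def[of "N * p"] by (auto simp: poly_prod)
qed

text \<open>\<open>contact\<close> ranges over all ramification indices. Lifted to index
  \<open>N * p\<close>, a pair of index \<open>p\<close> becomes the image of a pair of index
  \<open>N\<close>, so the maximum is taken over one finite set.\<close>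

lemma contact_eq_Max:
  assumes F: "rooted F" and G: "rooted G"
  shows "contact F G = Max ((\<lambda>(y, z). puiseux_ord N (y - z)) ` (roots F \<times> roots G))"
proof -
  have "\<exists>y'\<in>roots F. \<exists>z'\<in>roots G. puiseux_ord p (y - z) = puiseux_ord N (y' - z')"
    if p: "p > 0" and y: "y \<in> puiseux_roots p F" and z: "z \<in> puiseux_roots p G" for p y z
  proof -
    have lift: "fls_compose_power u N \<in> puiseux_roots (N * p) H" if "u \<in> puiseux_roots p H" for u H
    proof -
      have "subst_power (N * p) H = subst_power N (subst_power p H)"
        using p N_pos by (simp add: subst_power_subst_power mult.commute)
      with that show ?thesis by (simp add: puiseux_roots_def poly_subst_power)
    qed
    from lift[OF y] lift[OF z] obtain y' z' where
      y': "y' \<in> roots F" "fls_compose_power y N = fls_compose_power y' p" and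
      z': "z' \<in> roots G" "fls_compose_power z N = fls_compose_power z' p"
      by (auto simp: puiseux_roots_mult F G p)
    have "puiseux_ord p (y - z) = puiseux_ord (p * N) (fls_compose_power (y - z) N)"
      using p N_pos by (simp add: puiseux_ord_compose_power del: fls_compose_power_diff)
    also have "\<dots> = puiseux_ord (N * p) (fls_compose_power (y' - z') p)"
      by (simp add: y' z' mult.commute)
    also have "\<dots> = puiseux_ord N (y' - z')"
      using p N_pos by (simp add: puiseux_ord_compose_power del: fls_compose_power_diff)
    finally show ?thesis using y' z' by blast
  qed
  then have "{puiseux_ord p (y - z) | p y z. 0 < p \<and> y \<in> puiseux_roots p F \<and> z \<in> puiseux_roots p G} =
    (\<lambda>(y, z). puiseux_ord N (y - z)) ` (roots F \<times> roots G)"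
    using N_pos by (auto simp: image_iff)
  then show ?thesis by (simp add: contact_def)
qed

lemma contact_in:
  assumes F: "rooted F" and G: "rooted G"
  obtains y z where "y \<in> roots F" "z \<in> roots G" "contact F G = puiseux_ord N (y - z)"
    "\<And>y' z'. y' \<in> roots F \<Longrightarrow> z' \<in> roots G \<Longrightarrow> puiseux_ord N (y' - z') \<le> contact F G"
proof -
  define X where "X = (\<lambda>(y, z). puiseux_ord N (y - z)) ` (roots F \<times> roots G)"
  have "finite X" unfolding X_def
    using F G N_pos by (intro finite_imageI finite_cartesian_product finite_puiseux_roots) (auto simp: rooted_def)
  moreover have "X \<noteq> {}" using F G by (auto simp: X_def rooted_def)
  moreover have "contact F G = Max X" by (simp add: X_def contact_eq_Max F G)
  ultimately have "contact F G \<in> X" "\<And>x. x \<in> X \<Longrightarrow> x \<le> contact F G" by simp_all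
  then show ?thesis using that by (fastforce simp: X_def)
qed

lemma contact_ge_iff:
  assumes F: "rooted F" and G: "rooted G"
  shows "near c F G \<longleftrightarrow>
    (\<exists>y\<in>roots F. \<exists>z\<in>roots G. agree c y z)"
proof -
  obtain y z where yz: "y \<in> roots F" "z \<in> roots G" "contact F G = puiseux_ord N (y - z)"
    and le: "\<And>y' z'. y' \<in> roots F \<Longrightarrow> z' \<in> roots G \<Longrightarrow> puiseux_ord N (y' - z') \<le> contact F G"
    by (rule contact_in[OF F G]) blast
  show ?thesis
  proof
    assume "near c F G"
    then have "agree c y z" by (simp add: yz(3) puiseux_ord_ge_iff[OF N_pos])
    with yz show "\<exists>y\<in>roots F. \<exists>z\<in>roots G. agree c y z" by blast
  next
    assume "\<exists>y\<in>roots F. \<exists>z\<in>roots G. agree c y z"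
    then obtain y' z' where "y' \<in> roots F" "z' \<in> roots G"
      "ereal (lv c) \<le> puiseux_ord N (y' - z')"
      by (auto simp: puiseux_ord_ge_iff[OF N_pos])
    with le show "near c F G" by (blast intro: order_trans)
  qed
qed

lemma rooted_eq_of_common_root:
  assumes "rooted F" "rooted G" "y \<in> roots F" "y \<in> roots G"
  shows "F = G"
proof -
  have "F dvd G" "G dvd F"
    using assms by (auto intro!: rooted_dvd_of_common_root simp: rooted_def)
  then obtain c where c: "G = F * c" by blast
  have "F \<noteq> 0" "G \<noteq> 0" using assms by (auto simp: rooted_def)
  then have "degree F = degree G"
    using \<open>F dvd G\<close> \<open>G dvd F\<close> by (intro antisym dvd_imp_degree_le)
  with c \<open>F \<noteq> 0\<close> \<open>G \<noteq> 0\<close> have "degree c = 0" by (auto simp: degree_mult_eq)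
  then obtain a where a: "c = [:a:]" by (rule degree_eq_zeroE)
  with c have "lead_coeff G = a * lead_coeff F" by simp
  with assms(1,2) have "a = 1" by (simp add: rooted_def)
  with a c show ?thesis by simp
qed

lemma contact_real:
  assumes "rooted F" "rooted G" "F \<noteq> G"
  obtains c where "contact F G = ereal (lv c)"
proof -
  obtain y z where yz: "y \<in> roots F" "z \<in> roots G" "contact F G = puiseux_ord N (y - z)"
    by (rule contact_in[OF assms(1,2)]) blast
  then have "y \<noteq> z" using rooted_eq_of_common_root assms by blast
  then show ?thesis
    using yz(3) by (intro that[of "fls_subdegree (y - z)"]) (simp add: puiseux_ord_def)
qed

lemma contact_self: "rooted F \<Longrightarrow> contact F F = \<infinity>"
proof -
  assume F: "rooted F"
  then obtain y where y: "y \<in> roots F" by (auto simp: rooted_def)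
  have "puiseux_ord N (y - y) \<le> contact F F"
    by (rule contact_in[OF F F]) (use y in blast)
  then show ?thesis by (simp add: puiseux_ord_def)
qed

lemma rooted_conjugate:
  assumes "rooted F" "y \<in> roots F" "z \<in> roots F"
  obtains k where "z = rot (w ^ k) y"
  using rooted_orbit(1)[OF assms(1,2)] assms(3) by auto

text \<open>A close pair can be rotated until its first member is the prescribed root of
  \<open>F\<close>.\<close>

lemma contact_ge_root:
  assumes F: "rooted F" and G: "rooted G" and y: "y \<in> roots F"
    and c: "near c F G"
  obtains z where "z \<in> roots G" "agree c y z"
proof -
  from c obtain y' z' where y': "y' \<in> roots F" "z' \<in> roots G" "agree c y' z'"
    by (auto simp: contact_ge_iff F G)
  obtain k where "y = rot (w ^ k) y'" using rooted_conjugate[OF F y'(1) y] .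
  with y' have "agree c y (rot (w ^ k) z')" by (simp add: agree_rot)
  with that rot_root[OF y'(2)] show ?thesis by blast
qed

lemma contact_ultrametric:
  assumes "rooted F" "rooted G" "rooted H"
    and "near c F G" "near c G H"
  shows "near c F H"
proof -
  obtain y z where "y \<in> roots F" "z \<in> roots G" "agree c y z"
    using assms by (auto simp: contact_ge_iff)
  moreover obtain x where "x \<in> roots H" "agree c z x"
    using contact_ge_root[OF assms(2,3) \<open>z \<in> _\<close> assms(5)] .
  ultimately show ?thesis using assms by (auto simp: contact_ge_iff intro: agree_trans)
qed


subsection \<open>Counting conjugate roots\<close>

text \<open>Balls are sets of arbitrary series, so that roots of different components can have the
  same ball, and \<open>card\<close> counts distinct balls.\<close>

definition balls :: "int \<Rightarrow> 'a fls set \<Rightarrow> 'a fls set set" where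
  "balls c Y = (\<lambda>y. {z. agree c y z}) ` Y"

lemma ball_eq_iff: "{z. agree c y z} = {z. agree c y' z} \<longleftrightarrow> agree c y y'"
  using agree_refl agree_sym agree_trans by blast

lemma agree_rot_pow:
  assumes "rooted F" "y \<in> roots F" "i \<le> j"
  shows "agree c (rot (w ^ i) y) (rot (w ^ j) y) \<longleftrightarrow> period F c dvd j - i"
proof -
  have "rot (w ^ j) y = rot (w ^ i) (rot (w ^ (j - i)) y)"
    using assms(3) by (simp add: rot_rot flip: power_add)
  then show ?thesis
    using agree_iff_period[OF assms(1,2), of c "j - i"] by (simp add: agree_rot agree_sym)
qed

lemma card_multiples_lessThan:
  assumes "p dvd n" "p > 0"
  shows "card {k. k < n \<and> p dvd k} = n div p"
proof -
  from assms obtain m where n: "n = p * m" by blast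
  have "{k. k < n \<and> p dvd k} = (\<lambda>j. p * j) ` {..<m}"
    using assms(2) by (auto simp: n)
  moreover have "inj_on (\<lambda>j. p * j) {..<m}" using assms(2) by (auto simp: inj_on_def)
  ultimately show ?thesis using assms(2) by (simp add: card_image n)
qed

lemma card_agree:
  assumes F: "rooted F" and y: "y \<in> roots F"
  shows "int (card {z \<in> roots F. agree c z y}) = level_gcd F c"
proof -
  have "{z \<in> roots F. agree c z y} = (\<lambda>k. rot (w ^ k) y) ` {k. k < degree F \<and> period F c dvd k}"
    using rooted_orbit(1)[OF F y] agree_iff_period[OF F y, of c] by auto
  moreover have "inj_on (\<lambda>k. rot (w ^ k) y) {k. k < degree F \<and> period F c dvd k}"
    using rooted_orbit(2)[OF F y] by (rule inj_on_subset) auto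
  ultimately have "card {z \<in> roots F. agree c z y} = degree F div period F c"
    using level_gcd(4,5)[OF F, of c] by (simp add: card_image card_multiples_lessThan)
  then have "int (card {z \<in> roots F. agree c z y}) = int (degree F) div int (period F c)"
    by (simp add: zdiv_int)
  also have "\<dots> = level_gcd F c"
    using level_gcd(4)[OF F, of c] by (simp add: level_gcd(3)[OF F, of c])
  finally show ?thesis .
qed

text \<open>The ball of the \<open>k\<close>-th conjugate depends only on \<open>k\<close> modulo
  the period, and different residues give different balls.\<close>

lemma card_balls:
  assumes F: "rooted F"
  shows "card (balls c (roots F)) = period F c"
proof -
  obtain y where y: "y \<in> roots F" using F by (auto simp: rooted_def)
  define p where "p = period F c"
  have p: "p > 0" "p dvd degree F" using level_gcd(4,5)[OF F] by (simp_all add: p_def)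
  then have ple: "p \<le> degree F" using rooted_degree_pos[OF F] by (simp add: dvd_imp_le)
  define b where "b = (\<lambda>k. {z. agree c (rot (w ^ k) y) z})"
  have mod: "b k = b (k mod p)" for k
    using agree_rot_pow[OF F y, of "k mod p" k c] unfolding b_def ball_eq_iff
    by (subst agree_sym) (simp add: p_def[symmetric] minus_mod_eq_mult_div)
  have "balls c (roots F) = b ` {..<degree F}"
    unfolding balls_def rooted_orbit(1)[OF F y] by (simp add: image_image b_def)
  also have "\<dots> = b ` {..<p}"
  proof (intro antisym image_subsetI)
    fix k assume "k \<in> {..<degree F}"
    show "b k \<in> b ` {..<p}" using mod[of k] p by auto
  qed (use ple in auto)
  also have "card \<dots> = p"
  proof -
    have "inj_on b {..<p}"
    proof (rule linorder_inj_onI)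
      fix i j assume ij: "i < j" "i \<in> {..<p}" "j \<in> {..<p}"
      then have "\<not> p dvd j - i" by (auto dest!: dvd_imp_le)
      then show "b i \<noteq> b j"
        using agree_rot_pow[OF F y, of i j c] ij unfolding b_def ball_eq_iff by (simp add: p_def)
    qed auto
    then show ?thesis by (simp add: card_image)
  qed
  finally show ?thesis by (simp add: p_def)
qed

subsection \<open>Intersection numbers\<close>

text \<open>The sum of \<open>min(c, ord(z - y))\<close> over the conjugates \<open>z\<close> of
  \<open>y\<close>: the order in \<open>t\<close> of \<open>F\<close> at a series that agrees with
  its nearest root \<open>y\<close> exactly up to \<open>c\<close>. The case distinction takes care
  of \<open>z = y\<close>.\<close>

definition order_sum :: "'a fls poly \<Rightarrow> 'a fls \<Rightarrow> int \<Rightarrow> int" where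
  "order_sum F y c = (\<Sum>z\<in>roots F. if agree c z y then c else fls_subdegree (z - y))"

text \<open>Equal gcds at \<open>c + 1\<close> and \<open>d\<close> mean that a conjugate agreeing
  with \<open>y\<close> beyond \<open>c\<close> agrees with it up to \<open>d\<close>. There are
  \<open>level_gcd F d\<close> of these, and each adds \<open>d - c\<close>.\<close>

lemma order_sum_step:
  assumes F: "rooted F" and y: "y \<in> roots F" and "c \<le> d"
    and step: "c < d \<Longrightarrow> level_gcd F (c + 1) = level_gcd F d"
  shows "order_sum F y d = order_sum F y c + (d - c) * level_gcd F d"
proof (cases "c < d")
  case True
  define R where "R = roots F"
  have fin: "finite R" unfolding R_def
    using F N_pos by (intro finite_puiseux_roots) (auto simp: rooted_def)
  have "{z \<in> R. agree d z y} \<subseteq> {z \<in> R. agree (c + 1) z y}"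
    using True agree_mono[of d _ y "c + 1"] by auto
  moreover have "card {z \<in> R. agree d z y} = card {z \<in> R. agree (c + 1) z y}"
    using card_agree[OF F y] step[OF True] unfolding R_def by (metis of_nat_eq_iff)
  ultimately have same: "{z \<in> R. agree d z y} = {z \<in> R. agree (c + 1) z y}"
    using fin by (intro card_subset_eq) auto
  have "(if agree d z y then d else fls_subdegree (z - y)) =
    (if agree c z y then c else fls_subdegree (z - y)) + (if agree d z y then d - c else 0)"
    if "z \<in> R" for z
  proof (cases "agree d z y")
    case True
    then have "agree c z y" using assms(3) by (rule agree_mono)
    with True show ?thesis by simp
  next
    case False
    with same that have n: "\<not> agree (c + 1) z y" by blast
    then have "z \<noteq> y" by auto
    with n False show ?thesis by (auto simp: agree_iff_subdegree)
  qed
  then have "order_sum F y d = order_sum F y c + (\<Sum>z\<in>R. if agree d z y then d - c else 0)"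
    unfolding order_sum_def R_def[symmetric] by (simp add: sum.distrib[symmetric])
  also have "(\<Sum>z\<in>R. if agree d z y then d - c else 0) = int (card {z \<in> R. agree d z y}) * (d - c)"
    using fin by (simp add: sum.If_cases Int_def)
  finally show ?thesis using card_agree[OF F y, of d] by (simp add: R_def)
qed (use assms in simp)

text \<open>Up to the first characteristic exponent all conjugates agree, so every summand is
  \<open>c\<close>.\<close>

lemma order_sum_low:
  assumes F: "rooted F" and y: "y \<in> roots F"
    and "ereal (lv c) \<le> char_exponent F 1"
  shows "order_sum F y c = int (degree F) * c"
proof -
  define R where "R = roots F"
  have fin: "finite R" unfolding R_def
    using F N_pos by (intro finite_puiseux_roots) (auto simp: rooted_def)
  have "card R = degree F"
    using rooted_orbit(1,2)[OF F y] by (simp add: R_def card_image)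
  moreover have "level_gcd F c = int (degree F)"
    using level_gcd_eq[OF F, of 1 c] assms(3) by simp
  then have "card {z \<in> R. agree c z y} = degree F"
    using card_agree[OF F y, of c] by (simp add: R_def)
  ultimately have "{z \<in> R. agree c z y} = R" using fin by (intro card_subset_eq) auto
  then have "order_sum F y c = (\<Sum>z\<in>R. c)"
    unfolding order_sum_def R_def by (intro sum.cong) auto
  then show ?thesis using \<open>card R = degree F\<close> by simp
qed

text \<open>Multiplied by \<open>d_{k+1}\<close>, the recursion of \<open>char_r\<close> reads
  \<open>r_{k+1} d_{k+1} = r_k d_k + (m_{k+1} - m_k) d_{k+1}\<close>. This is the growth of
  \<open>order_sum\<close> between consecutive characteristic exponents, up to the factor
  \<open>N / n\<close>.\<close>

lemma order_sum_char:
  assumes F: "rooted F" and y: "y \<in> roots F" and k: "1 \<le> k" "k \<le> char_h F"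
  shows "real_of_int (order_sum F y (char_m F k * int (N div degree F))) =
    char_r F k * real (char_d F k) * (real (N div degree F))"
  using k
proof (induction k rule: nat_induct)
  case (Suc k)
  interpret characteristic F using F by (rule rooted_characteristic)
  define e where "e = N div degree F"
  have e: "e > 0" using rooted_ram_pos[OF F] by (simp add: e_def)
  show ?case
  proof (cases "k = 0")
    case True
    have "order_sum F y (char_m F 1 * int e) = int (degree F) * (char_m F 1 * int e)"
      using Suc.prems True char_exponent_ge_iff[OF F, of "char_m F 1 * int e" 1]
      by (intro order_sum_low F y) (simp add: e_def)
    then show ?thesis using True by (simp add: e_def)
  next
    case False
    define c where "c = char_m F k * int e"
    define d where "d = char_m F (Suc k) * int e"
    have "c < d" using False Suc.prems char_m_less[of k "Suc k"] e by (simp add: c_def d_def)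
    have gcd: "level_gcd F i = int (char_d F (Suc k))" if "c < i" "i \<le> d" for i
    proof (rule level_gcd_eq[OF F])
      show "ereal (lv i) \<le> char_exponent F (Suc k)"
        using that by (simp add: char_exponent_ge_iff[OF F] d_def e_def)
      have "\<not> ereal (lv i) \<le> char_exponent F k"
        using that Suc.prems by (simp add: char_exponent_ge_iff[OF F] c_def e_def)
      then show "Suc k = 1 \<or> char_exponent F (Suc k - 1) < ereal (lv i)"
        by (simp add: not_le)
    qed simp
    define m m' where "m = real_of_int (char_m F k)" and "m' = real_of_int (char_m F (Suc k))"
    define D where "D = real (char_d F (Suc k))"
    have step: "order_sum F y d = order_sum F y c + (d - c) * int (char_d F (Suc k))"
      using order_sum_step[OF F y, of c d] gcd[of d] gcd[of "c + 1"] \<open>c < d\<close> by simp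
    have prev: "real_of_int (order_sum F y c) = char_r F k * real (char_d F k) * real e"
      using Suc.IH Suc.prems False by (simp add: c_def e_def)
    have r: "char_r F (Suc k) * D = char_r F k * real (char_d F k) + (m' - m) * D"
    proof -
      obtain j where j: "k = Suc j" using False by (cases k) auto
      have "char_r F (Suc k) = char_r F k * real (char_d F k) / D + m' - m"
        unfolding j D_def m_def m'_def by (rule char_r.simps(3))
      moreover have "(a / D + b - c) * D = a + (b - c) * D" for a b c
      proof -
        have "D \<noteq> 0" using char_d_pos[of "Suc k"] by (simp only: D_def)
        then show ?thesis by (simp add: left_diff_distrib distrib_right)
      qed
      ultimately show ?thesis by (simp only:)
    qed
    have "real_of_int (order_sum F y d) = char_r F k * real (char_d F k) * real e + (real_of_int d - real_of_int c) * D"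
      by (simp only: step of_int_add of_int_mult of_int_diff prev D_def of_int_of_nat_eq)
    also have "real_of_int d - real_of_int c = (m' - m) * real e"
      by (simp add: c_def d_def m_def m'_def algebra_simps)
    also have "char_r F k * real (char_d F k) * real e + (m' - m) * real e * D =
      (char_r F k * real (char_d F k) + (m' - m) * D) * real e"
      by (simp add: distrib_right mult.assoc mult.commute[of D])
    also have "\<dots> = char_r F (Suc k) * D * real e" by (simp only: r)
    finally show ?thesis by (simp only: D_def d_def e_def)
  qed
qed simp

text \<open>\<open>S\<close> is piecewise linear in \<open>M\<close>, with slopes proportional to
  the number of conjugates that still agree, just as \<open>order_sum\<close>. The factor
  \<open>n / N\<close> undoes the rescaling of exponents.\<close>

lemma char_S_eq_order_sum:
  assumes F: "rooted F" and y: "y \<in> roots F"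
  shows "char_S F (lv c) = real_of_int (order_sum F y c) * real (degree F) / real N"
proof -
  interpret characteristic F using F by (rule rooted_characteristic)
  define e where "e = N div degree F"
  have e: "e > 0" and N: "N = degree F * e"
    using rooted_ram_pos[OF F] rooted_unramify[OF F] by (simp_all add: e_def)
  define M where "M = (lv c :: real)"
  show ?thesis
  proof (cases "ereal M < char_exponent F 1")
    case True
    then have "order_sum F y c = int (degree F) * c"
      by (intro order_sum_low F y) (simp add: M_def)
    with True show ?thesis by (simp add: char_S_def M_def)
  next
    case False
    \<comment> \<open>The maximum of this set is the index selected by \<open>THE\<close> in
      \<open>char_S\<close>: that of the last characteristic exponent not exceeding
      \<open>M\<close>.\<close>
    define A where "A = {k. 1 \<le> k \<and> k \<le> h \<and> char_exponent F k \<le> ereal M}"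
    have "1 \<le> h" using False by (auto simp: char_exponent_def not_less split: if_splits)
    with False have "1 \<in> A" by (simp add: A_def not_less)
    moreover have "finite A" by (rule finite_subset[of _ "{..h}"]) (auto simp: A_def)
    ultimately have Max: "Max A \<in> A" "\<And>k. k \<in> A \<Longrightarrow> k \<le> Max A" by (auto intro: Max_in)
    define k where "k = Max A"
    have k: "1 \<le> k" "k \<le> h" "char_exponent F k \<le> ereal M" using Max(1) by (auto simp: A_def k_def)
    have nxt: "ereal M < char_exponent F (k + 1)"
    proof (rule ccontr)
      assume n: "\<not> ?thesis"
      then have "k + 1 \<le> h" by (auto simp: char_exponent_def split: if_splits)
      with n have "k + 1 \<in> A" by (auto simp: A_def)
      with Max(2) show False by (fastforce simp: k_def)
    qed
    have "(THE k. 1 \<le> k \<and> k \<le> h \<and> char_exponent F k \<le> ereal M \<and> ereal M < char_exponent F (k + 1)) = k"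
    proof (rule the_equality)
      fix j assume j: "1 \<le> j \<and> j \<le> h \<and> char_exponent F j \<le> ereal M \<and> ereal M < char_exponent F (j + 1)"
      show "j = k"
      proof (rule linorder_cases[of j k])
        assume "j < k"
        then have "char_exponent F (j + 1) \<le> char_exponent F k" by (intro char_exponent_mono) auto
        with j k show ?thesis by (meson leD order_trans)
      next
        assume "k < j"
        then have "char_exponent F (k + 1) \<le> char_exponent F j" by (intro char_exponent_mono) auto
        with j nxt show ?thesis by (meson leD order_trans)
      qed
    qed (use k nxt in auto)
    then have S: "char_S F M = char_r F k * of_nat (char_d F k)
        + (of_nat (degree F) * M - of_int (char_m F k)) * of_nat (char_d F (k + 1))"
      using False by (simp add: char_S_def Let_def)
    define b where "b = char_m F k * int e"
    have bc: "b \<le> c" using k(3) by (simp add: M_def b_def char_exponent_le_iff[OF F] e_def)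
    have gcd: "level_gcd F d = int (char_d F (k + 1))" if "b < d" "d \<le> c" for d
    proof (rule level_gcd_eq[OF F])
      show "ereal (lv d) \<le> char_exponent F (k + 1)"
        using less_imp_le[OF nxt] that unfolding M_def char_exponent_ge_iff[OF F] by auto
      have "\<not> ereal (lv d) \<le> char_exponent F k"
        using that k by (simp add: char_exponent_ge_iff[OF F] b_def e_def)
      then show "k + 1 = 1 \<or> char_exponent F (k + 1 - 1) < ereal (lv d)"
        by (simp add: not_le)
    qed simp
    have "order_sum F y c = order_sum F y b + (c - b) * level_gcd F c"
      using gcd[of "b + 1"] gcd[of c] bc by (intro order_sum_step[OF F y]) auto
    also have "(c - b) * level_gcd F c = (c - b) * int (char_d F (k + 1))"
      using gcd[of c] bc by (cases "b = c") auto
    finally have "real_of_int (order_sum F y c) = real_of_int (order_sum F y b)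
       + (real_of_int c - real_of_int b) * real (char_d F (k + 1))" by simp
    also have "real_of_int (order_sum F y b) = char_r F k * real (char_d F k) * real e"
      using order_sum_char[OF F y k(1,2)] by (simp add: b_def e_def)
    finally have ord: "real_of_int (order_sum F y c) =
      char_r F k * real (char_d F k) * real e + (of_int c - of_int (char_m F k) * real e) * real (char_d F (k + 1))"
      by (simp only: b_def of_int_mult of_int_of_nat_eq)
    have "(A * e' + (c - m * e') * D) * n / (n * e') = A + (n * (c / (n * e')) - m) * D"
      if "e' > 0" "n > 0" for A c m D e' n :: real
      using that by (simp add: field_simps)
    from this[of "real e" "real (degree F)"] show ?thesis
      using e degree_pos unfolding S[unfolded M_def] ord by (simp only: N of_nat_mult of_nat_0_less_iff)
  qed
qed

end

subsection \<open>Roots of the derivative in a ball\<close>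

definition vanishes_below :: "int \<Rightarrow> 'a :: zero fls \<Rightarrow> bool" where
  "vanishes_below c u \<longleftrightarrow> (\<forall>i<c. u $$ i = 0)"

lemma vanishes_below_mono: "vanishes_below d u \<Longrightarrow> c \<le> d \<Longrightarrow> vanishes_below c u"
  by (auto simp: vanishes_below_def)

lemma vanishes_below_0 [simp]: "vanishes_below c 0"
  by (simp add: vanishes_below_def)

lemma vanishes_below_diff:
  fixes u v :: "'a :: ab_group_add fls"
  shows "vanishes_below c u \<Longrightarrow> vanishes_below c v \<Longrightarrow> vanishes_below c (u - v)"
  by (simp add: vanishes_below_def)

lemma vanishes_below_le_subdegree:
  "u \<noteq> 0 \<Longrightarrow> vanishes_below c u \<Longrightarrow> c \<le> fls_subdegree u"
  by (intro fls_subdegree_geI) (auto simp: vanishes_below_def)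

lemma
  fixes u v :: "'a :: field fls"
  assumes "vanishes_below c u" "vanishes_below d v"
  shows vanishes_below_mult: "vanishes_below (c + d) (u * v)"
    and nth_mult_vanishes_below: "(u * v) $$ (c + d) = u $$ c * v $$ d"
proof -
  have "vanishes_below (c + d) (u * v) \<and> (u * v) $$ (c + d) = u $$ c * v $$ d"
  proof (cases "u = 0 \<or> v = 0")
    case False
    with assms have le: "c \<le> fls_subdegree u" "d \<le> fls_subdegree v"
      by (auto intro: vanishes_below_le_subdegree)
    have "vanishes_below (c + d) (u * v)"
      using le unfolding vanishes_below_def by (auto intro: fls_times_nth_eq0)
    moreover have "(u * v) $$ (c + d) = u $$ c * v $$ d"
    proof (cases "fls_subdegree u = c \<and> fls_subdegree v = d")
      case True
      then show ?thesis by (auto simp: fls_times_nth(2))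
    next
      case False
      with le have "c + d < fls_subdegree u + fls_subdegree v" by linarith
      then have "(u * v) $$ (c + d) = 0" by (rule fls_times_nth_eq0)
      moreover have "u $$ c = 0 \<or> v $$ d = 0"
        using False le by (metis fls_eq0_below_subdegree le_neq_trans)
      ultimately show ?thesis by auto
    qed
    ultimately show ?thesis by blast
  qed auto
  then show "vanishes_below (c + d) (u * v)" "(u * v) $$ (c + d) = u $$ c * v $$ d" by auto
qed

text \<open>For the Gauss norm of radius \<open>c\<close>, the last coefficient of maximal norm has the number of roots
  in the ball as its index.\<close>

definition newton_peak :: "int \<Rightarrow> 'a :: field fls poly \<Rightarrow> nat \<Rightarrow> int \<Rightarrow> bool" where
  "newton_peak c p k m \<longleftrightarrow> (\<forall>i. vanishes_below (m - int i * c) (coeff p i)) \<and>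
     coeff p k $$ (m - int k * c) \<noteq> 0 \<and> (\<forall>i>k. vanishes_below (m - int i * c + 1) (coeff p i))"

lemma newton_peak_unique:
  assumes "newton_peak c p k m" "newton_peak c p k' m'"
  shows "k = k'"
proof -
  have *: False if "newton_peak c p k m" "newton_peak c p k' m'" "m < m'" for k k' m m'
    using that unfolding newton_peak_def vanishes_below_def by auto
  have "m = m'" using *[of k m k' m'] *[of k' m' k m] assms by (metis linorder_neqE)
  have **: False if "newton_peak c p k m" "newton_peak c p k' m" "k < k'" for k k'
    using that unfolding newton_peak_def vanishes_below_def by auto
  then show ?thesis using assms \<open>m = m'\<close> by (metis linorder_neqE)
qed

text \<open>The factor \<open>y - x\<close> has its own peak at index 1 if \<open>x\<close> lies in
  the ball of radius \<open>c\<close> around 0 and at index 0 otherwise; under multiplication peak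
  indices add. The height \<open>m\<close> grows by \<open>c\<close> or by the order of
  \<open>x\<close>.\<close>

lemma newton_peak_linear_factor:
  fixes p :: "'a :: field fls poly"
  assumes "newton_peak c p k m"
  shows "\<exists>m'. newton_peak c ([:-x, 1:] * p) (if vanishes_below c x then Suc k else k) m'"
proof -
  have low: "vanishes_below (m - int i * c) (coeff p i)"
    and top: "coeff p k $$ (m - int k * c) \<noteq> 0"
    and high: "i > k \<Longrightarrow> vanishes_below (m - int i * c + 1) (coeff p i)" for i
    using assms by (auto simp: newton_peak_def)
  define q where "q = [:-x, 1:] * p"
  have q0: "coeff q 0 = 0 - x * coeff p 0" by (simp add: q_def)
  have qS: "coeff q (Suc i) = coeff p i - x * coeff p (Suc i)" for i
    by (simp add: q_def)
  show ?thesis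
  proof (cases "vanishes_below c x")
    case x: True
    have x_low: "vanishes_below (m + c - int i * c) (x * coeff p i)" for i
      using vanishes_below_mult[OF x low[of i]] by (simp add: algebra_simps)
    have x_high: "vanishes_below (m + c - int i * c + 1) (x * coeff p i)" if "i > k" for i
      using vanishes_below_mult[OF x high[OF that]] by (simp add: algebra_simps)
    have p_low: "vanishes_below (m + c - int (Suc i) * c) (coeff p i)" for i
      using low[of i] by (simp add: algebra_simps)
    have p_high: "vanishes_below (m + c - int (Suc i) * c + 1) (coeff p i)" if "i > k" for i
      using high[OF that] by (simp add: algebra_simps)
    have "newton_peak c q (Suc k) (m + c)"
      unfolding newton_peak_def
    proof (intro conjI allI impI)
      fix i show "vanishes_below (m + c - int i * c) (coeff q i)"
      proof (cases i)
        case 0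
        then show ?thesis using x_low[of 0] unfolding q0 0 by (intro vanishes_below_diff) simp_all
      next
        case (Suc j)
        then show ?thesis using x_low[of i] p_low[of j] unfolding Suc qS by (intro vanishes_below_diff)
      qed
    next
      have "(x * coeff p (Suc k)) $$ (m - int k * c) = 0"
        using x_high[of "Suc k"] by (simp add: vanishes_below_def algebra_simps)
      then show "coeff q (Suc k) $$ (m + c - int (Suc k) * c) \<noteq> 0"
        using top by (simp add: qS algebra_simps)
    next
      fix i assume "Suc k < i"
      then obtain j where "i = Suc j" "k < j" by (cases i) auto
      then show "vanishes_below (m + c - int i * c + 1) (coeff q i)"
        using x_high[of i] p_high[of j] unfolding \<open>i = Suc j\<close> qS by (intro vanishes_below_diff) auto
    qed
    then show ?thesis using x by (auto simp: q_def)
  next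
    case x: False
    define a where "a = fls_subdegree x"
    have "a < c" using x by (auto simp: vanishes_below_def a_def not_le[symmetric] dest: fls_eq0_below_subdegree
          intro: order_less_le_trans)
    have va: "vanishes_below a x" by (simp add: vanishes_below_def a_def)
    have "x \<noteq> 0" using x by auto
    then have xa: "x $$ a \<noteq> 0" by (simp add: a_def)
    have x_low: "vanishes_below (m + a - int i * c) (x * coeff p i)" for i
      using vanishes_below_mult[OF va low[of i]] by (simp add: algebra_simps)
    have x_high: "vanishes_below (m + a - int i * c + 1) (x * coeff p i)" if "i > k" for i
      using vanishes_below_mult[OF va high[OF that]] by (simp add: algebra_simps)
    have p_low: "vanishes_below (m + a - int (Suc i) * c + 1) (coeff p i)" for i
      using low[of i] \<open>a < c\<close> by (elim vanishes_below_mono) (simp add: algebra_simps)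
    have "newton_peak c q k (m + a)"
      unfolding newton_peak_def
    proof (intro conjI allI impI)
      fix i show "vanishes_below (m + a - int i * c) (coeff q i)"
      proof (cases i)
        case 0
        then show ?thesis using x_low[of 0] unfolding q0 0 by (intro vanishes_below_diff) simp_all
      next
        case (Suc j)
        have "vanishes_below (m + a - int (Suc j) * c) (coeff p j)"
          using p_low[of j] by (elim vanishes_below_mono) simp
        then show ?thesis using x_low[of i] unfolding Suc qS by (intro vanishes_below_diff)
      qed
    next
      \<comment> \<open>At this exponent the other contribution, from the coefficient
        \<open>k - 1\<close> of \<open>p\<close>, is 0 because \<open>a < c\<close>; so the product
        cannot be cancelled.\<close>
      have eq: "(x * coeff p k) $$ (m + a - int k * c) = x $$ a * coeff p k $$ (m - int k * c)"
        using nth_mult_vanishes_below[OF va low[of k]] by (simp add: algebra_simps)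
      show "coeff q k $$ (m + a - int k * c) \<noteq> 0"
      proof (cases k)
        case 0
        then show ?thesis using eq top xa by (simp add: q0)
      next
        case (Suc j)
        have "coeff p j $$ (m + a - int k * c) = 0"
          using p_low[of j] by (simp add: vanishes_below_def Suc)
        then show ?thesis using eq top xa unfolding Suc qS by simp
      qed
    next
      fix i assume "k < i"
      then obtain j where "i = Suc j" by (cases i) auto
      with \<open>k < i\<close> show "vanishes_below (m + a - int i * c + 1) (coeff q i)"
        using x_high[of i] p_low[of j] unfolding \<open>i = Suc j\<close> qS by (intro vanishes_below_diff) auto
    qed
    then show ?thesis using x by (auto simp: q_def)
  qed
qed

lemma newton_peak_split:
  fixes b :: "'a :: field fls"
  assumes "b \<noteq> 0"
  shows "\<exists>m. newton_peak c (smult b (\<Prod>x\<in>#A. [:-x, 1:])) (size {#x \<in># A. vanishes_below c x#}) m"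
proof (induction A)
  case empty
  have "newton_peak c [:b:] 0 (fls_subdegree b)"
    using assms by (auto simp: newton_peak_def vanishes_below_def coeff_pCons split: nat.splits)
  then show ?case by auto
next
  case (add x A)
  then obtain m where "newton_peak c (smult b (\<Prod>x\<in>#A. [:-x, 1:])) (size {#x \<in># A. vanishes_below c x#}) m"
    by blast
  from newton_peak_linear_factor[OF this, of x] show ?case
    by (auto simp: mult_ac simp del: mult_pCons_left mult_pCons_right split: if_splits)
qed

text \<open>The factors \<open>i + 1\<close> are nonzero in characteristic 0, so differentiation
  shifts indices by one and leaves the orders of the coefficients unchanged.\<close>

lemma newton_peak_pderiv:
  fixes p :: "'a :: field_char_0 fls poly"
  assumes "newton_peak c p (Suc k) m"
  shows "newton_peak c (pderiv p) k (m - c)"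
proof -
  have nth: "coeff (pderiv p) i $$ j = of_nat (Suc i) * coeff p (Suc i) $$ j" for i j
    unfolding coeff_pderiv by (rule fls_mult_of_nat_nth)
  have idx: "m - c - int i * c = m - int (Suc i) * c" for i by (simp add: algebra_simps)
  show ?thesis
    using assms unfolding newton_peak_def vanishes_below_def nth idx
    by (auto simp del: of_nat_Suc)
qed

lemma pcompose_split:
  fixes b a :: "'a :: idom"
  shows "smult b (\<Prod>x\<in>#A. [:-x, 1:]) \<circ>\<^sub>p [:a, 1:] = smult b (\<Prod>x\<in>#image_mset (\<lambda>x. x - a) A. [:-x, 1:])"
proof -
  have "(\<Prod>x\<in>#A. [:-x, 1:]) \<circ>\<^sub>p [:a, 1:] = (\<Prod>x\<in>#image_mset (\<lambda>x. x - a) A. [:-x, 1:])"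
  proof (induction A)
    case (add x A)
    have "[:-x, 1:] \<circ>\<^sub>p [:a, 1:] = [:- (x - a), 1:]" by (simp add: pcompose_pCons)
    with add show ?case by (simp add: pcompose_mult del: mult_pCons_left)
  qed (simp add: pcompose_1)
  then show ?thesis by (simp add: pcompose_smult)
qed

text \<open>After moving the centre \<open>a\<close> to 0, the peak index of a split polynomial is
  its number of roots in the ball; the derivative has peak index one less, and peak indices are
  unique.\<close>

lemma rolle_ball:
  fixes p :: "'a :: field_char_0 fls poly"
  assumes p: "p = smult b (\<Prod>x\<in>#A. [:-x, 1:])" "b \<noteq> 0"
    and p': "pderiv p = smult b' (\<Prod>x\<in>#A'. [:-x, 1:])" "b' \<noteq> 0"
    and k: "size {#x \<in># A. agree c a x#} > 0"
  shows "Suc (size {#x \<in># A'. agree c a x#}) = size {#x \<in># A. agree c a x#}"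
proof -
  have agree: "vanishes_below c (x - a) \<longleftrightarrow> agree c a x" for x
    by (auto simp: vanishes_below_def agree_def)
  have sz: "size {#x \<in># image_mset (\<lambda>x. x - a) B. vanishes_below c x#} = size {#x \<in># B. agree c a x#}" for B
    by (simp add: filter_mset_image_mset agree)
  obtain k where k: "size {#x \<in># A. agree c a x#} = Suc k" using k by (cases "size {#x \<in># A. agree c a x#}") auto
  obtain m where "newton_peak c (p \<circ>\<^sub>p [:a, 1:]) (Suc k) m"
    using newton_peak_split[OF p(2), of c "image_mset (\<lambda>x. x - a) A"]
    unfolding p(1) pcompose_split sz k by blast
  then have "newton_peak c (pderiv (p \<circ>\<^sub>p [:a, 1:])) k (m - c)" by (rule newton_peak_pderiv)
  moreover have "pderiv (p \<circ>\<^sub>p [:a, 1:]) = pderiv p \<circ>\<^sub>p [:a, 1:]"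
    by (simp add: pderiv_pcompose pderiv_pCons)
  moreover obtain m' where "newton_peak c (pderiv p \<circ>\<^sub>p [:a, 1:]) (size {#x \<in># A'. agree c a x#}) m'"
    using newton_peak_split[OF p'(2), of c "image_mset (\<lambda>x. x - a) A'"]
    unfolding p'(1) pcompose_split sz by blast
  ultimately have "size {#x \<in># A'. agree c a x#} = k"
    using newton_peak_unique by metis
  then show ?thesis by (simp add: k)
qed

lemma size_filter_Union_disjoint:
  assumes "finite B" "pairwise disjnt B"
  shows "size {#x \<in># A. x \<in> \<Union>B#} = (\<Sum>b\<in>B. size {#x \<in># A. x \<in> b#})"
  using assms
proof (induction B)
  case (insert b B)
  then have "b \<inter> \<Union>B = {}" "pairwise disjnt B"
    by (auto simp: pairwise_def disjnt_def)
  then have "{#x \<in># A. x \<in> \<Union>(insert b B)#} = {#x \<in># A. x \<in> b#} + {#x \<in># A. x \<in> \<Union>B#}"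
    by (intro multiset_eqI) auto
  with insert \<open>pairwise disjnt B\<close> show ?case by simp
qed simp

context root_of_unity
begin

lemma disjoint_balls: "pairwise disjnt (balls c Y)"
  unfolding balls_def by (auto simp: pairwise_def disjnt_def agree_def)

text \<open>Each ball is centred at a root of \<open>p\<close>, so its count drops by exactly one;
  balls of equal radius are disjoint, so the counts add up.\<close>

lemma rolle_balls:
  assumes p: "p = smult b (\<Prod>x\<in>#mset_set R. [:-x, 1:])" "b \<noteq> 0" "finite R"
    and p': "pderiv p = smult b' (\<Prod>x\<in>#A'. [:-x, 1:])" "b' \<noteq> 0" and Y: "Y \<subseteq> R"
  shows "size {#x \<in># A'. x \<in> \<Union>(balls c Y)#} + card (balls c Y) = card (R \<inter> \<Union>(balls c Y))"
proof -
  define B where "B = balls c Y"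
  have B: "finite B" "pairwise disjnt B"
    using finite_subset[OF Y p(3)] disjoint_balls by (auto simp: B_def balls_def)
  have "Suc (size {#x \<in># A'. x \<in> b#}) = size {#x \<in># mset_set R. x \<in> b#}" if "b \<in> B" for b
  proof -
    from that obtain y where y: "y \<in> Y" "b = {z. agree c y z}" by (auto simp: B_def balls_def)
    then have "y \<in># {#x \<in># mset_set R. agree c y x#}" using Y p(3) by auto
    then have "size {#x \<in># mset_set R. agree c y x#} > 0"
      by (metis empty_iff nonempty_has_size set_mset_empty)
    from rolle_ball[OF p(1,2) p' this] show ?thesis by (simp add: y(2))
  qed
  then have "(\<Sum>b\<in>B. Suc (size {#x \<in># A'. x \<in> b#})) = (\<Sum>b\<in>B. size {#x \<in># mset_set R. x \<in> b#})"
    by (intro sum.cong) auto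
  then have "size {#x \<in># A'. x \<in> \<Union>B#} + card B = size {#x \<in># mset_set R. x \<in> \<Union>B#}"
    unfolding size_filter_Union_disjoint[OF B] by (simp add: sum_Suc)
  also have "\<dots> = card (R \<inter> \<Union>B)"
    using p(3) by (simp add: filter_mset_mset_set) (simp add: Int_def)
  finally show ?thesis by (simp add: B_def)
qed

end

subsection \<open>Factorization into components\<close>

lemma normalize_fls_poly: "normalize F = smult (inverse (lead_coeff F)) F"
  for F :: "'a :: field fls poly"
  by (simp add: poly_eq_iff normalize_poly_eq_map_poly coeff_map_poly divide_inverse mult.commute)

text \<open>Over a field, monic means normalized, so the factorization into primes becomes one into
  components.\<close>

lemma components_eq_prime_factors:
  fixes g :: "'a :: field fls poly"
  assumes "g \<noteq> 0"
  shows "components g = prime_factors g"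
proof -
  have "lead_coeff F = 1 \<longleftrightarrow> normalize F = F" if "F \<noteq> 0" for F :: "'a fls poly"
  proof
    assume "normalize F = F"
    then have "lead_coeff F = lead_coeff (smult (inverse (lead_coeff F)) F)"
      by (simp add: normalize_fls_poly)
    also have "\<dots> = 1" using that by simp
    finally show "lead_coeff F = 1" .
  qed (simp add: normalize_fls_poly)
  then have prime: "prime F \<longleftrightarrow> lead_coeff F = 1 \<and> irreducible F" for F :: "'a fls poly"
    by (cases "F = 0") (auto simp: prime_def prime_elem_iff_irreducible)
  show ?thesis
    using assms by (auto simp: components_def in_prime_factors_iff prime)
qed

lemma components_factorization:
  fixes g :: "'a :: field fls poly"
  assumes "g \<noteq> 0"
  shows "g = smult (lead_coeff g) (\<Prod>G\<in>components g. G ^ multiplicity G g)"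
  using assms by (simp add: components_eq_prime_factors prod_prime_factors normalize_fls_poly)

lemma finite_components: "g \<noteq> 0 \<Longrightarrow> finite (components g)"
  for g :: "'a :: field fls poly"
  by (simp add: components_eq_prime_factors)

text \<open>Linear factors are removed in turn: \<open>p\<close> either vanishes at \<open>x\<close>
  or divides the product without \<open>y - x\<close>.\<close>

lemma dvd_split_has_root:
  fixes p :: "'a :: field poly"
  assumes "p dvd smult b (\<Prod>x\<in>#A. [:-x, 1:])" "b \<noteq> 0" "degree p > 0"
  shows "\<exists>x\<in>#A. poly p x = 0"
  using assms(1)
proof (induction A)
  case empty
  then have "degree p \<le> degree [:b:]" using assms(2) by (intro dvd_imp_degree_le) auto
  with assms(3) show ?case by simp
next
  case (add x A)
  show ?case
  proof (cases "poly p x = 0")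
    case False
    define S where "S = smult b (\<Prod>x\<in>#A. [:-x, 1:])"
    have "smult b (\<Prod>x\<in>#add_mset x A. [:-x, 1:]) = [:-x, 1:] * S"
      by (simp add: S_def mult_ac del: mult_pCons_left mult_pCons_right)
    then obtain q where q: "[:-x, 1:] * S = p * q"
      using add.prems by (metis dvdE)
    have "poly ([:-x, 1:] * S) x = 0" by simp
    then have "poly p x * poly q x = 0" unfolding q by simp
    then obtain q' where "q = [:-x, 1:] * q'" using False by (auto simp: poly_eq_0_iff_dvd)
    with q have "[:-x, 1:] * S = [:-x, 1:] * (p * q')"
      by (simp only: mult_ac)
    then have "S = p * q'" by (subst (asm) mult_cancel_left) auto
    then show ?thesis using add.IH by (auto simp: S_def)
  qed simp
qed

lemma prod_mset_repeat_mset: "(\<Prod>x\<in>#repeat_mset n A. f x) = (\<Prod>x\<in>#A. f x) ^ n"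
  for f :: "'b \<Rightarrow> 'a :: comm_monoid_mult"
  by (induction n) simp_all

lemma prod_mset_sum: "(\<Prod>x\<in>#(\<Sum>i\<in>I. A i). f x) = (\<Prod>i\<in>I. \<Prod>x\<in>#A i. f x)"
  for f :: "'b \<Rightarrow> 'a :: comm_monoid_mult"
  by (induction I rule: infinite_finite_induct) simp_all

lemma size_filter_repeat_mset: "size (filter_mset P (repeat_mset n A)) = n * size (filter_mset P A)"
  by (induction n) simp_all

lemma size_filter_sum: "size (filter_mset P (\<Sum>i\<in>I. A i)) = (\<Sum>i\<in>I. size (filter_mset P (A i)))"
  by (induction I rule: infinite_finite_induct) simp_all

lemma sum_mset_set_disjoint:
  assumes "finite I" "\<And>i. i \<in> I \<Longrightarrow> finite (A i)"
    and "\<And>i j x. i \<in> I \<Longrightarrow> j \<in> I \<Longrightarrow> x \<in> A i \<Longrightarrow> x \<in> A j \<Longrightarrow> i = j"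
  shows "(\<Sum>i\<in>I. mset_set (A i)) = mset_set (\<Union>i\<in>I. A i)"
  using assms
proof (induction I)
  case (insert i I)
  have "A i \<inter> (\<Union>j\<in>I. A j) = {}" using insert.hyps insert.prems(2) by blast
  then have "mset_set (A i \<union> (\<Union>j\<in>I. A j)) = mset_set (A i) + mset_set (\<Union>j\<in>I. A j)"
    using insert.hyps insert.prems(1) by (intro mset_set_Union) auto
  with insert show ?case by simp
qed simp

context root_of_unity
begin

text \<open>Multiplicities are kept because the derivative need not be squarefree.\<close>

definition root_mset :: "'a fls poly \<Rightarrow> 'a fls multiset" where
  "root_mset g = (\<Sum>G\<in>components g. repeat_mset (multiplicity G g) (mset_set (roots G)))"

lemma finite_rooted: "rooted F \<Longrightarrow> finite (roots F)"
  using N_pos by (intro finite_puiseux_roots) (auto simp: rooted_def)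

lemma rooted_card: "rooted F \<Longrightarrow> card (roots F) = degree F"
  using rooted_orbit(1,2) by (fastforce simp: rooted_def card_image)

lemma rooted_component:
  assumes "G \<in> components g" "g \<noteq> 0" "splits (subst_power N g)"
  shows "rooted G"
proof -
  obtain A where A: "subst_power N g = smult (lead_coeff (subst_power N g)) (\<Prod>x\<in>#A. [:-x, 1:])"
    using assms(3) by blast
  have G: "lead_coeff G = 1" "irreducible G" "G dvd g" using assms by (auto simp: components_def)
  have "degree G > 0" using G(2) is_unit_iff_degree[of G] by (auto simp: irreducible_def)
  moreover have "subst_power N G dvd subst_power N g" using G(3) by (auto simp: subst_power_mult)
  ultimately have "\<exists>x\<in>#A. poly (subst_power N G) x = 0"
    using assms(2) A N_pos by (intro dvd_split_has_root[of _ "lead_coeff (subst_power N g)"])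
      (auto simp: degree_subst_power subst_power_eq_0_iff)
  with G show ?thesis by (auto simp: rooted_def puiseux_roots_def)
qed

lemma subst_power_root_mset:
  assumes "g \<noteq> 0" "\<And>G. G \<in> components g \<Longrightarrow> rooted G"
  shows "subst_power N g = smult (fls_compose_power (lead_coeff g) N) (\<Prod>x\<in>#root_mset g. [:-x, 1:])"
proof -
  have "(\<Prod>x\<in>#mset_set (roots G). [:-x, 1:]) = subst_power N G" if "G \<in> components g" for G
  proof -
    have G: "rooted G" using that by (rule assms(2))
    then obtain y where "y \<in> roots G" by (auto simp: rooted_def)
    from rooted_orbit(5)[OF G this] show ?thesis by (simp add: prod_unfold_prod_mset)
  qed
  then have "(\<Prod>x\<in>#root_mset g. [:-x, 1:]) = (\<Prod>G\<in>components g. subst_power N G ^ multiplicity G g)"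
    unfolding root_mset_def prod_mset_sum prod_mset_repeat_mset by (intro prod.cong) simp_all
  then show ?thesis
    by (subst components_factorization[OF assms(1)])
      (simp add: subst_power_smult subst_power_prod subst_power_power N_pos)
qed

lemma size_filter_root_mset:
  assumes "\<And>G. G \<in> components g \<Longrightarrow> rooted G"
  shows "size {#x \<in># root_mset g. p x#} =
    (\<Sum>G\<in>components g. multiplicity G g * card {x \<in> roots G. p x})"
  unfolding root_mset_def size_filter_sum size_filter_repeat_mset
  using finite_rooted[OF assms] by (intro sum.cong) (simp_all add: filter_mset_mset_set)

lemma level_le_iff: "ereal (lv a) \<le> ereal (lv b) \<longleftrightarrow> a \<le> b"
  using N_pos by (simp add: divide_le_cancel)

text \<open>Orders in \<open>t\<close> are integers, so no contact lies strictly between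
  \<open>c / N\<close> and \<open>(c + 1) / N\<close>. For \<open>F = G\<close> the contact is
  infinite and both sides are false.\<close>

lemma contact_eq_iff:
  assumes "rooted F" "rooted G"
  shows "contact F G = ereal (lv c) \<longleftrightarrow>
    near c F G \<and> \<not> near (c + 1) F G"
proof (cases "F = G")
  case False
  obtain d where d: "contact F G = ereal (lv d)"
    using contact_real[OF assms False] .
  have "ereal (lv a) = ereal (lv b) \<longleftrightarrow> a = b"
    and "ereal (lv a) \<le> ereal (lv b) \<longleftrightarrow> a \<le> b" for a b
    using N_pos by (simp_all add: divide_le_cancel)
  then show ?thesis unfolding d by (simp only:) auto
qed (simp add: contact_self assms)

end

section \<open>Roots of a reduced polynomial and of its derivative\<close>

locale reduced_polynomial = root_of_unity N w
  for N :: nat and w :: "'a :: {alg_closed_field, field_char_0}" +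
  fixes f :: "'a fls poly"
  assumes f_monic: "lead_coeff f = 1" and f_squarefree: "squarefree f"
    and f_split: "splits (subst_power N f)" and df_split: "splits (subst_power N (pderiv f))"
begin

lemma f_nonzero: "f \<noteq> 0"
  using f_monic by auto

lemma rooted_f: "F \<in> components f \<Longrightarrow> rooted F"
  using rooted_component f_split f_nonzero by blast

lemma df_nonzero:
  assumes "components f \<noteq> {}"
  shows "pderiv f \<noteq> 0"
proof -
  obtain F where F: "F \<in> components f" using assms by blast
  then have "F dvd f" by (simp add: components_def)
  then have "degree F \<le> degree f" using f_nonzero by (rule dvd_imp_degree_le)
  with rooted_degree_pos[OF rooted_f[OF F]] show ?thesis by (auto simp: pderiv_eq_0_iff)
qed

lemma rooted_df: "components f \<noteq> {} \<Longrightarrow> G \<in> components (pderiv f) \<Longrightarrow> rooted G"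
  using rooted_component df_split df_nonzero by blast

lemma multiplicity_f: "F \<in> components f \<Longrightarrow> multiplicity F f = 1"
  using f_squarefree f_nonzero by (simp add: components_eq_prime_factors squarefree_factorial_semiring')

definition f_roots :: "'a fls set" where
  "f_roots = (\<Union>F\<in>components f. roots F)"

lemma finite_f_roots: "finite f_roots"
  using finite_rooted rooted_f f_nonzero by (auto simp: f_roots_def finite_components)

lemma root_mset_f: "root_mset f = mset_set f_roots"
proof -
  have "root_mset f = (\<Sum>F\<in>components f. mset_set (roots F))"
    unfolding root_mset_def by (intro sum.cong) (simp_all add: multiplicity_f)
  also have "\<dots> = mset_set f_roots"
    unfolding f_roots_def
    using finite_components[OF f_nonzero] finite_rooted rooted_f rooted_eq_of_common_root
    by (intro sum_mset_set_disjoint) blast+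
  finally show ?thesis .
qed

text \<open>The level is encoded by the integer \<open>c\<close>, as \<open>M = c / N\<close>.\<close>

definition is_cluster :: "int \<Rightarrow> 'a fls poly set \<Rightarrow> bool" where
  "is_cluster c P \<longleftrightarrow> P \<noteq> {} \<and> P \<subseteq> components f \<and>
     (\<forall>F\<in>P. \<forall>G\<in>P. near c F G) \<and>
     (\<forall>F\<in>P. \<forall>G\<in>components f - P. \<not> near c F G)"

definition cluster_roots :: "'a fls poly set \<Rightarrow> 'a fls set" where
  "cluster_roots P = (\<Union>F\<in>P. roots F)"

lemma degree_Q_part:
  assumes P: "is_cluster c P"
  shows "degree (Q_part (pderiv f) (lv c, P)) + card (balls c (cluster_roots P)) =
    card (balls (c + 1) (cluster_roots P))"
proof -
  have sub: "P \<subseteq> components f" and "P \<noteq> {}"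
    and con: "\<And>F G. F \<in> P \<Longrightarrow> G \<in> P \<Longrightarrow> near c F G"
    and sep: "\<And>F G. F \<in> P \<Longrightarrow> G \<in> components f \<Longrightarrow> G \<notin> P \<Longrightarrow> \<not> near c F G"
    using P by (auto simp: is_cluster_def)
  have ne: "components f \<noteq> {}" using sub \<open>P \<noteq> {}\<close> by blast
  have rP: "rooted F" if "F \<in> P" for F using that sub rooted_f by blast
  define Y where "Y = cluster_roots P"
  define U where "U = (\<lambda>d. \<Union>(balls d Y))"
  have U: "z \<in> U d \<longleftrightarrow> (\<exists>F\<in>P. \<exists>y\<in>roots F. agree d y z)" for z d
    by (auto simp: U_def balls_def Y_def cluster_roots_def)
  have U_mono: "U (c + 1) \<subseteq> U c"
    using agree_mono[of "c + 1" _ _ c] unfolding subset_iff U by auto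
  have Yf: "Y \<subseteq> f_roots" using sub by (auto simp: Y_def cluster_roots_def f_roots_def)
  \<comment> \<open>The class is separated from the other components at level \<open>c\<close>,
    which keeps their roots out of the balls of this and of any smaller radius.\<close>
  have f_U: "f_roots \<inter> U d = Y" if "d \<ge> c" for d
  proof (intro antisym subsetI)
    fix z assume z: "z \<in> f_roots \<inter> U d"
    then obtain G F y where G: "G \<in> components f" "z \<in> roots G"
      and F: "F \<in> P" "y \<in> roots F" "agree d y z"
      by (auto simp: U f_roots_def)
    have "agree c y z" using F(3) that by (rule agree_mono)
    then have "near c F G"
      using F G by (auto simp: contact_ge_iff rP rooted_f)
    then have "G \<in> P" using sep F G by blast
    with G show "z \<in> Y" by (auto simp: Y_def cluster_roots_def)
  next
    fix z assume "z \<in> Y"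
    then show "z \<in> f_roots \<inter> U d"
      using Yf by (auto simp: U Y_def cluster_roots_def intro: agree_refl)
  qed
  define A' where "A' = root_mset (pderiv f)"
  have rdf: "\<And>G. G \<in> components (pderiv f) \<Longrightarrow> rooted G" using rooted_df ne by blast
  \<comment> \<open>The right side is \<open>card Y\<close> for both radii, which is why it cancels
    in the end.\<close>
  have rolle: "size {#x \<in># A'. x \<in> U d#} + card (balls d Y) = card Y" if "d \<ge> c" for d
  proof -
    have "size {#x \<in># A'. x \<in> U d#} + card (balls d Y) = card (f_roots \<inter> U d)"
      unfolding U_def A'_def
    proof (rule rolle_balls)
      show "subst_power N f = smult (fls_compose_power (lead_coeff f) N) (\<Prod>x\<in>#mset_set f_roots. [:-x, 1:])"
        using subst_power_root_mset[OF f_nonzero rooted_f] by (simp only: root_mset_f)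
      show "pderiv (subst_power N f) =
        smult (fls_compose_power (lead_coeff (pderiv f)) N) (\<Prod>x\<in>#root_mset (pderiv f). [:-x, 1:])"
        using subst_power_root_mset[OF df_nonzero[OF ne] rdf] by (simp only: subst_power_pderiv[OF N_pos])
    qed (use Yf finite_f_roots f_nonzero df_nonzero[OF ne] N_pos in \<open>simp_all add: fls_compose_power_eq_0_iff\<close>)
    with f_U[OF that] show ?thesis by simp
  qed
  define sel where "sel = {G \<in> components (pderiv f). \<forall>F\<in>P. contact F G = ereal (lv c)}"
  \<comment> \<open>A single root of \<open>G\<close> decides whether \<open>G\<close> is selected.
    Conversely, closeness to one \<open>F1\<close> spreads to all of \<open>P\<close> by the
    ultrametric inequality.\<close>
  have sel_iff: "G \<in> sel \<longleftrightarrow> z \<in> U c - U (c + 1)"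
    if G: "G \<in> components (pderiv f)" and z: "z \<in> roots G" for G z
  proof
    have rG: "rooted G" using rdf[OF G] .
    assume "G \<in> sel"
    then have "\<And>F. F \<in> P \<Longrightarrow> near c G F \<and>
       \<not> near (c + 1) F G"
      using contact_eq_iff[OF rP rG] by (auto simp: sel_def contact_sym[of G])
    moreover obtain F where F: "F \<in> P" using \<open>P \<noteq> {}\<close> by blast
    ultimately have 1: "near c G F"
      and 2: "\<And>F. F \<in> P \<Longrightarrow> \<not> near (c + 1) F G" by auto
    obtain y where "y \<in> roots F" "agree c z y"
      using contact_ge_root[OF rG rP[OF F] z 1] .
    then have "z \<in> U c" using F by (auto simp: U agree_sym[of c z])
    moreover have "z \<notin> U (c + 1)"
    proof
      assume "z \<in> U (c + 1)"
      then obtain F y where "F \<in> P" "y \<in> roots F" "agree (c + 1) y z" by (auto simp: U)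
      with z contact_ge_iff[OF rP rG, of F "c + 1"] 2 show False by blast
    qed
    ultimately show "z \<in> U c - U (c + 1)" by blast
  next
    have rG: "rooted G" using rdf[OF G] .
    assume zU: "z \<in> U c - U (c + 1)"
    then obtain F1 y1 where F1: "F1 \<in> P" "y1 \<in> roots F1" "agree c y1 z" by (auto simp: U)
    have "contact F G = ereal (lv c)" if F: "F \<in> P" for F
      unfolding contact_eq_iff[OF rP[OF F] rG]
    proof
      have "near c F1 G"
        using F1 z by (auto simp: contact_ge_iff rP rG)
      then show "near c F G"
        using contact_ultrametric[OF rP[OF F] rP[OF F1(1)] rG con[OF F F1(1)]] by blast
      show "\<not> near (c + 1) F G"
      proof
        assume "near (c + 1) F G"
        then have "near (c + 1) G F" by (simp only: contact_sym)
        then obtain y where "y \<in> roots F" "agree (c + 1) z y"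
          by (rule contact_ge_root[OF rG rP[OF F] z])
        then show False using zU F by (auto simp: U agree_sym[of _ z])
      qed
    qed
    then show "G \<in> sel" using G by (simp add: sel_def)
  qed
  have "size {#x \<in># A'. x \<in> U c - U (c + 1)#} =
    (\<Sum>G\<in>components (pderiv f). multiplicity G (pderiv f) * card {x \<in> roots G. x \<in> U c - U (c + 1)})"
    unfolding A'_def by (rule size_filter_root_mset) (rule rdf)
  also have "\<dots> = (\<Sum>G\<in>components (pderiv f). multiplicity G (pderiv f) * (if G \<in> sel then degree G else 0))"
  proof (intro sum.cong refl)
    fix G assume G: "G \<in> components (pderiv f)"
    then have "{x \<in> roots G. x \<in> U c - U (c + 1)} = (if G \<in> sel then roots G else {})"
      using sel_iff[OF G] by auto
    then show "multiplicity G (pderiv f) * card {x \<in> roots G. x \<in> U c - U (c + 1)} =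
      multiplicity G (pderiv f) * (if G \<in> sel then degree G else 0)"
      using rooted_card[OF rdf[OF G]] by simp
  qed
  also have "\<dots> = (\<Sum>G\<in>sel. multiplicity G (pderiv f) * degree G)"
    using finite_components[OF df_nonzero[OF ne]]
    by (intro sum.mono_neutral_cong_right) (auto simp: sel_def)
  also have "\<dots> = degree (Q_part (pderiv f) (lv c, P))"
  proof -
    have "\<And>G. G \<in> sel \<Longrightarrow> G \<noteq> 0" by (auto simp: sel_def components_def)
    then show ?thesis
      unfolding Q_part_def fst_conv snd_conv sel_def[symmetric]
      by (simp add: degree_prod_sum_eq degree_power_eq)
  qed
  finally have "degree (Q_part (pderiv f) (lv c, P)) = size {#x \<in># A'. x \<in> U c - U (c + 1)#}" ..
  moreover have "size {#x \<in># A'. x \<in> U c#} = size {#x \<in># A'. x \<in> U c - U (c + 1)#} + size {#x \<in># A'. x \<in> U (c + 1)#}"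
  proof -
    have "{#x \<in># A'. x \<in> U c#} = {#x \<in># A'. x \<in> U c - U (c + 1)#} + {#x \<in># A'. x \<in> U (c + 1)#}"
      using U_mono by (intro multiset_eqI) auto
    then show ?thesis by simp
  qed
  ultimately show ?thesis using rolle[of c] rolle[of "c + 1"] by (simp add: Y_def)
qed

end

section \<open>Contacts and intersection numbers of the factor of the derivative\<close>

lemma components_Q_part:
  fixes H :: "'a :: field fls poly"
  assumes G: "G \<in> components (Q_part H p)" and "H \<noteq> 0"
  shows "G \<in> components H" "\<And>F. F \<in> snd p \<Longrightarrow> contact F G = ereal (fst p)"
proof -
  define sel where "sel = {G \<in> components H. \<forall>F\<in>snd p. contact F G = ereal (fst p)}"
  have Q: "Q_part H p = (\<Prod>G\<in>sel. G ^ multiplicity G H)" by (simp add: Q_part_def sel_def)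
  have fin: "finite sel" using finite_components[OF \<open>H \<noteq> 0\<close>] by (simp add: sel_def)
  have prime: "prime G'" if "G' \<in> sel" for G'
    using that \<open>H \<noteq> 0\<close> by (auto simp: sel_def components_eq_prime_factors)
  have nz: "Q_part H p \<noteq> 0" using fin prime by (auto simp: Q)
  have "prime G" "G dvd Q_part H p"
    using G nz by (auto simp: components_eq_prime_factors)
  then obtain G' where "G' \<in> sel" "G dvd G' ^ multiplicity G' H"
    using fin by (auto simp: Q prime_dvd_prod_iff)
  with \<open>prime G\<close> prime have "G = G'"
    by (metis prime_dvd_power primes_dvd_imp_eq)
  with \<open>G' \<in> sel\<close> show "G \<in> components H" "\<And>F. F \<in> snd p \<Longrightarrow> contact F G = ereal (fst p)"
    by (auto simp: sel_def)
qed

context root_of_unity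
begin

text \<open>Isosceles triangle: \<open>F1\<close> and \<open>G\<close> are closer to each other than
  \<open>F\<close> is to \<open>F1\<close>.\<close>

lemma contact_outside:
  assumes "rooted F" "rooted F1" "rooted G"
    and "\<not> near c F F1" "near c F1 G"
  shows "contact F G = contact F F1"
proof -
  have "F \<noteq> F1" using assms contact_self by auto
  obtain d where d: "contact F F1 = ereal (lv d)"
    using contact_real[OF assms(1,2) \<open>F \<noteq> F1\<close>] .
  then have "d < c" using assms(4) by (simp only: level_le_iff not_le)
  have le: "near a F1 G" if "a \<le> c" for a
    using that level_le_iff[of a c] assms(5) by (meson order_trans)
  have "near d F G"
    using contact_ultrametric[OF assms(1-3), of d] le[of d] d \<open>d < c\<close> by simp
  moreover have "\<not> near (d + 1) F G"
  proof
    assume "near (d + 1) F G"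
    moreover have "near (d + 1) G F1"
      using le[of "d + 1"] \<open>d < c\<close> by (simp only: contact_sym)
    ultimately have "near (d + 1) F F1"
      by (rule contact_ultrametric[OF assms(1,3,2)])
    with d contact_eq_iff[OF assms(1,2), of d] show False by simp
  qed
  ultimately show ?thesis
    unfolding d by (subst contact_eq_iff[OF assms(1,3)]) blast
qed

text \<open>Both sums compute \<open>char_S\<close>, in which no root occurs.\<close>

lemma order_sum_independent:
  assumes "rooted F" "y \<in> roots F" "z \<in> roots F"
  shows "order_sum F y c = order_sum F z c"
proof -
  have "real_of_int (order_sum F y c) * real (degree F) / real N =
    real_of_int (order_sum F z c) * real (degree F) / real N"
    using char_S_eq_order_sum assms by metis
  then show ?thesis using N_pos rooted_degree_pos[OF assms(1)] by simp
qed

text \<open>For a root \<open>y'\<close> of \<open>F\<close> nearest to \<open>z\<close>, the order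
  of \<open>x - z\<close> is \<open>min(c, ord(x - y'))\<close> for every root \<open>x\<close> of
  \<open>F\<close>: none agrees with \<open>z\<close> beyond \<open>c\<close>, and one that leaves
  \<open>y'\<close> earlier leaves \<open>z\<close> at the same exponent.\<close>

lemma sum_subdegree_diff_root:
  assumes F: "rooted F" and G: "rooted G" and y: "y \<in> roots F" and z: "z \<in> roots G"
    and con: "contact F G = ereal (lv c)"
  shows "(\<Sum>x\<in>roots F. fls_subdegree (x - z)) = order_sum F y c"
proof -
  have "near c G F" using con contact_sym[of G F] by simp
  then obtain y' where y': "y' \<in> roots F" "agree c z y'"
    by (rule contact_ge_root[OF G F z])
  have no: "\<not> agree (c + 1) x z" if "x \<in> roots F" for x
    using con contact_eq_iff[OF F G, of c] contact_ge_iff[OF F G, of "c + 1"] that z by blast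
  have "fls_subdegree (x - z) = (if agree c x y' then c else fls_subdegree (x - y'))"
    if x: "x \<in> roots F" for x
  proof -
    have "x \<noteq> z" using no[OF x] by auto
    have char: "fls_subdegree (x - z) = d" if "agree d x z" "\<not> agree (d + 1) x z" for d
      using that \<open>x \<noteq> z\<close> by (simp add: agree_iff_subdegree)
    show ?thesis
    proof (cases "agree c x y'")
      case True
      then have "agree c x z" using y'(2) agree_sym agree_trans by blast
      with True char no[OF x] show ?thesis by simp
    next
      case False
      then have "x \<noteq> y'" by auto
      define d where "d = fls_subdegree (x - y')"
      have d: "agree d x y'" "\<not> agree (d + 1) x y'" "d < c"
        using False \<open>x \<noteq> y'\<close> by (simp_all add: agree_iff_subdegree d_def)
      have "agree d z y'" "agree (d + 1) z y'"
        using agree_mono[OF y'(2)] d(3) by auto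
      then have "agree d x z" "\<not> agree (d + 1) x z"
        using d agree_sym agree_trans by blast+
      with char False show ?thesis by (simp add: d_def)
    qed
  qed
  then have "(\<Sum>x\<in>roots F. fls_subdegree (x - z)) = order_sum F y' c"
    unfolding order_sum_def by (intro sum.cong) auto
  then show ?thesis using order_sum_independent[OF F y y'(1)] by simp
qed

text \<open>Conjugate roots of \<open>F\<close> give the same order of \<open>G\<close>, so the
  double sum is \<open>degree F\<close> times one order; summed the other way, each root of
  \<open>G\<close> contributes \<open>order_sum F y c\<close>.\<close>

lemma subdegree_poly_root:
  assumes F: "rooted F" and G: "rooted G" and y: "y \<in> roots F"
    and con: "contact F G = ereal (lv c)"
  shows "poly (subst_power N G) y \<noteq> 0"
    and "int (degree F) * fls_subdegree (poly (subst_power N G) y) = int (degree G) * order_sum F y c"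
proof -
  have "F \<noteq> G" using con contact_self[OF F] by auto
  then have nz: "poly (subst_power N G) x \<noteq> 0" if "x \<in> roots F" for x
    using rooted_eq_of_common_root[OF F G that] by (auto simp: puiseux_roots_def)
  then show "poly (subst_power N G) y \<noteq> 0" using y .
  obtain z where z: "z \<in> roots G" using G by (auto simp: rooted_def)
  have val: "fls_subdegree (poly (subst_power N G) x) = (\<Sum>z\<in>roots G. fls_subdegree (x - z))"
    if x: "x \<in> roots F" for x
  proof -
    have eq: "poly (subst_power N G) x = (\<Prod>z\<in>roots G. x - z)"
      by (subst rooted_orbit(5)[OF G z]) (simp add: poly_prod)
    have "x - z \<noteq> 0" if "z \<in> roots G" for z
      using nz[OF x] that by (auto simp: puiseux_roots_def)
    then show ?thesis unfolding eq by (intro fls_subdegree_prod)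
  qed
  have const: "fls_subdegree (poly (subst_power N G) x) = fls_subdegree (poly (subst_power N G) y)"
    if x: "x \<in> roots F" for x
  proof -
    obtain k where "x = rot (w ^ k) y" using rooted_conjugate[OF F y x] .
    moreover have "(w ^ k) ^ N = 1" using w_power[of "k * N"] by (simp add: power_mult)
    ultimately show ?thesis
      using N_pos by (simp add: poly_subst_power_rot fls_subdegree_rot)
  qed
  have "int (degree F) * fls_subdegree (poly (subst_power N G) y) =
    (\<Sum>x\<in>roots F. fls_subdegree (poly (subst_power N G) x))"
    by (simp add: const rooted_card[OF F])
  also have "\<dots> = (\<Sum>x\<in>roots F. \<Sum>z\<in>roots G. fls_subdegree (x - z))"
    by (simp add: val)
  also have "\<dots> = (\<Sum>z\<in>roots G. \<Sum>x\<in>roots F. fls_subdegree (x - z))"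
    by (rule sum.swap)
  also have "\<dots> = (\<Sum>z\<in>roots G. order_sum F y c)"
    by (intro sum.cong) (simp_all add: sum_subdegree_diff_root[OF F G y _ con])
  finally show "int (degree F) * fls_subdegree (poly (subst_power N G) y) = int (degree G) * order_sum F y c"
    by (simp add: rooted_card[OF G])
qed

text \<open>All factors have the same contact with \<open>F\<close>, so each contributes its degree
  times one common value, and only the total degree of the product enters.\<close>

lemma intersection_prod:
  assumes F: "rooted F" and S: "finite S" "\<And>G. G \<in> S \<Longrightarrow> rooted G"
    and con: "\<And>G. G \<in> S \<Longrightarrow> contact F G = ereal (lv c)"
  shows "intersection F (\<Prod>G\<in>S. G ^ m G) =
    ereal (char_S F (lv c) * (real (degree (\<Prod>G\<in>S. G ^ m G)) / real (degree F)))"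
proof -
  define Q where "Q = (\<Prod>G\<in>S. G ^ m G)"
  define n where "n = degree F"
  define e where "e = N div n"
  have N: "N = n * e" and e: "e > 0" and n: "n > 0"
    using rooted_unramify[OF F] rooted_ram_pos[OF F] rooted_degree_pos[OF F] by (simp_all add: n_def e_def)
  define y where "y = fls_compose_power (newton_root F) e"
  have y: "y \<in> roots F" using rooted_newton_root[OF F] by (simp add: y_def e_def n_def)
  have "poly (subst_power N Q) y = fls_compose_power (poly (subst_power n Q) (newton_root F)) e"
    using n e unfolding y_def N
    by (subst subst_power_subst_power[symmetric]) (simp_all add: poly_subst_power)
  then have ord: "puiseux_ord n (poly (subst_power n Q) (newton_root F)) = puiseux_ord N (poly (subst_power N Q) y)"
    using n e by (simp add: N puiseux_ord_compose_power)
  have eq: "poly (subst_power N Q) y = (\<Prod>G\<in>S. poly (subst_power N G) y ^ m G)"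
    by (simp add: Q_def subst_power_prod subst_power_power poly_prod N_pos)
  have nz: "poly (subst_power N G) y \<noteq> 0" if "G \<in> S" for G
    using subdegree_poly_root(1)[OF F S(2) y con] that by blast
  have "poly (subst_power N Q) y \<noteq> 0" using S(1) nz by (simp add: eq)
  have "fls_subdegree (poly (subst_power N Q) y) = (\<Sum>G\<in>S. int (m G) * fls_subdegree (poly (subst_power N G) y))"
    unfolding eq using nz by (subst fls_subdegree_prod) (simp_all add: fls_subdegree_pow)
  then have "int n * fls_subdegree (poly (subst_power N Q) y) =
    (\<Sum>G\<in>S. int (m G) * (int n * fls_subdegree (poly (subst_power N G) y)))"
    by (simp add: sum_distrib_left mult_ac)
  also have "\<dots> = (\<Sum>G\<in>S. int (m G * degree G) * order_sum F y c)"
    using subdegree_poly_root(2)[OF F S(2) y con] by (intro sum.cong) (simp_all add: n_def)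
  also have "\<dots> = int (degree Q) * order_sum F y c"
  proof -
    have "\<And>G. G \<in> S \<Longrightarrow> G \<noteq> 0" using S(2) unfolding rooted_def by fastforce
    then have "degree Q = (\<Sum>G\<in>S. m G * degree G)"
      unfolding Q_def by (subst degree_prod_sum_eq) (auto simp: degree_power_eq)
    then show ?thesis by (simp add: sum_distrib_right)
  qed
  finally have key: "real n * real_of_int (fls_subdegree (poly (subst_power N Q) y)) =
    real (degree Q) * real_of_int (order_sum F y c)"
    by (metis of_int_mult of_int_of_nat_eq)
  have "intersection F Q = ereal (real n * real_of_int (fls_subdegree (poly (subst_power N Q) y)) / real N)"
    using \<open>poly (subst_power N Q) y \<noteq> 0\<close>
    unfolding intersection_def n_def[symmetric] ord by (simp add: puiseux_ord_def)
  also have "\<dots> = ereal (char_S F (lv c) * (real (degree Q) / real n))"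
    unfolding key char_S_eq_order_sum[OF F y] n_def[symmetric] using n by simp
  finally show ?thesis by (simp add: Q_def n_def)
qed

end

context reduced_polynomial
begin

text \<open>Justifies the \<open>THE\<close> in \<open>contact_point\<close>: members of
  \<open>P\<close> are closer to each other than to \<open>F\<close>, so they all have the same
  contact with \<open>F\<close>.\<close>

lemma contact_point_cluster:
  assumes P: "is_cluster c P" and F: "F \<in> components f - P" and F1: "F1 \<in> P"
  shows "contact_point F P = contact F F1"
  unfolding contact_point_def
proof (rule the_equality)
  have "contact F G = contact F F1" if G: "G \<in> P" for G
  proof (rule contact_outside)
    show "\<not> near c F F1" "near c F1 G"
      using P F F1 G by (auto simp: is_cluster_def contact_sym[of F])
  qed (use P F F1 G rooted_f in \<open>auto simp: is_cluster_def\<close>)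
  then show "\<forall>G\<in>P. contact F G = contact F F1" by blast
  then show "v = contact F F1" if "\<forall>G\<in>P. contact F G = v" for v
    using that F1 by auto
qed

lemma contact_Q_part_outside:
  assumes P: "is_cluster c P" and F: "F \<in> components f - P"
    and G: "G \<in> components (Q_part (pderiv f) (lv c, P))"
  shows "contact F G = contact_point F P"
proof -
  obtain F1 where F1: "F1 \<in> P" using P by (auto simp: is_cluster_def)
  have ne: "components f \<noteq> {}" using F by blast
  have G': "G \<in> components (pderiv f)" "contact F1 G = ereal (lv c)"
    using components_Q_part[OF G df_nonzero[OF ne]] F1 by auto
  have "contact F G = contact F F1"
  proof (rule contact_outside)
    show "\<not> near c F F1"
      using P F F1 by (auto simp: is_cluster_def contact_sym[of F])
    show "near c F1 G" using G' by simp
  qed (use P F F1 rooted_f rooted_df[OF ne G'(1)] in \<open>auto simp: is_cluster_def\<close>)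
  then show ?thesis using contact_point_cluster[OF P F F1] by simp
qed

lemma contact_point_less:
  assumes P: "is_cluster c P" and F: "F \<in> components f - P"
  obtains d where "contact_point F P = ereal (lv d)" "d < c"
proof -
  obtain F1 where F1: "F1 \<in> P" using P by (auto simp: is_cluster_def)
  have "F \<noteq> F1" "F1 \<in> components f" using F F1 P by (auto simp: is_cluster_def)
  then obtain d where d: "contact F F1 = ereal (lv d)"
    using contact_real rooted_f F by (metis DiffD1)
  moreover have "\<not> near c F F1"
    using P F F1 by (auto simp: is_cluster_def contact_sym[of F])
  ultimately have "d < c" by (simp only: level_le_iff not_le)
  with contact_point_cluster[OF P F F1] d show ?thesis by (intro that[of d]) simp_all
qed

lemma intersection_Q_part:
  assumes P: "is_cluster c P" and F: "F \<in> components f"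
  defines "Q \<equiv> Q_part (pderiv f) (lv c, P)"
  shows "intersection F Q =
    ereal (char_S F (if F \<in> P then lv c else real_of_ereal (contact_point F P))
      * (real (degree Q) / real (degree F)))"
proof -
  have ne: "components f \<noteq> {}" using F by blast
  define sel where "sel = {G \<in> components (pderiv f). \<forall>F\<in>P. contact F G = ereal (lv c)}"
  have Q: "Q = (\<Prod>G\<in>sel. G ^ multiplicity G (pderiv f))"
    by (simp add: Q_def Q_part_def sel_def)
  have sel: "finite sel" "\<And>G. G \<in> sel \<Longrightarrow> rooted G"
    using finite_components[OF df_nonzero[OF ne]] rooted_df[OF ne] by (auto simp: sel_def)
  show ?thesis
  proof (cases "F \<in> P")
    case True
    then have "\<And>G. G \<in> sel \<Longrightarrow> contact F G = ereal (lv c)" by (simp add: sel_def)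
    from intersection_prod[OF rooted_f[OF F] sel this, of "\<lambda>G. multiplicity G (pderiv f)"] True
    show ?thesis by (simp add: Q)
  next
    case False
    then have F': "F \<in> components f - P" using F by blast
    obtain d where d: "contact_point F P = ereal (lv d)"
      using contact_point_less[OF P F'] by blast
    obtain F1 where F1: "F1 \<in> P" using P by (auto simp: is_cluster_def)
    have "contact F G = ereal (lv d)" if G: "G \<in> sel" for G
      unfolding d[symmetric] contact_point_cluster[OF P F' F1]
    proof (rule contact_outside)
      show "\<not> near c F F1"
        using P F' F1 by (auto simp: is_cluster_def contact_sym[of F])
      show "near c F1 G" using G F1 by (simp add: sel_def)
    qed (use P F F1 rooted_f sel(2)[OF G] in \<open>auto simp: is_cluster_def\<close>)
    from intersection_prod[OF rooted_f[OF F] sel this, of "\<lambda>G. multiplicity G (pderiv f)"] False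
    show ?thesis by (simp add: Q d)
  qed
qed

end

section \<open>Characteristic exponents as jumps of the number of balls\<close>

lemma nat_eq_of_dvd_iff:
  fixes a b :: nat
  assumes "\<And>k. a dvd k \<longleftrightarrow> b dvd k"
  shows "a = b"
  using assms[of a] assms[of b] by (simp add: dvd_antisym)

context root_of_unity
begin

text \<open>The index \<theta> of a single component. It exists because \<open>char_exponent\<close>
  is infinite beyond \<open>char_h F\<close>.\<close>

definition char_index :: "'a fls poly \<Rightarrow> int \<Rightarrow> nat" where
  "char_index F c = (LEAST k. 1 \<le> k \<and> ereal (lv c) \<le> char_exponent F k)"

lemma char_index:
  assumes F: "rooted F"
  shows "1 \<le> char_index F c" "ereal (lv c) \<le> char_exponent F (char_index F c)"
    "char_index F c \<le> Suc (char_h F)"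
    "\<And>j. 1 \<le> j \<Longrightarrow> j < char_index F c \<Longrightarrow> char_exponent F j < ereal (lv c)"
    "level_gcd F c = int (char_d F (char_index F c))"
proof -
  have ex: "1 \<le> Suc (char_h F) \<and> ereal (lv c) \<le> char_exponent F (Suc (char_h F))"
    by (simp add: char_exponent_def)
  show ge: "1 \<le> char_index F c" and le: "ereal (lv c) \<le> char_exponent F (char_index F c)"
    unfolding char_index_def using LeastI[of "\<lambda>k. 1 \<le> k \<and> ereal (lv c) \<le> char_exponent F k", OF ex]
    by blast+
  show "char_index F c \<le> Suc (char_h F)"
    unfolding char_index_def using ex by (rule Least_le)
  show less: "\<And>j. 1 \<le> j \<Longrightarrow> j < char_index F c \<Longrightarrow> char_exponent F j < ereal (lv c)"
    unfolding char_index_def using not_less_Least not_le by blast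
  show "level_gcd F c = int (char_d F (char_index F c))"
  proof (rule level_gcd_eq[OF F ge _ le])
    show "char_index F c = 1 \<or> char_exponent F (char_index F c - 1) < ereal (lv c)"
      using less[of "char_index F c - 1"] ge by (cases "char_index F c = 1") auto
  qed
qed

text \<open>Raising \<open>c\<close> by one admits the exponent \<open>c\<close> only, so the gcd
  changes only if this is the characteristic exponent of index \<theta>, and then it becomes
  \<open>d_{\<theta>+1}\<close>.\<close>

lemma level_gcd_Suc:
  assumes F: "rooted F"
  shows "char_exponent F (char_index F c) = ereal (lv c) \<Longrightarrow>
      level_gcd F (c + 1) = int (char_d F (Suc (char_index F c)))"
    and "char_exponent F (char_index F c) \<noteq> ereal (lv c) \<Longrightarrow>
      level_gcd F (c + 1) = level_gcd F c"
proof -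
  interpret characteristic F using F by (rule rooted_characteristic)
  define t where "t = char_index F c"
  define e where "e = N div degree F"
  have e: "e > 0" using rooted_ram_pos[OF F] by (simp add: e_def)
  note t = char_index[OF F, where c = c, folded t_def]
  have lt: "ereal (lv c) < ereal (lv (c + 1))"
    using level_le_iff[of "c + 1" c] by (simp only: not_le[symmetric])
  show "level_gcd F (c + 1) = int (char_d F (Suc (char_index F c)))"
    if eq: "char_exponent F (char_index F c) = ereal (lv c)"
    unfolding t_def[symmetric]
  proof (rule level_gcd_eq[OF F])
    have th: "t \<le> h" "char_m F t * int e \<le> c" and tc: "c \<le> char_m F t * int e"
      using eq char_exponent_le_iff[OF F, of t c] char_exponent_ge_iff[OF F, of c t]
      by (simp_all add: t_def e_def)
    show "ereal (lv (c + 1)) \<le> char_exponent F (Suc t)"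
    proof (cases "Suc t \<le> h")
      case True
      then have "char_m F t < char_m F (Suc t)" using t(1) by (intro char_m_less) auto
      then have "char_m F t * int e < char_m F (Suc t) * int e" using e by simp
      then show ?thesis using tc by (simp only: char_exponent_ge_iff[OF F] e_def) simp
    qed (simp add: char_exponent_def)
    show "Suc t = 1 \<or> char_exponent F (Suc t - 1) < ereal (lv (c + 1))"
      using eq lt by (simp add: t_def)
  qed simp
  show "level_gcd F (c + 1) = level_gcd F c"
    if ne: "char_exponent F (char_index F c) \<noteq> ereal (lv c)"
    unfolding t(5)
  proof (rule level_gcd_eq[OF F t(1)])
    have "\<not> char_exponent F t \<le> ereal (lv c)"
      using ne t(2) by (auto simp: t_def)
    then have "h < t \<or> c < char_m F t * int e"
      by (auto simp: char_exponent_le_iff[OF F] e_def)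
    then show "ereal (lv (c + 1)) \<le> char_exponent F t"
      by (auto simp only: char_exponent_ge_iff[OF F] e_def)
    show "t = 1 \<or> char_exponent F (t - 1) < ereal (lv (c + 1))"
    proof (cases "t = 1")
      case False
      then have "char_exponent F (t - 1) < ereal (lv c)" using t(1) by (intro t(4)) auto
      then show ?thesis using lt order.strict_trans by blast
    qed simp
  qed
qed

text \<open>At a characteristic exponent \<open>d_k\<close> drops strictly, so the number of balls
  grows; elsewhere the gcd stays the same.\<close>

lemma period_jump_iff:
  assumes F: "rooted F"
  shows "period F (c + 1) \<noteq> period F c \<longleftrightarrow>
    char_exponent F (char_index F c) = ereal (lv c)"
proof
  assume "period F (c + 1) \<noteq> period F c"
  then have "level_gcd F (c + 1) \<noteq> level_gcd F c" unfolding period_def by (rule contrapos_nn) simp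
  then show "char_exponent F (char_index F c) = ereal (lv c)"
    using level_gcd_Suc(2)[OF F, of c] by blast
next
  assume eq: "char_exponent F (char_index F c) = ereal (lv c)"
  interpret characteristic F using F by (rule rooted_characteristic)
  have "char_index F c \<le> h" using eq by (auto simp: char_exponent_def split: if_splits)
  then have "char_d F (Suc (char_index F c)) < char_d F (char_index F c)"
    using char_index(1)[OF F, of c] by (intro char_d_Suc_less char_d_gt_1) auto
  then have "level_gcd F (c + 1) < level_gcd F c"
    using level_gcd_Suc(1)[OF F eq] char_index(5)[OF F, of c] by simp
  moreover have "level_gcd F (c + 1) * int (period F (c + 1)) = level_gcd F c * int (period F c)"
    using level_gcd(3)[OF F] by metis
  ultimately show "period F (c + 1) \<noteq> period F c"
    using level_gcd(4)[OF F, of c] by auto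
qed

text \<open>The jumps below \<open>c\<close> are the rescaled characteristic exponents below
  \<open>c\<close>, and \<theta> - 1 counts them. So \<theta> is expressed through
  \<open>period\<close> alone, which can be compared between components.\<close>

lemma char_index_eq_card:
  assumes F: "rooted F"
  shows "Suc (card {b. b < c \<and> period F (b + 1) \<noteq> period F b}) = char_index F c"
proof -
  interpret characteristic F using F by (rule rooted_characteristic)
  define t where "t = char_index F c"
  define e where "e = N div degree F"
  have e: "e > 0" using rooted_ram_pos[OF F] by (simp add: e_def)
  note t = char_index[OF F, where c = c, folded t_def]
  have "{b. b < c \<and> period F (b + 1) \<noteq> period F b} = (\<lambda>k. char_m F k * int e) ` {1..<t}"
  proof (intro set_eqI iffI)
    fix b assume "b \<in> {b. b < c \<and> period F (b + 1) \<noteq> period F b}"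
    then have b: "b < c" "char_exponent F (char_index F b) = ereal (lv b)"
      by (simp_all add: period_jump_iff[OF F])
    then have eq: "char_m F (char_index F b) * int e = b"
      using char_exponent_le_iff[OF F, of "char_index F b" b] char_exponent_ge_iff[OF F, of b "char_index F b"]
      by (auto simp: e_def)
    have "char_exponent F (char_index F b) < ereal (lv c)"
      unfolding b(2) using b(1) level_le_iff[of c b] by (simp only: not_le[symmetric]) simp
    then have "\<not> t \<le> char_index F b"
      using t(1,2) char_exponent_mono[of t "char_index F b"] by (meson leD order_trans)
    then show "b \<in> (\<lambda>k. char_m F k * int e) ` {1..<t}"
      using eq char_index(1)[OF F, of b] by (intro image_eqI[of _ _ "char_index F b"]) auto
  next
    fix b assume "b \<in> (\<lambda>k. char_m F k * int e) ` {1..<t}"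
    then obtain k where k: "1 \<le> k" "k < t" "b = char_m F k * int e" by auto
    have "k \<le> h" using k t(3) by simp
    have eq: "char_exponent F k = ereal (lv b)"
      using char_exponent_le_iff[OF F, of k b] char_exponent_ge_iff[OF F, of b k] k(3) \<open>k \<le> h\<close>
      by (simp add: e_def)
    have "ereal (lv b) < ereal (lv c)" using t(4)[OF k(1,2)] eq by simp
    then have "b < c" using level_le_iff[of c b] by (simp only: not_le[symmetric]) simp
    moreover have "char_index F b = k"
      unfolding char_index_def
    proof (rule Least_equality)
      fix j assume j: "1 \<le> j \<and> ereal (lv b) \<le> char_exponent F j"
      show "k \<le> j"
      proof (rule ccontr)
        assume "\<not> k \<le> j"
        then have "char_exponent F j < char_exponent F k"
          using j \<open>k \<le> h\<close> by (intro char_exponent_less) auto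
        with eq have "char_exponent F j < ereal (lv b)" by simp
        with j show False using leD by blast
      qed
    qed (use k eq in simp)
    ultimately show "b \<in> {b. b < c \<and> period F (b + 1) \<noteq> period F b}"
      using eq by (simp add: period_jump_iff[OF F])
  qed
  moreover have "inj_on (\<lambda>k. char_m F k * int e) {1..<t}"
  proof (rule linorder_inj_onI)
    fix i j assume "i < j" "i \<in> {1..<t}" "j \<in> {1..<t}"
    then have "char_m F i < char_m F j" using t(3) by (intro char_m_less) auto
    then show "char_m F i * int e \<noteq> char_m F j * int e" using e by simp
  qed auto
  ultimately show ?thesis using t(1) by (simp add: card_image t_def)
qed

text \<open>Close roots stay close under a common rotation, so one returns to its ball exactly when
  the other does.\<close>

lemma period_eq:
  assumes F: "rooted F" and G: "rooted G" and con: "near c F G" and "b \<le> c"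
  shows "period F b = period G b"
proof -
  obtain y z where y: "y \<in> roots F" and z: "z \<in> roots G" and yz: "agree c y z"
    using con by (auto simp: contact_ge_iff F G)
  have yz': "agree b y z" using yz \<open>b \<le> c\<close> by (rule agree_mono)
  have "period F b dvd k \<longleftrightarrow> period G b dvd k" for k
  proof -
    have "agree b (rot (w ^ k) y) (rot (w ^ k) z)" using yz' by (simp add: agree_rot)
    then have "agree b (rot (w ^ k) y) y \<longleftrightarrow> agree b (rot (w ^ k) z) z"
      using yz' agree_sym agree_trans by blast
    then show ?thesis by (simp only: agree_iff_period[OF F y] agree_iff_period[OF G z])
  qed
  then show ?thesis by (rule nat_eq_of_dvd_iff)
qed

lemma char_index_eq:
  assumes F: "rooted F" and G: "rooted G" and con: "near c F G"
  shows "char_index F c = char_index G c"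
proof -
  have "{b. b < c \<and> period F (b + 1) \<noteq> period F b} = {b. b < c \<and> period G (b + 1) \<noteq> period G b}"
    using period_eq[OF F G con] by auto
  then show ?thesis using char_index_eq_card[OF F, of c] char_index_eq_card[OF G, of c] by simp
qed

text \<open>Passing from \<open>c\<close> to \<open>c + 1\<close> adds only the condition imposed by
  the coefficient at exponent \<open>c\<close>.\<close>

lemma period_Suc_dvd_iff:
  assumes F: "rooted F" and y: "y \<in> roots F"
  shows "period F (c + 1) dvd k \<longleftrightarrow> period F c dvd k \<and> (y $$ c \<noteq> 0 \<longrightarrow> int N dvd int k * c)"
proof -
  have split: "(\<forall>i<c + 1. Q i) \<longleftrightarrow> (\<forall>i<c. Q i) \<and> Q c" for Q :: "int \<Rightarrow> bool"
    by (auto simp: zless_add1_eq le_less)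
  then show ?thesis
    using split[of "\<lambda>i. y $$ i \<noteq> 0 \<longrightarrow> int N dvd int k * i"]
    by (simp only: agree_iff_period[OF F y, symmetric] agree_rot_w)
qed

lemma nth_nonzero_of_jump:
  assumes F: "rooted F" and y: "y \<in> roots F" and jump: "period F (c + 1) \<noteq> period F c"
  shows "y $$ c \<noteq> 0"
proof
  assume "y $$ c = 0"
  then have "period F (c + 1) dvd k \<longleftrightarrow> period F c dvd k" for k
    using period_Suc_dvd_iff[OF F y, of c k] by simp
  then show False using jump nat_eq_of_dvd_iff by blast
qed

text \<open>At a jump both roots have a nonzero coefficient at exponent \<open>c\<close>, so the
  added condition \<open>N dvd k * c\<close> is the same for both.\<close>

lemma period_Suc_eq:
  assumes F: "rooted F" and G: "rooted G" and con: "near c F G"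
    and jump: "period F (c + 1) \<noteq> period F c" "period G (c + 1) \<noteq> period G c"
  shows "period F (c + 1) = period G (c + 1)"
proof -
  obtain y z where y: "y \<in> roots F" and z: "z \<in> roots G"
    using F G by (auto simp: rooted_def)
  have "period F (c + 1) dvd k \<longleftrightarrow> period G (c + 1) dvd k" for k
    using period_Suc_dvd_iff[OF F y, of c k] period_Suc_dvd_iff[OF G z, of c k]
      nth_nonzero_of_jump[OF F y jump(1)] nth_nonzero_of_jump[OF G z jump(2)] period_eq[OF F G con order_refl]
    by simp
  then show ?thesis by (rule nat_eq_of_dvd_iff)
qed

text \<open>The jump of \<open>H\<close> shows that \<open>N\<close> does not divide
  \<open>period * c\<close>, where the period at \<open>c\<close> is common to all three. A
  component without a jump therefore has coefficient 0 at exponent \<open>c\<close>, and roots of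
  \<open>F\<close> and \<open>G\<close> that agree below \<open>c\<close> agree below
  \<open>c + 1\<close>.\<close>

lemma contact_of_no_jump:
  assumes F: "rooted F" and G: "rooted G" and H: "rooted H"
    and con: "near c F G" "near c F H"
    and "period H (c + 1) \<noteq> period H c" "period F (c + 1) = period F c" "period G (c + 1) = period G c"
  shows "near (c + 1) F G"
proof -
  obtain x where x: "x \<in> roots H" using H by (auto simp: rooted_def)
  have "\<not> int N dvd int (period H c) * c"
  proof
    assume "int N dvd int (period H c) * c"
    then have "period H (c + 1) dvd period H c"
      using period_Suc_dvd_iff[OF H x, of c "period H c"] by simp
    moreover have "period H c dvd period H (c + 1)"
      using period_Suc_dvd_iff[OF H x, of c "period H (c + 1)"] by simp
    ultimately show False using assms(6) by (simp add: dvd_antisym)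
  qed
  then have nd: "\<not> int N dvd int (period F c) * c" "\<not> int N dvd int (period G c) * c"
    using period_eq[OF F H con(2) order_refl] period_eq[OF F G con(1) order_refl] by simp_all
  obtain y z where y: "y \<in> roots F" and z: "z \<in> roots G" and yz: "agree c y z"
    using con(1) by (auto simp: contact_ge_iff F G)
  have "y $$ c = 0" using period_Suc_dvd_iff[OF F y, of c "period F c"] nd(1) assms(7) by auto
  moreover have "z $$ c = 0" using period_Suc_dvd_iff[OF G z, of c "period G c"] nd(2) assms(8) by auto
  ultimately have "agree (c + 1) y z" using yz by (auto simp: agree_def le_less)
  then show ?thesis unfolding contact_ge_iff[OF F G] using y z by blast
qed

end

subsection \<open>The tree\<close>

context root_of_unity
begin

lemma level_less_iff: "ereal (lv a) < ereal (lv b) \<longleftrightarrow> a < b"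
  using level_le_iff[of b a] by (simp only: not_le[symmetric])

lemma char_exponent_real:
  assumes F: "rooted F" and "k \<le> char_h F"
  shows "char_exponent F k = ereal (of_int (char_m F k * int (N div degree F)) / of_nat N)"
  using char_exponent_le_iff[OF F, of k "char_m F k * int (N div degree F)"]
    char_exponent_ge_iff[OF F, of "char_m F k * int (N div degree F)" k] assms(2)
  by (intro antisym) blast+

lemma period_eq_quotient:
  assumes F: "rooted F" and "level_gcd F c = int d"
  shows "real (period F c) = real (degree F) / real d"
proof -
  have "int (degree F) = int d * int (period F c)" using level_gcd(3)[OF F, of c] assms(2) by simp
  then have "degree F = d * period F c" by (metis of_nat_eq_iff of_nat_mult)
  moreover have "d \<noteq> 0" using level_gcd(1)[OF F, of c] assms(2) by simp
  ultimately show ?thesis by simp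
qed

lemma balls_Un: "balls c (X \<union> Y) = balls c X \<union> balls c Y"
  by (auto simp: balls_def)

lemma balls_UN: "balls c (\<Union>i\<in>I. X i) = (\<Union>i\<in>I. balls c (X i))"
  by (auto simp: balls_def)

lemma balls_common:
  assumes "b \<in> balls c X" "b \<in> balls c Y"
  obtains x y where "x \<in> X" "y \<in> Y" "agree c x y"
proof -
  obtain x y where "x \<in> X" "y \<in> Y" "b = {z. agree c x z}" "b = {z. agree c y z}"
    using assms by (auto simp: balls_def)
  with that ball_eq_iff[of c x y] show ?thesis by metis
qed

end

context reduced_polynomial
begin

lemma tree_level_real:
  assumes "M \<in> tree_levels f"
  obtains c where "M = lv c"
proof -
  consider F G where "F \<in> components f" "G \<in> components f" "F \<noteq> G" "contact F G = ereal M"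
    | F k where "F \<in> components f" "k \<le> char_h F" "char_exponent F k = ereal M"
    using assms by (auto simp: tree_levels_def)
  then show ?thesis
  proof cases
    case 1
    then obtain c where "contact F G = ereal (lv c)"
      using contact_real rooted_f by metis
    with 1 show ?thesis by (intro that[of c]) simp
  next
    case 2
    with char_exponent_real[OF rooted_f[OF 2(1)] 2(2)]
    show ?thesis by (intro that[of "char_m F k * int (N div degree F)"]) simp
  qed
qed

text \<open>A component of contact at least \<open>M\<close> with a member of
  \<open>level_components\<close> is itself a member, so a class is cut out by contact with one
  element.\<close>

lemma tree_point_iff:
  "(M, P) \<in> tree_points f \<longleftrightarrow> M \<in> tree_levels f \<and>
     (\<exists>F\<in>level_components f M. P = {G \<in> components f. ereal M \<le> contact F G})"
proof -
  have "level_rel f M `` {F} = {G \<in> components f. ereal M \<le> contact F G}" if F: "F \<in> level_components f M" for F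
  proof -
    have FC: "F \<in> components f" using F by (auto simp: level_components_def)
    then have "contact F F = \<infinity>" using rooted_f contact_self by blast
    have "G \<in> level_components f M" if "G \<in> components f" "ereal M \<le> contact F G" for G
    proof (cases "G = F")
      case False
      with that FC show ?thesis
        unfolding level_components_def using contact_sym[of G F] by auto
    qed (use F in simp)
    with F FC \<open>contact F F = \<infinity>\<close> show ?thesis
      unfolding level_rel_def by (auto simp: level_components_def)
  qed
  then show ?thesis
    by (auto simp: tree_points_def quotient_def)
qed

text \<open>Needed for a least level above a given one, where strictly dominating points
  live.\<close>

lemma finite_tree_levels: "finite (tree_levels f)"
proof -
  define V where "V = (\<lambda>(F, G). contact F G) ` (components f \<times> components f) \<union>
    (\<Union>F\<in>components f. char_exponent F ` {1..char_h F})"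
  have "ereal M \<in> V" if M: "M \<in> tree_levels f" for M
  proof -
    consider F G where "F \<in> components f" "G \<in> components f" "contact F G = ereal M"
      | F k where "F \<in> components f" "k \<in> {1..char_h F}" "char_exponent F k = ereal M"
      using M unfolding tree_levels_def by blast
    then show ?thesis
    proof cases
      case 1
      then have "contact F G \<in> (\<lambda>(F, G). contact F G) ` (components f \<times> components f)" by blast
      with 1 show ?thesis by (simp add: V_def)
    next
      case 2
      then have "char_exponent F k \<in> (\<Union>F\<in>components f. char_exponent F ` {1..char_h F})" by blast
      with 2 show ?thesis by (simp add: V_def)
    qed
  qed
  then have "tree_levels f \<subseteq> real_of_ereal ` V"
    by (intro subsetI image_eqI[of _ real_of_ereal "ereal _"]) auto
  moreover have "finite V" using finite_components[OF f_nonzero] by (auto simp: V_def)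
  ultimately show ?thesis using finite_subset by blast
qed

end

section \<open>A point of the tree and the points that strictly dominate it\<close>

locale tree_point = reduced_polynomial N w f
  for N :: nat and w :: "'a :: {alg_closed_field, field_char_0}" and f :: "'a fls poly" +
  fixes c :: int and P :: "'a fls poly set"
  assumes point: "(lv c, P) \<in> tree_points f"
begin

abbreviation level :: real where "level \<equiv> lv c"

abbreviation "SD \<equiv> strict_dominators f (level, P)"

abbreviation "D \<equiv> point_D f (level, P)"

text \<open>The class of \<open>F\<close> at radius \<open>c + 1\<close>, described without
  reference to the next level of the tree.\<close>

definition above :: "'a fls poly \<Rightarrow> 'a fls poly set" where
  "above F = {G \<in> components f. near (c + 1) F G}"

lemma cluster: "is_cluster c P"
proof -
  obtain F where F: "F \<in> level_components f level" and P: "P = {G \<in> components f. ereal level \<le> contact F G}"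
    using point tree_point_iff by blast
  have FC: "F \<in> components f" using F by (auto simp: level_components_def)
  have r: "\<And>G. G \<in> components f \<Longrightarrow> rooted G" using rooted_f by blast
  have "F \<in> P" using FC r contact_self by (simp add: P)
  moreover have "ereal level \<le> contact G H" if "G \<in> P" "H \<in> P" for G H
  proof -
    have G: "G \<in> components f" "ereal level \<le> contact G F" and H: "H \<in> components f" "ereal level \<le> contact F H"
      using that contact_sym[of G F] by (simp_all add: P)
    show ?thesis
      using contact_ultrametric[OF r[OF G(1)] r[OF FC] r[OF H(1)] G(2) H(2)] .
  qed
  moreover have "\<not> ereal level \<le> contact G H" if "G \<in> P" "H \<in> components f - P" for G H
  proof
    assume le: "ereal level \<le> contact G H"
    have G: "G \<in> components f" "ereal level \<le> contact F G" and H: "H \<in> components f"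
      using that by (simp_all add: P)
    have "ereal level \<le> contact F H"
      using contact_ultrametric[OF r[OF FC] r[OF G(1)] r[OF H] G(2) le] .
    with that show False by (simp add: P)
  qed
  moreover have "P \<subseteq> components f" by (auto simp: P)
  ultimately show ?thesis unfolding is_cluster_def by blast
qed

lemma P_nonempty: "P \<noteq> {}" and P_components: "F \<in> P \<Longrightarrow> F \<in> components f"
  and P_rooted: "F \<in> P \<Longrightarrow> rooted F"
  and P_contact: "F \<in> P \<Longrightarrow> G \<in> P \<Longrightarrow> ereal level \<le> contact F G"
  using cluster rooted_f by (auto simp: is_cluster_def)

lemma in_P_of_contact: "F \<in> P \<Longrightarrow> G \<in> components f \<Longrightarrow> ereal level \<le> contact F G \<Longrightarrow> G \<in> P"
  using cluster by (auto simp: is_cluster_def)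

text \<open>Contact at least \<open>M\<close> makes \<open>char_index\<close> constant on
  \<open>P\<close>, so each member alone determines the minimum over the class.\<close>

lemma theta_eq:
  assumes F: "F \<in> P"
  shows "(LEAST k. 1 \<le> k \<and> (\<forall>F\<in>P. ereal level \<le> char_exponent F k)) = char_index F c"
proof (rule Least_equality)
  have "char_index G c = char_index F c" if "G \<in> P" for G
    using char_index_eq[OF P_rooted[OF that] P_rooted[OF F] P_contact[OF that F]] .
  then show "1 \<le> char_index F c \<and> (\<forall>G\<in>P. ereal level \<le> char_exponent G (char_index F c))"
    using char_index(1,2) P_rooted F by metis
next
  fix k assume k: "1 \<le> k \<and> (\<forall>F\<in>P. ereal level \<le> char_exponent F k)"
  then show "char_index F c \<le> k"
    using F unfolding char_index_def by (intro Least_le) auto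
qed

text \<open>No contact lies strictly between \<open>M\<close> and the level \<open>M'\<close> of a
  strictly dominating point, so contact greater than \<open>M\<close> already means at least
  \<open>M'\<close>: the point is a full class at radius \<open>c + 1\<close>.\<close>

lemma SD_class:
  assumes q: "q \<in> SD" and F: "F \<in> snd q"
  shows "snd q = above F" "F \<in> P" "snd q \<subseteq> P" "F \<in> above F" 
proof -
  obtain M' P' where qM: "q = (M', P')" by (cases q)
  have pt: "(M', P') \<in> tree_points f" and "P' \<subseteq> P" "level < M'" and gap: "tree_levels f \<inter> {level<..<M'} = {}"
    using q by (auto simp: strict_dominators_def strictly_dominates_def dominates_def qM)
  then show "F \<in> P" "snd q \<subseteq> P" using F by (auto simp: qM)
  have M': "M' \<in> tree_levels f" using pt tree_point_iff by blast
  obtain d where d: "M' = lv d" using tree_level_real[OF M'] .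
  then have "c < d" using \<open>level < M'\<close> level_less_iff[of c d] by simp
  interpret T: tree_point N w f d P' by unfold_locales (use pt d in simp)
  show "F \<in> above F"
    using P_components[OF \<open>F \<in> P\<close>] contact_self[OF P_rooted[OF \<open>F \<in> P\<close>]] by (simp add: above_def)
  show "snd q = above F"
  proof (intro antisym subsetI)
    fix G assume G: "G \<in> snd q"
    have "ereal M' \<le> contact F G" using T.P_contact F G by (simp add: qM d)
    then have "near (c + 1) F G"
      using level_le_iff[of "c + 1" d] \<open>c < d\<close> by (auto simp only: d intro: order_trans)
    then show "G \<in> above F" using T.P_components G by (simp add: above_def qM)
  next
    fix G assume G: "G \<in> above F"
    then have GC: "G \<in> components f" and con: "near (c + 1) F G"
      by (simp_all add: above_def)
    have "ereal M' \<le> contact F G"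
    proof (cases "F = G")
      case False
      obtain a where a: "contact F G = ereal (lv a)"
        using contact_real[OF P_rooted[OF \<open>F \<in> P\<close>] rooted_f[OF GC] False] .
      then have "c < a" using con by (simp only: level_le_iff)
      then have "level < lv a" using level_less_iff[of c a] by simp
      moreover have "lv a \<in> tree_levels f"
        using a GC P_components[OF \<open>F \<in> P\<close>] False unfolding tree_levels_def by blast
      ultimately have "M' \<le> lv a"
        using gap by (meson disjoint_iff greaterThanLessThan_iff not_le)
      then show ?thesis by (simp add: a)
    qed (use contact_self P_rooted \<open>F \<in> P\<close> in auto)
    then show "G \<in> snd q" using T.in_P_of_contact F GC by (simp add: qM d)
  qed
qed

lemma SD_nonempty: "q \<in> SD \<Longrightarrow> snd q \<noteq> {}"
proof -
  assume q: "q \<in> SD"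
  obtain M' P' where qM: "q = (M', P')" by (cases q)
  have pt: "(M', P') \<in> tree_points f" using q by (auto simp: strict_dominators_def qM)
  obtain d where d: "M' = lv d" using tree_level_real pt tree_point_iff by blast
  interpret T: tree_point N w f d P' by unfold_locales (use pt d in simp)
  show ?thesis using T.P_nonempty by (simp add: qM)
qed

text \<open>All strictly dominating points have the same level, since neither of two levels can lie
  in the gap below the other.\<close>

lemma inj_SD: "inj_on snd SD"
proof (rule inj_onI)
  fix q q' assume q: "q \<in> SD" "q' \<in> SD" and eq: "snd q = snd q'"
  have lev: "fst q \<in> tree_levels f" "level < fst q" "tree_levels f \<inter> {level<..<fst q} = {}" if "q \<in> SD" for q
    using that
    by (auto simp: strict_dominators_def strictly_dominates_def tree_points_def)
  have "fst q = fst q'"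
    using lev[OF q(1)] lev[OF q(2)] by (meson disjoint_iff greaterThanLessThan_iff linorder_neqE)
  with eq show "q = q'" by (simp add: prod_eq_iff)
qed

lemma finite_SD: "finite SD"
proof -
  have "snd ` SD \<subseteq> Pow (components f)"
    using SD_class(3) P_components SD_nonempty by blast
  then have "finite (snd ` SD)"
    using finite_components[OF f_nonzero] finite_subset by blast
  then show ?thesis using inj_SD by (rule finite_imageD)
qed

lemma D_subset: "F \<in> D \<Longrightarrow> F \<in> P"
  by (simp add: point_D_def)

lemma finite_D: "finite D"
  using finite_components[OF f_nonzero] P_components D_subset by (metis finite_subset subsetI)

lemma P_decomposition: "P = (\<Union>q\<in>SD. snd q) \<union> D"
  using SD_class(3) SD_nonempty by (auto simp: point_D_def)

text \<open>If \<open>F\<close> were present at a higher level, its class at the least level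
  \<open>m\<close> above \<open>M\<close> would strictly dominate the point and contain
  \<open>F\<close>.\<close>

lemma no_level_above_D:
  assumes F: "F \<in> D" and M': "M' \<in> tree_levels f" "level < M'"
  shows "F \<notin> level_components f M'"
proof
  assume lev: "F \<in> level_components f M'"
  define L where "L = {M'' \<in> tree_levels f. level < M''}"
  have L: "finite L" "L \<noteq> {}" using finite_tree_levels M' by (auto simp: L_def)
  define m where "m = Min L"
  have m: "m \<in> tree_levels f" "level < m" "\<And>M''. M'' \<in> tree_levels f \<Longrightarrow> level < M'' \<Longrightarrow> m \<le> M''"
    using Min_in[OF L] Min_le[OF L(1)] by (auto simp: L_def m_def)
  have "m \<le> M'" using m(3) M' by blast
  then have levm: "F \<in> level_components f m"
    using lev order_trans[of "ereal m" "ereal M'"] unfolding level_components_def by (simp) blast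
  define P' where "P' = {G \<in> components f. ereal m \<le> contact F G}"
  have "(m, P') \<in> tree_points f"
    unfolding tree_point_iff P'_def using m(1) levm by blast
  moreover have "P' \<subseteq> P"
  proof
    fix G assume "G \<in> P'"
    then have G: "G \<in> components f" "ereal m \<le> contact F G" by (simp_all add: P'_def)
    then have "ereal level \<le> contact F G" using m(2) by (meson ereal_less_eq(3) less_imp_le order_trans)
    then show "G \<in> P" using in_P_of_contact[OF D_subset[OF F]] G by blast
  qed
  moreover have "tree_levels f \<inter> {level<..<m} = {}"
    by (auto dest: m(3) leD)
  ultimately have "(m, P') \<in> SD"
    using m(2) by (simp add: strict_dominators_def strictly_dominates_def dominates_def)
  moreover have "F \<in> P'"
    using P_components[OF D_subset[OF F]] contact_self[OF P_rooted[OF D_subset[OF F]]] by (simp add: P'_def)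
  ultimately have "F \<in> (\<Union>q\<in>SD. snd q)" by force
  then show False using F by (simp add: point_D_def)
qed

text \<open>A contact greater than \<open>M\<close> with another component would be a higher level
  at which \<open>F\<close> is present.\<close>

lemma D_above:
  assumes F: "F \<in> D"
  shows "above F = {F}"
proof (intro antisym subsetI)
  have FP: "F \<in> P" using D_subset[OF F] .
  fix G assume G: "G \<in> above F"
  show "G \<in> {F}"
  proof (rule ccontr)
    assume "G \<notin> {F}"
    then have ne: "F \<noteq> G" by auto
    have GC: "G \<in> components f" and con: "near (c + 1) F G"
      using G by (simp_all add: above_def)
    obtain a where a: "contact F G = ereal (lv a)"
      using contact_real[OF P_rooted[OF FP] rooted_f[OF GC] ne] .
    then have "c < a" using con by (simp only: level_le_iff)
    then have "level < lv a" using level_less_iff[of c a] by simp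
    moreover have "lv a \<in> tree_levels f"
      using a GC P_components[OF FP] ne unfolding tree_levels_def by blast
    moreover have "F \<in> level_components f (lv a)"
      using a GC P_components[OF FP] ne unfolding level_components_def by auto
    ultimately show False using no_level_above_D[OF F] by blast
  qed
next
  fix G assume "G \<in> {F}"
  then show "G \<in> above F"
    using P_components[OF D_subset[OF F]] contact_self[OF P_rooted[OF D_subset[OF F]]] by (simp add: above_def)
qed

lemma D_char_exponent:
  assumes F: "F \<in> D" and k: "1 \<le> k" "k \<le> char_h F"
  shows "char_exponent F k \<le> ereal level"
proof (rule ccontr)
  assume "\<not> ?thesis"
  moreover obtain M' where M': "char_exponent F k = ereal M'" using k by (simp add: char_exponent_def)
  ultimately have "level < M'" by simp
  moreover have FC: "F \<in> components f" using P_components[OF D_subset[OF F]] .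
  then have "M' \<in> tree_levels f" using M' k unfolding tree_levels_def by auto
  moreover have "\<exists>j\<in>{1..char_h F}. ereal M' \<le> char_exponent F j"
    using M' k by (intro bexI[of _ k]) simp_all
  then have "F \<in> level_components f M'"
    using FC unfolding level_components_def by blast
  ultimately show False using no_level_above_D[OF F] by blast
qed

text \<open>By contact, every ball met by the class is already met by the roots of one
  member.\<close>

lemma card_balls_class:
  assumes "F \<in> X" "\<And>G. G \<in> X \<Longrightarrow> rooted G" "\<And>G. G \<in> X \<Longrightarrow> near d F G"
  shows "card (balls d (cluster_roots X)) = period F d"
proof -
  have "balls d (cluster_roots X) = balls d (roots F)"
  proof (intro antisym subsetI)
    fix b assume "b \<in> balls d (cluster_roots X)"
    then obtain G z where G: "G \<in> X" "z \<in> roots G" and b: "b = {x. agree d z x}"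
      by (auto simp: balls_def cluster_roots_def)
    have "near d G F" using assms(3)[OF G(1)] by (simp only: contact_sym)
    then obtain y where y: "y \<in> roots F" "agree d z y"
      by (rule contact_ge_root[OF assms(2)[OF G(1)] assms(2)[OF assms(1)] G(2)])
    then have "b = {x. agree d y x}" unfolding b ball_eq_iff by simp
    with y(1) show "b \<in> balls d (roots F)" by (auto simp: balls_def)
  next
    fix b assume "b \<in> balls d (roots F)"
    then show "b \<in> balls d (cluster_roots X)" using assms(1) by (auto simp: balls_def cluster_roots_def)
  qed
  then show ?thesis using card_balls assms(1,2) by simp
qed

text \<open>All characteristic exponents of \<open>F\<close> are at most \<open>M\<close>, so at
  radius \<open>c + 1\<close> the gcd is 1 and the roots lie in different balls.\<close>

lemma D_period:
  assumes F: "F \<in> D"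
  shows "period F (c + 1) = degree F"
proof -
  have rF: "rooted F" using P_rooted[OF D_subset[OF F]] .
  interpret characteristic F using rF by (rule rooted_characteristic)
  have "level_gcd F (c + 1) = int (char_d F (Suc h))"
  proof (rule level_gcd_eq[OF rF])
    show "Suc h = 1 \<or> char_exponent F (Suc h - 1) < ereal (lv (c + 1))"
    proof (cases "h = 0")
      case False
      then have "char_exponent F h \<le> ereal level" using D_char_exponent[OF F, of h] by simp
      also have "\<dots> < ereal (lv (c + 1))" by (simp only: level_less_iff)
      finally show ?thesis by simp
    qed simp
  qed (simp_all add: char_exponent_def)
  then show ?thesis using level_gcd(3)[OF rF, of "c + 1"] char_d_h by simp
qed

lemma card_balls_next:
  assumes rep: "\<And>q. q \<in> SD \<Longrightarrow> rep q \<in> snd q"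
  shows "card (balls (c + 1) (cluster_roots P)) = (\<Sum>q\<in>SD. period (rep q) (c + 1)) + (\<Sum>F\<in>D. degree F)"
proof -
  define bq where "bq = (\<lambda>q :: 'a tree_point. balls (c + 1) (cluster_roots (snd q)))"
  define bF where "bF = (\<lambda>F. balls (c + 1) (roots F))"
  \<comment> \<open>A ball common to two subfamilies forces contact at radius \<open>c + 1\<close>
    between some of their members; the disjointness claims \<open>d1\<close>, \<open>d2\<close>,
    \<open>d3\<close> follow from this.\<close>
  have meet: "\<exists>F\<in>X. \<exists>G\<in>Y. G \<in> above F"
    if b: "b \<in> balls (c + 1) (cluster_roots X)" "b \<in> balls (c + 1) (cluster_roots Y)"
      and XY: "X \<subseteq> P" "Y \<subseteq> P"
    for b X Y
  proof -
    obtain x y where "x \<in> cluster_roots X" "y \<in> cluster_roots Y" and xy: "agree (c + 1) x y"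
      using b by (rule balls_common)
    then obtain F G where FG: "F \<in> X" "G \<in> Y" and x: "x \<in> roots F" and y: "y \<in> roots G"
      by (auto simp: cluster_roots_def)
    then have "F \<in> P" "G \<in> P" using XY by auto
    then have "near (c + 1) F G"
      unfolding contact_ge_iff[OF P_rooted[OF \<open>F \<in> P\<close>] P_rooted[OF \<open>G \<in> P\<close>]] using x y xy by blast
    then have "G \<in> above F" using P_components[OF \<open>G \<in> P\<close>] by (simp add: above_def)
    with FG show ?thesis by blast
  qed
  have bF': "bF F = balls (c + 1) (cluster_roots {F})" for F by (simp add: bF_def cluster_roots_def)
  have "cluster_roots P = (\<Union>q\<in>SD. cluster_roots (snd q)) \<union> (\<Union>F\<in>D. roots F)"
    unfolding cluster_roots_def by (subst P_decomposition) auto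
  then have total: "balls (c + 1) (cluster_roots P) = (\<Union>q\<in>SD. bq q) \<union> (\<Union>F\<in>D. bF F)"
    by (simp add: balls_Un balls_UN bq_def bF_def)
  have fin: "finite (cluster_roots X)" if "X \<subseteq> P" for X
    using that P_components finite_components[OF f_nonzero] finite_rooted P_rooted
    unfolding cluster_roots_def by (intro finite_UN_I) (auto intro: finite_subset)
  have fq: "finite (bq q)" if "q \<in> SD" for q
    using fin[OF SD_class(3)[OF that rep[OF that]]] by (simp add: bq_def balls_def)
  have fF: "finite (bF F)" if "F \<in> D" for F
    using fin[of "{F}"] D_subset[OF that] by (simp add: bF' balls_def)
  have d1: "bq q \<inter> bq q' = {}" if q: "q \<in> SD" "q' \<in> SD" "q \<noteq> q'" for q q'
  proof (rule ccontr)
    assume "bq q \<inter> bq q' \<noteq> {}"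
    then obtain b where "b \<in> bq q" "b \<in> bq q'" by blast
    then obtain F G where FG: "F \<in> snd q" "G \<in> snd q'" "G \<in> above F"
      using meet SD_class(3)[OF q(1) rep[OF q(1)]] SD_class(3)[OF q(2) rep[OF q(2)]] unfolding bq_def by blast
    then have "G \<in> snd q" using SD_class(1)[OF q(1)] by blast
    then have "snd q = snd q'" using SD_class(1)[OF q(1)] SD_class(1)[OF q(2) FG(2)] by blast
    then show False using inj_SD q by (auto dest: inj_onD)
  qed
  have d2: "bF F \<inter> bF G = {}" if FG: "F \<in> D" "G \<in> D" "F \<noteq> G" for F G
  proof (rule ccontr)
    assume "bF F \<inter> bF G \<noteq> {}"
    then have "G \<in> above F" using meet[of _ "{F}" "{G}"] D_subset FG unfolding bF' by blast
    then show False using D_above FG by auto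
  qed
  have d3: "bq q \<inter> bF G = {}" if q: "q \<in> SD" and G: "G \<in> D" for q G
  proof (rule ccontr)
    assume "bq q \<inter> bF G \<noteq> {}"
    then obtain F where F: "F \<in> snd q" "G \<in> above F"
      using meet[of _ "snd q" "{G}"] D_subset[OF G] SD_class(3)[OF q rep[OF q]] unfolding bF' bq_def by blast
    then have "G \<in> snd q" using SD_class(1)[OF q] by blast
    then show False using q G by (auto simp: point_D_def)
  qed
  have "card ((\<Union>q\<in>SD. bq q) \<union> (\<Union>F\<in>D. bF F)) = card (\<Union>q\<in>SD. bq q) + card (\<Union>F\<in>D. bF F)"
    using d3 fq fF finite_SD finite_D by (intro card_Un_disjoint) auto
  also have "card (\<Union>q\<in>SD. bq q) = (\<Sum>q\<in>SD. card (bq q))"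
    using d1 fq finite_SD by (intro card_UN_disjoint) auto
  also have "\<dots> = (\<Sum>q\<in>SD. period (rep q) (c + 1))"
  proof (intro sum.cong refl)
    fix q assume q: "q \<in> SD"
    show "card (bq q) = period (rep q) (c + 1)"
      unfolding bq_def
    proof (rule card_balls_class[OF rep[OF q]])
      show "\<And>G. G \<in> snd q \<Longrightarrow> rooted G" using SD_class(2)[OF q] P_rooted by blast
      show "\<And>G. G \<in> snd q \<Longrightarrow> ereal (lv (c + 1)) \<le> contact (rep q) G"
        using SD_class(1)[OF q rep[OF q]] by (simp add: above_def)
    qed
  qed
  also have "card (\<Union>F\<in>D. bF F) = (\<Sum>F\<in>D. card (bF F))"
    using d2 fF finite_D by (intro card_UN_disjoint) auto
  also have "\<dots> = (\<Sum>F\<in>D. degree F)"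
    using card_balls P_rooted D_subset D_period by (intro sum.cong) (simp_all add: bF_def)
  finally show ?thesis by (simp only: total)
qed

end

section \<open>The degree of the factor of the derivative and the sum over \<open>D\<close>\<close>

context tree_point
begin

lemma level_le_char_exponent:
  "F \<in> P \<Longrightarrow> ereal level \<le> char_exponent F (char_index F c)"
  using char_index(2)[OF P_rooted] .

lemma period_P: "F \<in> P \<Longrightarrow> G \<in> P \<Longrightarrow> period F c = period G c"
  using period_eq[OF P_rooted P_rooted P_contact order_refl] .

lemma period_jump_eq:
  "F \<in> P \<Longrightarrow> G \<in> P \<Longrightarrow> period F (c + 1) \<noteq> period F c \<Longrightarrow> period G (c + 1) \<noteq> period G c \<Longrightarrow>
    period F (c + 1) = period G (c + 1)"
  using period_Suc_eq[OF P_rooted P_rooted P_contact] .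

lemma period_quotient:
  assumes F: "F \<in> P"
  shows "real (period F c) = real (degree F) / real (char_d F (char_index F c))"
    and "period F (c + 1) \<noteq> period F c \<Longrightarrow>
      real (period F (c + 1)) = real (degree F) / real (char_d F (char_index F c + 1))"
proof -
  have rF: "rooted F" using P_rooted[OF F] .
  show "real (period F c) = real (degree F) / real (char_d F (char_index F c))"
    using period_eq_quotient[OF rF char_index(5)[OF rF]] .
  assume "period F (c + 1) \<noteq> period F c"
  then show "real (period F (c + 1)) = real (degree F) / real (char_d F (char_index F c + 1))"
    using period_eq_quotient[OF rF level_gcd_Suc(1)[OF rF]] period_jump_iff[OF rF] by simp
qed

text \<open>A point in \<open>B\<close> meets \<open>n_F/d_\<theta>\<close> small balls, as many as
  \<open>P\<close> meets large ones, so subtracting the large balls gives the factor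
  \<open>b - 1\<close>. A point in \<open>A\<close> jumps at \<open>M\<close> and meets
  \<open>n_F/d_{\<theta>+1}\<close> small balls, a member of \<open>D\<close> meets
  \<open>n_F\<close>.\<close>

lemma degree_Q_formula:
  assumes theta: "\<theta> = (LEAST k. 1 \<le> k \<and> (\<forall>F\<in>P. ereal level \<le> char_exponent F k))"
    and A_eq: "A = {q \<in> SD. \<forall>F\<in>snd q. ereal level = char_exponent F \<theta>}"
    and B_eq: "B = {q \<in> SD. \<forall>F\<in>snd q. ereal level < char_exponent F \<theta>}"
    and F1: "A \<noteq> {} \<Longrightarrow> p1 \<in> A \<and> F1 \<in> snd p1"
    and F2: "if B \<noteq> {} then p2 \<in> B \<and> F2 \<in> snd p2 else F2 \<in> P"
  shows "real (degree (Q_part (pderiv f) (level, P))) =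
       (if A = {} then 0 else real (card A) * (real (degree F1) / real (char_d F1 (\<theta> + 1))))
       + (real (card B) - 1) * (real (degree F2) / real (char_d F2 \<theta>))
       + (\<Sum>F\<in>D. real (degree F))"
proof -
  have th: "\<theta> = char_index F c" if "F \<in> P" for F using theta theta_eq[OF that] by simp
  have jump: "period F (c + 1) \<noteq> period F c \<longleftrightarrow> ereal level = char_exponent F \<theta>" if "F \<in> P" for F
    using period_jump_iff[OF P_rooted[OF that], of c] th[OF that] by auto
  \<comment> \<open>Members of one strictly dominating point have equal periods at \<open>c\<close>
    and at \<open>c + 1\<close>, so they jump together; hence each such point falls into
    \<open>A\<close> or \<open>B\<close>.\<close>
  have AB: "A \<union> B = SD" "A \<inter> B = {}"
  proof -
    show "A \<inter> B = {}" using SD_nonempty by (fastforce simp: A_eq B_eq)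
    have "q \<in> A \<or> q \<in> B" if q: "q \<in> SD" for q
    proof -
      obtain F where F: "F \<in> snd q" using SD_nonempty[OF q] by blast
      have "(ereal level = char_exponent G \<theta>) \<longleftrightarrow> (ereal level = char_exponent F \<theta>)" if G: "G \<in> snd q" for G
      proof -
        have P: "F \<in> P" "G \<in> P" using SD_class(2)[OF q] F G by auto
        have "near (c + 1) F G"
          using SD_class(1)[OF q F] G by (simp add: above_def)
        then have "period F (c + 1) = period G (c + 1)"
          by (rule period_eq[OF P_rooted[OF P(1)] P_rooted[OF P(2)]]) simp
        then show ?thesis using jump[OF P(1)] jump[OF P(2)] period_P[OF P] by simp
      qed
      moreover have "ereal level \<le> char_exponent G \<theta>" if "G \<in> snd q" for G
        using level_le_char_exponent th SD_class(2)[OF q that] by metis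
      ultimately show ?thesis using q by (auto simp: A_eq B_eq order.order_iff_strict)
    qed
    then show "A \<union> B = SD" by (auto simp: A_eq B_eq)
  qed
  define rep where "rep = (\<lambda>q :: 'a tree_point. SOME F. F \<in> snd q)"
  have rep: "rep q \<in> snd q" if "q \<in> SD" for q
    using SD_nonempty[OF that] some_in_eq by (auto simp: rep_def)
  have repP: "rep q \<in> P" if "q \<in> SD" for q using SD_class(2)[OF that rep[OF that]] .
  have F2P: "F2 \<in> P"
  proof (cases "B = {}")
    case False
    then show ?thesis using F2 SD_class(2)[of p2 F2] by (auto simp: B_eq)
  qed (use F2 in simp)
  \<comment> \<open>The number of large balls, equal to the period at \<open>c\<close> of any member
    of \<open>P\<close>.\<close>
  define p0 where "p0 = real (degree F2) / real (char_d F2 \<theta>)"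
  have p0: "real (period F c) = p0" if "F \<in> P" for F
    using period_P[OF that F2P] period_quotient(1)[OF F2P] th[OF F2P] by (simp add: p0_def)
  have sumB: "(\<Sum>q\<in>B. real (period (rep q) (c + 1))) = real (card B) * p0"
  proof -
    have "real (period (rep q) (c + 1)) = p0" if "q \<in> B" for q
    proof -
      have q: "q \<in> SD" and "ereal level < char_exponent (rep q) \<theta>" using that rep by (auto simp: B_eq)
      then have "period (rep q) (c + 1) = period (rep q) c" using jump[OF repP[OF q]] by auto
      then show ?thesis using p0[OF repP[OF q]] by simp
    qed
    then show ?thesis by simp
  qed
  have sumA: "(\<Sum>q\<in>A. real (period (rep q) (c + 1))) =
    (if A = {} then 0 else real (card A) * (real (degree F1) / real (char_d F1 (\<theta> + 1))))"
  proof (cases "A = {}")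
    case False
    then have p1: "p1 \<in> SD" "F1 \<in> snd p1" "ereal level = char_exponent F1 \<theta>" using F1 by (auto simp: A_eq)
    then have F1P: "F1 \<in> P" using SD_class(2) by blast
    have j1: "period F1 (c + 1) \<noteq> period F1 c" using jump[OF F1P] p1(3) by simp
    have "real (period (rep q) (c + 1)) = real (degree F1) / real (char_d F1 (\<theta> + 1))" if "q \<in> A" for q
    proof -
      have q: "q \<in> SD" and "ereal level = char_exponent (rep q) \<theta>" using that rep by (auto simp: A_eq)
      then have "period (rep q) (c + 1) \<noteq> period (rep q) c" using jump[OF repP[OF q]] by simp
      then have "period (rep q) (c + 1) = period F1 (c + 1)"
        using period_jump_eq[OF repP[OF q] F1P _ j1] by blast
      then show ?thesis using period_quotient(2)[OF F1P j1] th[OF F1P] by simp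
    qed
    then show ?thesis using False by simp
  qed simp
  have "card (balls c (cluster_roots P)) = period F2 c"
    using F2P P_rooted P_contact by (intro card_balls_class) auto
  then have "real (degree (Q_part (pderiv f) (level, P))) + p0 = real (card (balls (c + 1) (cluster_roots P)))"
    using degree_Q_part[OF cluster] p0[OF F2P] by (metis of_nat_add)
  also have "\<dots> = (\<Sum>q\<in>SD. real (period (rep q) (c + 1))) + (\<Sum>F\<in>D. real (degree F))"
    using card_balls_next[of rep, OF rep] by simp
  also have "(\<Sum>q\<in>SD. real (period (rep q) (c + 1))) =
    (\<Sum>q\<in>A. real (period (rep q) (c + 1))) + (\<Sum>q\<in>B. real (period (rep q) (c + 1)))"
    using AB finite_SD by (metis finite_Un sum.union_disjoint)
  finally show ?thesis unfolding sumA sumB p0_def[symmetric] by (simp add: algebra_simps)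
qed

text \<open>On \<open>D\<close> all characteristic exponents are at most \<open>M\<close>, while the
  one of index \<theta> is at least \<open>M\<close>: either it is equal to \<open>M\<close> and the
  last one, or it is infinite and \<theta> is \<open>char_h F + 1\<close>.\<close>

lemma D_cases:
  assumes theta: "\<theta> = (LEAST k. 1 \<le> k \<and> (\<forall>F\<in>P. ereal level \<le> char_exponent F k))" and F: "F \<in> D"
  shows "above_last_exponent F level \<and> char_h F = \<theta> - 1 \<and> period F (c + 1) = period F c \<or>
    at_last_exponent F level \<and> char_h F = \<theta> \<and> period F (c + 1) \<noteq> period F c"
proof -
  have FP: "F \<in> P" using D_subset[OF F] .
  have rF: "rooted F" using P_rooted[OF FP] .
  interpret characteristic F using rF by (rule rooted_characteristic)
  have th: "\<theta> = char_index F c" using theta theta_eq[OF FP] by simp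
  note t = char_index[OF rF, where c = c, folded th]
  show ?thesis
  proof (cases "\<theta> \<le> h")
    case True
    then have eq: "char_exponent F \<theta> = ereal level"
      using D_char_exponent[OF F t(1)] t(2) by (intro antisym) auto
    have "h = \<theta>"
    proof (rule ccontr)
      assume "h \<noteq> \<theta>"
      with True have "char_exponent F \<theta> < char_exponent F h" using t(1) by (intro char_exponent_less) auto
      moreover have "char_exponent F h \<le> ereal level" using D_char_exponent[OF F, of h] t(1) True by simp
      ultimately show False using eq by simp
    qed
    then show ?thesis
      using eq t(1) period_jump_iff[OF rF, of c] th by (simp add: at_last_exponent_def)
  next
    case False
    then have h: "\<theta> = Suc h" using t(3) by simp
    have "above_last_exponent F level"
    proof (cases "h = 0")
      case False
      then show ?thesis using t(4)[of h] h by (simp add: above_last_exponent_def)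
    qed (simp add: above_last_exponent_def)
    moreover have "char_exponent F \<theta> \<noteq> ereal level" using h by (simp add: char_exponent_def)
    ultimately show ?thesis using period_jump_iff[OF rF, of c] th h by simp
  qed
qed

lemma above_not_at: "above_last_exponent F M \<Longrightarrow> \<not> at_last_exponent F M"
  by (auto simp: above_last_exponent_def at_last_exponent_def)

text \<open>The degree of a member of \<open>D\<close> is its period at \<open>c + 1\<close>.
  Members without a jump have the common period at \<open>c\<close> as degree, and jumping members
  share the larger value.\<close>

lemma D_sum:
  assumes theta: "\<theta> = (LEAST k. 1 \<le> k \<and> (\<forall>F\<in>P. ereal level \<le> char_exponent F k))"
  shows "if (\<forall>F\<in>D. above_last_exponent F level) \<or> (\<forall>F\<in>D. at_last_exponent F level)
        then \<exists>nD. (\<forall>F\<in>D. degree F = nD) \<and> (\<Sum>F\<in>D. degree F) = card D * nD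
        else \<exists>F'. F' \<in> D \<and> above_last_exponent F' level \<and>
                  (\<forall>F\<in>D. above_last_exponent F level \<longrightarrow> F = F') \<and>
                  (\<exists>nD dD. (\<forall>F\<in>D - {F'}. degree F = nD \<and> char_d F (char_h F) = dD) \<and>
                      (\<Sum>F\<in>D. real (degree F)) =
                        (real (card D) - 1) * real nD + real nD / real dD)"
proof -
  note cases = D_cases[OF theta]
  have above: "degree F = period F c" "period F (c + 1) = period F c" if "F \<in> D" "above_last_exponent F level" for F
    using cases[OF that(1)] D_period[OF that(1)] above_not_at[OF that(2)] by auto
  have at: "period F (c + 1) \<noteq> period F c" "char_h F = \<theta>" if "F \<in> D" "\<not> above_last_exponent F level" for F
    using cases[OF that(1)] that(2) by auto
  have degree_at: "degree F = degree G" if "F \<in> D" "G \<in> D" "\<not> above_last_exponent F level" "\<not> above_last_exponent G level" for F G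
    using period_jump_eq[OF D_subset[OF that(1)] D_subset[OF that(2)]] at(1) that D_period by metis
  show ?thesis
  proof (cases "(\<forall>F\<in>D. above_last_exponent F level) \<or> (\<forall>F\<in>D. at_last_exponent F level)")
    case True
    have "degree F = degree G" if FG: "F \<in> D" "G \<in> D" for F G
    proof (cases "\<forall>F\<in>D. above_last_exponent F level")
      case True
      then show ?thesis using above(1) FG period_P D_subset by metis
    next
      case False
      with True have "\<forall>F\<in>D. \<not> above_last_exponent F level" using above_not_at by blast
      with FG degree_at show ?thesis by blast
    qed
    then obtain n where "\<forall>F\<in>D. degree F = n" by metis
    then show ?thesis using True by auto
  next
    case False
    then obtain F' F1 where F': "F' \<in> D" "above_last_exponent F' level"
      and F1: "F1 \<in> D" "\<not> above_last_exponent F1 level"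
      using cases by blast
    \<comment> \<open>As \<open>F1\<close> jumps, two members without a jump have contact greater
      than \<open>M\<close>; but a member of \<open>D\<close> is alone in its class at radius
      \<open>c + 1\<close>.\<close>
    have uniq: "F = F'" if F: "F \<in> D" "above_last_exponent F level" for F
    proof -
      have P: "F \<in> P" "F' \<in> P" "F1 \<in> P" using D_subset F F' F1 by auto
      have "near (c + 1) F F'"
        by (rule contact_of_no_jump[OF P_rooted[OF P(1)] P_rooted[OF P(2)] P_rooted[OF P(3)]
              P_contact[OF P(1,2)] P_contact[OF P(1,3)] at(1)[OF F1] above(2)[OF F] above(2)[OF F']])
      then have "F' \<in> above F" using P_components[OF P(2)] by (simp add: above_def)
      then show ?thesis using D_above[OF F(1)] by simp
    qed
    define n d where "n = degree F1" and "d = char_d F1 \<theta>"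
    have th: "\<theta> = char_index F c" if "F \<in> D" for F using theta theta_eq[OF D_subset[OF that]] by simp
    \<comment> \<open>\<open>n_F/d_\<theta>\<close> is the period at \<open>c\<close>, common to
      \<open>P\<close>, and for \<open>F'\<close> this is the whole degree. Hence the summand
      \<open>n(D)/d(D)\<close> is the degree of \<open>F'\<close>.\<close>
    have quot: "real (degree F) / real (char_d F \<theta>) = real (degree F')" if "F \<in> D" for F
      using period_quotient(1)[OF D_subset[OF that]] th[OF that] above(1)[OF F'] 
        period_P[OF D_subset[OF that] D_subset[OF F'(1)]] by simp
    have rest: "degree F = n \<and> char_d F (char_h F) = d" if "F \<in> D - {F'}" for F
    proof -
      have F: "F \<in> D" "\<not> above_last_exponent F level" using that uniq by auto
      have "degree F = n" using degree_at[OF F(1) F1(1) F(2) F1(2)] by (simp add: n_def)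
      moreover have "char_d F \<theta> = d"
      proof -
        have cancel: "a = b" if "x / a = p" "x / b = p" "p \<noteq> 0" for a b x p :: real
        proof -
          from that have "a \<noteq> 0" "b \<noteq> 0" by auto
          with that show ?thesis by (auto simp: field_simps)
        qed
        have "degree F' > 0" using rooted_degree_pos[OF P_rooted[OF D_subset[OF F'(1)]]] .
        then have "real (char_d F \<theta>) = real d"
          using cancel[of "real n" "real (char_d F \<theta>)" "real (degree F')" "real d"]
            quot[OF F(1)] quot[OF F1(1)] \<open>degree F = n\<close> by (simp add: n_def d_def)
        then show ?thesis by simp
      qed
      ultimately show ?thesis using at(2)[OF F] by simp
    qed
    have "(\<Sum>F\<in>D. real (degree F)) = real (degree F') + (\<Sum>F\<in>D - {F'}. real (degree F))"
      using F'(1) finite_D by (simp add: sum.remove)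
    also have "(\<Sum>F\<in>D - {F'}. real (degree F)) = (\<Sum>F\<in>D - {F'}. real n)"
      using rest by (intro sum.cong) auto
    also have "\<dots> = (real (card D) - 1) * real n"
    proof -
      have "card D > 0" using F'(1) finite_D by (auto simp: card_gt_0_iff)
      then show ?thesis using F'(1) finite_D by (simp add: card_Diff_singleton of_nat_diff)
    qed
    finally have "(\<Sum>F\<in>D. real (degree F)) = (real (card D) - 1) * real n + real n / real d"
      using quot[OF F1(1)] by (simp add: n_def d_def)
    then have "\<exists>nD dD. (\<forall>F\<in>D - {F'}. degree F = nD \<and> char_d F (char_h F) = dD) \<and>
        (\<Sum>F\<in>D. real (degree F)) = (real (card D) - 1) * real nD + real nD / real dD"
      using rest by blast
    then show ?thesis
      unfolding if_not_P[OF False] using F' uniq by blast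
  qed
qed

end

section \<open>Choice of a common ramification index and conclusion\<close>

lemma splits_subst_power:
  assumes "splits (subst_power p g)" "p > 0" "q > 0"
  shows "splits (subst_power (p * q) g)"
proof -
  obtain A where A: "subst_power p g = smult (lead_coeff (subst_power p g)) (\<Prod>x\<in>#A. [:-x, 1:])"
    using assms(1) by blast
  have prod: "subst_power q (\<Prod>x\<in>#A. [:-x, 1:]) = (\<Prod>x\<in>#image_mset (\<lambda>x. fls_compose_power x q) A. [:-x, 1:])" for A
    using assms(3) by (induction A) (simp_all add: subst_power_mult subst_power_pCons del: mult_pCons_left)
  have lead: "lead_coeff (subst_power (p * q) g) = fls_compose_power (lead_coeff (subst_power p g)) q"
    using assms(2,3) by (simp add: degree_subst_power coeff_subst_power fls_compose_power_compose_power)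
  have "subst_power (p * q) g = subst_power q (subst_power p g)"
    using assms(2,3) by (simp add: subst_power_subst_power)
  also have "\<dots> = smult (lead_coeff (subst_power (p * q) g))
    (\<Prod>x\<in>#image_mset (\<lambda>x. fls_compose_power x q) A. [:-x, 1:])"
    unfolding lead by (subst A) (simp only: subst_power_smult prod)
  finally show ?thesis by blast
qed

text \<open>The indices that split \<open>f\<close> and its derivative are multiplied, since
  splitting survives further ramification.\<close>

lemma reduced_polynomial_exists:
  fixes f :: "'a :: {alg_closed_field, field_char_0} fls poly"
  assumes "lead_coeff f = 1" "squarefree f" "pderiv f \<noteq> 0"
  obtains N w where "reduced_polynomial N w f"
proof -
  have "f \<noteq> 0" using assms(1) by auto
  then obtain p where p: "p > 0" and f: "splits (subst_power p f)"
    using newton_puiseux_splits by blast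
  obtain q where q: "q > 0" and df: "splits (subst_power q (pderiv f))"
    using newton_puiseux_splits[OF assms(3)] by blast
  have "p * q > 0" using p q by simp
  then obtain w :: 'a where w: "\<forall>k. w ^ k = 1 \<longleftrightarrow> p * q dvd k"
    using primitive_root_of_unity_exists by blast
  have "reduced_polynomial (p * q) w f"
    using assms(1,2) p q w splits_subst_power[OF f p q] splits_subst_power[OF df q p]
    by unfold_locales (simp_all add: mult.commute)
  with that show ?thesis .
qed

theorem theorem7p7:
  fixes f :: "'a :: {alg_closed_field, field_char_0} fls poly"
    and M :: real and P :: "'a fls poly set" and \<theta> :: nat
    and A B :: "'a tree_point set" and p1 p2 :: "'a tree_point" and F1 F2 :: "'a fls poly"
    and Q :: "'a fls poly" and D :: "'a fls poly set"
  assumes monic: "lead_coeff f = 1" and reduced: "squarefree f"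
    and point: "(M, P) \<in> tree_points f" and not_top: "(M, P) \<notin> tree_top f"
    and theta: "\<theta> = (LEAST k. 1 \<le> k \<and> (\<forall>F\<in>P. ereal M \<le> char_exponent F k))"
    and A_eq: "A = {q \<in> strict_dominators f (M, P). \<forall>F\<in>snd q. ereal M = char_exponent F \<theta>}"
    and B_eq: "B = {q \<in> strict_dominators f (M, P). \<forall>F\<in>snd q. ereal M < char_exponent F \<theta>}"
    and F1: "A \<noteq> {} \<Longrightarrow> p1 \<in> A \<and> F1 \<in> snd p1"
    and F2: "if B \<noteq> {} then p2 \<in> B \<and> F2 \<in> snd p2 else F2 \<in> P"
    and Q_eq: "Q = Q_part (pderiv f) (M, P)"
    and D_eq: "D = point_D f (M, P)"
  shows
    "real (degree Q) =
       (if A = {} then 0 else real (card A) * (real (degree F1) / real (char_d F1 (\<theta> + 1))))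
       + (real (card B) - 1) * (real (degree F2) / real (char_d F2 \<theta>))
       + (\<Sum>F\<in>D. real (degree F))
     \<and>
     (D \<noteq> {} \<longrightarrow>
       (\<forall>F\<in>D. (above_last_exponent F M \<and> char_h F = \<theta> - 1) \<or>
              (at_last_exponent F M \<and> char_h F = \<theta>)) \<and>
       (if (\<forall>F\<in>D. above_last_exponent F M) \<or> (\<forall>F\<in>D. at_last_exponent F M)
        then \<exists>nD. (\<forall>F\<in>D. degree F = nD) \<and> (\<Sum>F\<in>D. degree F) = card D * nD
        else \<exists>F'. F' \<in> D \<and> above_last_exponent F' M \<and>
                  (\<forall>F\<in>D. above_last_exponent F M \<longrightarrow> F = F') \<and>
                  (\<exists>nD dD. (\<forall>F\<in>D - {F'}. degree F = nD \<and> char_d F (char_h F) = dD) \<and>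
                      (\<Sum>F\<in>D. real (degree F)) =
                        (real (card D) - 1) * real nD + real nD / real dD)))
     \<and>
     (\<forall>G\<in>components Q. \<forall>F\<in>P. contact F G = ereal M)
     \<and>
     (\<forall>G\<in>components Q. \<forall>F\<in>components f - P.
        contact F G = contact_point F P \<and> contact_point F P < ereal M)
     \<and>
     (\<forall>F\<in>components f.
        intersection F Q =
          ereal (char_S F (if F \<in> P then M else real_of_ereal (contact_point F P))
                 * (real (degree Q) / real (degree F))))"
proof -
  have ne: "components f \<noteq> {}"
    using point by (auto simp: tree_points_def tree_levels_def)
  have "f \<noteq> 0" using monic by auto
  \<comment> \<open>A monic constant is 1 and has no irreducible factors, whereas a point of the
    tree requires a component.\<close>
  have "pderiv f \<noteq> 0"
  proof
    assume "pderiv f = 0"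
    then have "degree f = 0" by (simp add: pderiv_eq_0_iff)
    with monic have "f = 1" by (metis degree_eq_zeroE lead_coeff_pCons(2) one_pCons)
    with ne show False by (auto simp: components_def irreducible_def)
  qed
  then obtain N w where red: "reduced_polynomial N w f"
    using reduced_polynomial_exists monic reduced by blast
  interpret reduced_polynomial N w f by (rule red)
  have "M \<in> tree_levels f" using point tree_point_iff by blast
  \<comment> \<open>Levels are contacts of distinct components or characteristic exponents, hence
    multiples of \<open>1 / N\<close>.\<close>
  then obtain c where M: "M = of_int c / of_nat N" by (rule tree_level_real)
  interpret tree_point N w f c P by unfold_locales (use point M in simp)
  have Q: "Q = Q_part (pderiv f) (level, P)" using Q_eq M by simp
  have contact: "G \<in> components (pderiv f)" "\<And>F. F \<in> P \<Longrightarrow> contact F G = ereal level"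
    if "G \<in> components Q" for G
    using components_Q_part[of G "pderiv f" "(level, P)"] that \<open>pderiv f \<noteq> 0\<close> by (auto simp: Q)
  have inside: "\<forall>G\<in>components Q. \<forall>F\<in>P. contact F G = ereal M"
    using contact M by simp
  have outside: "\<forall>G\<in>components Q. \<forall>F\<in>components f - P.
      contact F G = contact_point F P \<and> contact_point F P < ereal M"
  proof (intro ballI conjI)
    fix G F assume "G \<in> components Q" "F \<in> components f - P"
    then show "contact F G = contact_point F P"
      using contact_Q_part_outside[OF cluster] by (simp add: Q)
    obtain d where "contact_point F P = ereal (of_int d / of_nat N)" "d < c"
      using contact_point_less[OF cluster \<open>F \<in> _\<close>] .
    then show "contact_point F P < ereal M" using level_less_iff[of d c] by (simp add: M)
  qed
  note theta' = theta[unfolded M]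
  have last: "\<forall>F\<in>D. (above_last_exponent F M \<and> char_h F = \<theta> - 1) \<or> (at_last_exponent F M \<and> char_h F = \<theta>)"
    using D_cases[OF theta'] unfolding D_eq M by blast
  note degree = degree_Q_formula[OF theta' A_eq[unfolded M] B_eq[unfolded M] F1 F2, folded M D_eq Q_eq]
  note int = intersection_Q_part[OF cluster, folded M Q_eq]
  show ?thesis
    by (intro conjI impI degree last D_sum[OF theta', folded M D_eq] inside outside ballI int)
qed

end
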